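(* Consider the general linear $D_2Q_9$ lattice Boltzmann scheme described in the context, with full equilibrium matrix $E$ and relaxation parameters $s_\varepsilon,s_{\varepsilon_2},s_{\varphi_x},s_{\varphi_y},s_{\varphi_{xx}},s_{\varphi_{xy}}\in(0,2)$. Let $\sigma_k=1/s_k-1/2>0$ for each index $k$. For $r\in SO_2(\mathbb R)$ let $L_5(r)=\sum_{n=1}^{5}\bigl(\Phi_n(r)(A_n)-A_n\bigr)\Delta t^n$ be the lack of isotropy of the scheme at fifth order. Then the following hold. 1. The scheme is isotropic at first order, that is $L_5(r)=O(\Delta t^2)$ for all $r\in SO_2(\mathbb R)$, if and only if $$E_\varepsilon^{q_x}=E_\varepsilon^{q_y}=E_{\varphi_{xx}}^{\rho}=E_{\varphi_{xx}}^{q_x}=E_{\varphi_{xx}}^{q_y}=E_{\varphi_{xy}}^{\rho}=E_{\varphi_{xy}}^{q_x}=E_{\varphi_{xy}}^{q_y}=0 .$$ 2. The scheme is isotropic at second order, that is $L_5(r)=O(\Delta t^3)$ for all $r\in SO_2(\mathbb R)$, if and only if it is isotropic at first order, $E_{\varphi_x}^{\rho}=E_{\varphi_x}^{q_y}=E_{\varphi_y}^{\rho}=E_{\varphi_y}^{q_x}=0$, and $$E_{\varphi_x}^{q_x}=E_{\varphi_y}^{q_y}=\frac{\sigma_{\varphi_{xx}}-4\sigma_{\varphi_{xy}}}{2\sigma_{\varphi_{xy}}+\sigma_{\varphi_{xx}}}.$$ 3. The scheme is isotropic at third order, that is $L_5(r)=O(\Delta t^4)$ for all $r\in SO_2(\mathbb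 R)$, if and only if the following three properties hold: - it is isotropic at second order; - $\sigma_{\varphi_{xx}}=\sigma_{\varphi_{xy}}$ and $E_{\varphi_x}^{q_x}=-1$; - at least one of the following is satisfied: (i) $2E_{\varepsilon_2}^{\rho}+4+3E_\varepsilon^\rho=0$ and $E_{\varepsilon_2}^{q_x}=E_{\varepsilon_2}^{q_y}=0$; (ii) $\sigma_{\varphi_x}=\sigma_{\varphi_y}=1/(12\sigma_{\varphi_{xx}})$ and $E_{\varepsilon_2}^{q_x}=E_{\varepsilon_2}^{q_y}=0$; (iii) $\sigma_{\varphi_x}=\sigma_{\varphi_y}=1/(12\sigma_{\varphi_{xx}})$ and $\sigma_{\varphi_{xx}}=\sigma_\varepsilon$. 4. The scheme is isotropic at fourth order, that is $L_5(r)=O(\Delta t^5)$ for all $r\in SO_2(\mathbb R)$, if and only if the following three properties hold: - it is isotropic at third order; - $2E_{\varepsilon_2}^{\rho}+4+3E_\varepsilon^\rho=0$, $\sigma_\varepsilon=\sigma_{\varphi_{xx}}$, $E_{\varepsilon_2}^{q_x}=E_{\varepsilon_2}^{q_y}=0$, and $\sigma_{\varphi_x}=\sigma_{\varphi_y}=1/(6\sigma_{\varphi_{xx}})$; - $2+3E_\varepsilon^\rho=0$ or $\sigma_{\varepsilon_2}=\sigma_{\varphi_{xx}}$. 5. The scheme is never isotropic at fifth order: for no choice of the parameters does $L_5(r)=O(\Delta t^6)$ hold for all $r\in SO_2(\mathbb R)$.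
   Context: **Lattice and velocities.** Space dimension $d=2$; the velocity scale $\lambda>0$ is fixed, and $\Delta t=\Delta x/\lambda$. The $D_2Q_9$ scheme has $q=9$ velocities $v_j=(v_j^x,v_j^y)$: $(0,0)$, $(\pm\lambda,0)$, $(0,\pm\lambda)$, $(\pm\lambda,\pm\lambda)$. The distribution is $f=(f_j)_{0\le j\le 8}$. **Moments.** The moment vector is $(W,Y)=Mf$, where each moment is $\sum_j p(v_j)f_j$ for the polynomial $p(v)$ below, with $v=(v^x,v^y)$ and $|v|^2=(v^x)^2+(v^y)^2$. Conserved moments $W=(\rho,q_x,q_y)$ ($N=3$): $1,\ v^x,\ v^y$. Non-conserved moments $Y=(m_\varepsilon,m_{\varepsilon_2},m_{\varphi_x},m_{\varphi_y},m_{\varphi_{xx}},m_{\varphi_{xy}})$, orthogonalized (the rows of $M$ are pairwise orthogonal): - $m_\varepsilon$: $3|v|^2-4\lambda^2$; - $m_{\varepsilon_2}$: $\tfrac92|v|^4-\tfrac{21}{2}\lambda^2|v|^2+4\lambda^4$; - $m_{\varphi_x}$: $(3|v|^2-5\lambda^2)v^x$; $m_{\varphi_y}$: $(3|v|^2-5\lambda^2)v^y$; - $m_{\varphi_{xx}}$: $(v^x)^2-(v^y)^2$; $m_{\varphi_{xy}}$: $v^xv^y$. **Equilibrium and relaxation.** $Y^{eq}=EW$ with the full real $6\times3$ matrix $$E=\begin{pmatrix} E_\varepsilon^\rho\lambda^2&E_\varepsilon^{q_x}\lambda&E_\varepsilon^{q_y}\lambda\\ E_{\varepsilon_2}^\rho\lambda^4&E_{\varepsilon_2}^{q_x}\lambda^3&E_{\varepsilon_2}^{q_y}\lambda^3\\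 E_{\varphi_x}^\rho\lambda^3&E_{\varphi_x}^{q_x}\lambda^2&E_{\varphi_x}^{q_y}\lambda^2\\ E_{\varphi_y}^\rho\lambda^3&E_{\varphi_y}^{q_x}\lambda^2&E_{\varphi_y}^{q_y}\lambda^2\\ E_{\varphi_{xx}}^\rho\lambda^2&E_{\varphi_{xx}}^{q_x}\lambda&E_{\varphi_{xx}}^{q_y}\lambda\\ E_{\varphi_{xy}}^\rho\lambda^2&E_{\varphi_{xy}}^{q_x}\lambda&E_{\varphi_{xy}}^{q_y}\lambda \end{pmatrix},$$ and $S=\mathrm{Diag}(s_\varepsilon,s_{\varepsilon_2},s_{\varphi_x},s_{\varphi_y},s_{\varphi_{xx}},s_{\varphi_{xy}})$ with all entries in $(0,2)$. The relaxation step is $W^*=W$, $Y^*=Y+S(EW-Y)$, i.e. multiplication of the moment vector by $J=\begin{pmatrix} \mathrm{Id}_3 & 0 \\ S\,E & \mathrm{Id}_6-S \end{pmatrix}$. With $f^*=M^{-1}JMf$, one time step is $f_j(x+v_j\Delta t,t+\Delta t)=f_j^*(x,t)$. **Equivalent equations.** Formally, in terms of constant-coefficient differential operators, one time step is $f(t+\Delta t)=e^{-\Delta t\,\Lambda}M^{-1}JM f(t)$ with $\Lambda=\mathrm{diag}(v_j\cdot\nabla)$. There is a unique pair of formal power series in $\Delta t$, with coefficients matrices of constant-coefficient differential operators in $(x,y)$, consisting of a $9\times3$ matrix $\Psi$ whose first three rows form $\mathrm{Id}_3$ and a $3\times3$ matrix $\mathcal A$, such that $Me^{-\Delta t\Lambda}M^{-1}J\,\Psi=\Psi\,e^{-\Delta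 t\mathcal A}$. It has the form $\mathcal A=\sum_{n\ge1}\Delta t^{\,n-1}A_n\odot\nabla^n$, where $(A_n\odot\nabla^nW)^i=\sum_{j=1}^{3}\sum_{\alpha_1,\dots,\alpha_n\in\{1,2\}}A_{n,j}^{i,\alpha_1\cdots\alpha_n}\partial_{\alpha_1}\cdots\partial_{\alpha_n}W^j$ and $A_n$ does not depend on $\Delta t$. The equivalent equations of order $m$ are $\partial_tW+\sum_{n=1}^m\Delta t^{\,n-1}A_n\odot\nabla^nW=0$. Tensors $A_n$ are identified when they define the same differential operator (equivalently, they are taken symmetric in $\alpha_1,\dots,\alpha_n$). **Isotropy.** For $r\in SO_2(\mathbb R)$ let $R(r)=\begin{pmatrix}1&0\\0&r\end{pmatrix}$ and $$\bigl(\Phi_n(r)(A)\bigr)^{i,\alpha_1\cdots\alpha_n}_j=\sum_{\beta_1,\dots,\beta_n=1}^{2}\ \sum_{k,l=1}^{3}R(r)^i_l\,A^{l,\beta_1\cdots\beta_n}_k\,r^{\alpha_1}_{\beta_1}\cdots r^{\alpha_n}_{\beta_n}\,(R(r)^{-1})^k_j .$$ The scheme is isotropic at order $m$ if $\Phi_n(r)(A_n)=A_n$ for all $r\in SO_2(\mathbb R)$ and all $1\le n\le m$. *)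

theory Defs
  imports "HOL-Analysis.Analysis" "HOL-Library.Landau_Symbols" "HOL-Library.Multiset"
begin

datatype dir = Neg | Zero | Pos

datatype conserved = Rho | Qx | Qy

datatype nonconserved = Epsi | Epsi2 | PhiX | PhiY | PhiXX | PhiXY

instance dir :: finite
proof
  have "UNIV = {Neg, Zero, Pos}" by (auto intro: dir.exhaust)
  then show "finite (UNIV :: dir set)" by (metis finite.emptyI finite_insert)
qed

instance conserved :: finite
proof
  have "UNIV = {Rho, Qx, Qy}" by (auto intro: conserved.exhaust)
  then show "finite (UNIV :: conserved set)" by (metis finite.emptyI finite_insert)
qed

instance nonconserved :: finite
proof
  have "UNIV = {Epsi, Epsi2, PhiX, PhiY, PhiXX, PhiXY}" by (auto intro: nonconserved.exhaust)
  then show "finite (UNIV :: nonconserved set)" by (metis finite.emptyI finite_insert)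
qed

text \<open>The nine velocities of the D2Q9 scheme are indexed by \<^typ>\<open>dir \<times> dir\<close> and the nine moments
  by \<^typ>\<open>conserved + nonconserved\<close>. A matrix of type \<^typ>\<open>'a^'n^'m\<close> has rows indexed by
  \<^typ>\<open>'m\<close> and columns by \<^typ>\<open>'n\<close>. The parameter \<open>lam\<close> is the velocity scale \<open>\<lambda>\<close>.\<close>

type_synonym velocity = "dir \<times> dir"
type_synonym moment = "conserved + nonconserved"

primrec dir_coord :: "dir \<Rightarrow> real" where
  "dir_coord Neg = -1"
| "dir_coord Zero = 0"
| "dir_coord Pos = 1"

definition vel_x :: "real \<Rightarrow> velocity \<Rightarrow> real" where
  "vel_x lam v = lam * dir_coord (fst v)"

definition vel_y :: "real \<Rightarrow> velocity \<Rightarrow> real" where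
  "vel_y lam v = lam * dir_coord (snd v)"

fun moment_poly :: "real \<Rightarrow> moment \<Rightarrow> real \<Rightarrow> real \<Rightarrow> real" where
  "moment_poly lam (Inl Rho) x y = 1"
| "moment_poly lam (Inl Qx) x y = x"
| "moment_poly lam (Inl Qy) x y = y"
| "moment_poly lam (Inr Epsi) x y = 3 * (x^2 + y^2) - 4 * lam^2"
| "moment_poly lam (Inr Epsi2) x y =
     9/2 * (x^2 + y^2)^2 - 21/2 * lam^2 * (x^2 + y^2) + 4 * lam^4"
| "moment_poly lam (Inr PhiX) x y = (3 * (x^2 + y^2) - 5 * lam^2) * x"
| "moment_poly lam (Inr PhiY) x y = (3 * (x^2 + y^2) - 5 * lam^2) * y"
| "moment_poly lam (Inr PhiXX) x y = x^2 - y^2"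
| "moment_poly lam (Inr PhiXY) x y = x * y"

definition moment_matrix :: "real \<Rightarrow> real^velocity^moment" where
  "moment_matrix lam = (\<chi> i v. moment_poly lam i (vel_x lam v) (vel_y lam v))"


subsection \<open>Equilibrium and relaxation\<close>

text \<open>\<open>e k j\<close> is the dimensionless coefficient \<open>E\<^sub>k\<^sup>j\<close>; in the equilibrium matrix it is multiplied by
  \<open>\<lambda>\<close> to the power (degree of moment \<open>k\<close>) - (degree of moment \<open>j\<close>), which is always positive.\<close>

primrec conserved_degree :: "conserved \<Rightarrow> nat" where
  "conserved_degree Rho = 0"
| "conserved_degree Qx = 1"
| "conserved_degree Qy = 1"

primrec nonconserved_degree :: "nonconserved \<Rightarrow> nat" where
  "nonconserved_degree Epsi = 2"
| "nonconserved_degree Epsi2 = 4"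
| "nonconserved_degree PhiX = 3"
| "nonconserved_degree PhiY = 3"
| "nonconserved_degree PhiXX = 2"
| "nonconserved_degree PhiXY = 2"

definition equilibrium_matrix ::
  "real \<Rightarrow> (nonconserved \<Rightarrow> conserved \<Rightarrow> real) \<Rightarrow> real^conserved^nonconserved" where
  "equilibrium_matrix lam e =
     (\<chi> k j. e k j * lam ^ (nonconserved_degree k - conserved_degree j))"

definition relaxation_matrix :: "(nonconserved \<Rightarrow> real) \<Rightarrow> real^nonconserved^nonconserved" where
  "relaxation_matrix s = (\<chi> k l. if k = l then s k else 0)"

definition relax_sigma :: "(nonconserved \<Rightarrow> real) \<Rightarrow> nonconserved \<Rightarrow> real" where
  "relax_sigma s k = 1 / s k - 1 / 2"

definition collision_matrix ::
  "real \<Rightarrow> (nonconserved \<Rightarrow> conserved \<Rightarrow> real) \<Rightarrow> (nonconserved \<Rightarrow> real) \<Rightarrow> real^moment^moment" where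
  "collision_matrix lam e s = (\<chi> a b. case (a, b) of
       (Inl i, Inl j) \<Rightarrow> mat 1 $ i $ j
     | (Inl i, Inr l) \<Rightarrow> 0
     | (Inr k, Inl j) \<Rightarrow> (relaxation_matrix s ** equilibrium_matrix lam e) $ k $ j
     | (Inr k, Inr l) \<Rightarrow> (mat 1 - relaxation_matrix s) $ k $ l)"


subsection \<open>Equivalent equations\<close>

text \<open>The ring of constant-coefficient differential operators in \<open>(x, y)\<close> is the polynomial ring in the
  two commuting indeterminates \<open>\<partial>\<^sub>1\<close> (inner polynomial variable) and \<open>\<partial>\<^sub>2\<close> (outer one).
  Formal power series over it are power series in \<open>\<Delta>t\<close>, with \<open>\<Delta>t\<close> represented by
  \<^const>\<open>fps_X\<close>.\<close>

type_synonym diffop = "real poly poly"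

definition diffop_const :: "real \<Rightarrow> diffop" where
  "diffop_const c = [:[:c:]:]"

definition partial :: "2 \<Rightarrow> diffop" where
  "partial \<alpha> = (if \<alpha> = 1 then [:[:0, 1:]:] else [:0, 1:])"

definition lift_matrix :: "real^'n^'m \<Rightarrow> diffop fps^'n^'m" where
  "lift_matrix = map_matrix (\<lambda>c. fps_const (diffop_const c))"

primrec matrix_power :: "'a::semiring_1^'n^'n \<Rightarrow> nat \<Rightarrow> 'a^'n^'n" where
  "matrix_power B 0 = mat 1"
| "matrix_power B (Suc k) = B ** matrix_power B k"

text \<open>\<open>\<Sum>\<^sub>k B\<^sup>k / k!\<close> for a matrix \<open>B\<close> divisible by \<open>\<Delta>t\<close>: then \<open>B\<^sup>k\<close> does not contribute to the
  coefficient of order \<open>n\<close> when \<open>k > n\<close>. It is only used for such \<open>B\<close>.\<close>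

definition formal_exp :: "diffop fps^'n^'n \<Rightarrow> diffop fps^'n^'n" where
  "formal_exp B = (\<chi> i j. Abs_fps (\<lambda>n.
     \<Sum>k\<le>n. diffop_const (1 / fact k) * fps_nth (matrix_power B k $ i $ j) n))"

definition minus_dt_times :: "diffop fps^'n^'n \<Rightarrow> diffop fps^'n^'n" where
  "minus_dt_times = map_matrix (\<lambda>f. - (fps_X * f))"

definition advection_matrix :: "real \<Rightarrow> diffop fps^velocity^velocity" where
  "advection_matrix lam = (\<chi> v w. if v = w
     then fps_const (diffop_const (vel_x lam v) * partial 1 + diffop_const (vel_y lam v) * partial 2)
     else 0)"

definition time_step_matrix ::
  "real \<Rightarrow> (nonconserved \<Rightarrow> conserved \<Rightarrow> real) \<Rightarrow> (nonconserved \<Rightarrow> real) \<Rightarrow> diffop fps^moment^moment"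
where
  "time_step_matrix lam e s =
     lift_matrix (moment_matrix lam) ** formal_exp (minus_dt_times (advection_matrix lam))
       ** lift_matrix (matrix_inv (moment_matrix lam)) ** lift_matrix (collision_matrix lam e s)"

definition is_equivalent_pair ::
  "real \<Rightarrow> (nonconserved \<Rightarrow> conserved \<Rightarrow> real) \<Rightarrow> (nonconserved \<Rightarrow> real) \<Rightarrow>
   diffop fps^conserved^moment \<Rightarrow> diffop fps^conserved^conserved \<Rightarrow> bool" where
  "is_equivalent_pair lam e s \<Psi> \<A> \<longleftrightarrow>
     (\<forall>i j. \<Psi> $ Inl i $ j = mat 1 $ i $ j) \<and>
     time_step_matrix lam e s ** \<Psi> = \<Psi> ** formal_exp (minus_dt_times \<A>)"

definition equivalent_operator ::
  "real \<Rightarrow> (nonconserved \<Rightarrow> conserved \<Rightarrow> real) \<Rightarrow> (nonconserved \<Rightarrow> real) \<Rightarrow>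
   diffop fps^conserved^conserved" where
  "equivalent_operator lam e s =
     snd (THE p. is_equivalent_pair lam e s (fst p) (snd p))"


subsection \<open>Tensors\<close>

text \<open>\<open>T i \<alpha> j\<close> is the component with upper indices \<open>i\<close>, \<open>\<alpha>\<^sub>1, \<dots>, \<alpha>\<^sub>n\<close> and lower index \<open>j\<close>. A tensor with
  \<open>n\<close> spatial indices is a function that vanishes unless \<open>\<alpha>\<close> has length \<open>n\<close>, so that tensors with
  different numbers of spatial indices can be added, as in a direct sum.\<close>

type_synonym tensor = "conserved \<Rightarrow> 2 list \<Rightarrow> conserved \<Rightarrow> real"

definition is_tensor :: "nat \<Rightarrow> tensor \<Rightarrow> bool" where
  "is_tensor n T \<longleftrightarrow> (\<forall>i \<alpha> j. length \<alpha> \<noteq> n \<longrightarrow> T i \<alpha> j = 0)"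

definition symmetric_tensor :: "tensor \<Rightarrow> bool" where
  "symmetric_tensor T \<longleftrightarrow> (\<forall>i \<alpha> \<beta> j. mset \<alpha> = mset \<beta> \<longrightarrow> T i \<alpha> j = T i \<beta> j)"

definition tensor_operator :: "nat \<Rightarrow> tensor \<Rightarrow> diffop^conserved^conserved" where
  "tensor_operator n T =
     (\<chi> i j. \<Sum>\<alpha> | length \<alpha> = n. diffop_const (T i \<alpha> j) * prod_list (map partial \<alpha>))"

definition equivalent_tensor ::
  "real \<Rightarrow> (nonconserved \<Rightarrow> conserved \<Rightarrow> real) \<Rightarrow> (nonconserved \<Rightarrow> real) \<Rightarrow> nat \<Rightarrow> tensor" where
  "equivalent_tensor lam e s n = (THE T. is_tensor n T \<and> symmetric_tensor T \<and>
     tensor_operator n T = map_matrix (\<lambda>f. fps_nth f (n - 1)) (equivalent_operator lam e s))"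


subsection \<open>Isotropy\<close>

definition conserved_rotation :: "real^2^2 \<Rightarrow> real^conserved^conserved" where
  "conserved_rotation r = (\<chi> i j. case (i, j) of
       (Rho, Rho) \<Rightarrow> 1
     | (Qx, Qx) \<Rightarrow> r $ 1 $ 1
     | (Qx, Qy) \<Rightarrow> r $ 1 $ 2
     | (Qy, Qx) \<Rightarrow> r $ 2 $ 1
     | (Qy, Qy) \<Rightarrow> r $ 2 $ 2
     | _ \<Rightarrow> 0)"

definition tensor_rotation :: "nat \<Rightarrow> real^2^2 \<Rightarrow> tensor \<Rightarrow> tensor" where
  "tensor_rotation n r T i \<alpha> j = (if length \<alpha> = n then
     (\<Sum>\<beta> | length \<beta> = n. \<Sum>k\<in>UNIV. \<Sum>l\<in>UNIV.
        conserved_rotation r $ i $ l * T l \<beta> k * (\<Prod>m<n. r $ (\<alpha> ! m) $ (\<beta> ! m))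
          * matrix_inv (conserved_rotation r) $ k $ j)
     else 0)"

definition isotropic_at_order ::
  "real \<Rightarrow> (nonconserved \<Rightarrow> conserved \<Rightarrow> real) \<Rightarrow> (nonconserved \<Rightarrow> real) \<Rightarrow> nat \<Rightarrow> bool" where
  "isotropic_at_order lam e s m \<longleftrightarrow>
     (\<forall>r. rotation_matrix r \<longrightarrow> (\<forall>n\<in>{1..m}.
        tensor_rotation n r (equivalent_tensor lam e s n) = equivalent_tensor lam e s n))"

definition lack_of_isotropy5 ::
  "real \<Rightarrow> (nonconserved \<Rightarrow> conserved \<Rightarrow> real) \<Rightarrow> (nonconserved \<Rightarrow> real) \<Rightarrow> real^2^2 \<Rightarrow> real \<Rightarrow> tensor"
where
  "lack_of_isotropy5 lam e s r dt i \<alpha> j =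
     (\<Sum>n=1..5. (tensor_rotation n r (equivalent_tensor lam e s n) i \<alpha> j
                  - equivalent_tensor lam e s n i \<alpha> j) * dt ^ n)"

definition lack_of_isotropy5_bigo ::
  "real \<Rightarrow> (nonconserved \<Rightarrow> conserved \<Rightarrow> real) \<Rightarrow> (nonconserved \<Rightarrow> real) \<Rightarrow> nat \<Rightarrow> bool" where
  "lack_of_isotropy5_bigo lam e s p \<longleftrightarrow>
     (\<forall>r. rotation_matrix r \<longrightarrow> (\<forall>i \<alpha> j.
        (\<lambda>dt. lack_of_isotropy5 lam e s r dt i \<alpha> j) \<in> O[at_right 0](\<lambda>dt. dt ^ p)))"

end

theory Submission
  imports Defs "HOL-Combinatorics.Permutations"
begin

text \<open>
  Let \<open>\<Psi>\<close> and \<open>\<A>\<close> be the equivalent pair and write \<open>L X = \<Gamma> X - X \<A>\<close>, where \<open>\<Gamma> = M \<Lambda> M\<^sup>-\<^sup>1\<close>. The scheme says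
  \<open>J \<Psi> = exp (\<Delta>t L) \<Psi>\<close>, hence the difference \<open>D = J \<Psi> - \<Psi>\<close> and the average \<open>V = (J \<Psi> + \<Psi>) / 2\<close> satisfy
  \<open>D = 2 tanh (\<Delta>t L / 2) V\<close>, which only involves odd powers of \<open>L\<close>. Moreover the conserved rows of
  \<open>D\<close> vanish and its other rows are related to those of \<open>V\<close> by \<open>V = E - \<sigma> D\<close>; this is why the
  parameters \<open>\<sigma> = 1 / s - 1 / 2\<close> appear. Comparing coefficients gives a short recursion for the
  symbols of the \<open>A\<^sub>n\<close>.

  Isotropy at order \<open>n\<close> means that the symbol satisfies \<open>A\<^sub>n(r \<xi>) = R(r) A\<^sub>n(\<xi>) R(r)\<^sup>-\<^sup>1\<close>. Evaluating this at
  a few rational rotations yields the conditions one order at a time, and each order is computed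
  only under the conditions found at the previous ones. At fifth order the entry
  \<open>(\<rho>, q\<^sub>x)\<close> of the symbol gives a numerical contradiction.
\<close>

section \<open>Landau symbols of polynomials\<close>

text \<open>The obstacle is size: the exponential of a 9 x 9 matrix of operators with 24 free
  parameters has unmanageable entries. In velocity coordinates \<Lambda> is diagonal, so row v of
  M^-1 J \<Psi> is row v of M^-1 \<Psi> times exp(\<Delta>t (c - \<A>)) with a scalar c; scalars
  commute with \<A>, and no 9 x 9 exponential is ever expanded. Since tanh is odd, only the
  corrections -L^3/12 and L^5/120 occur up to fifth order, and weights \<lambda>^degree remove
  \<lambda> from all formulas. \<A> and the tensors are given by definite descriptions, so unique
  existence has to be settled before any computation; homogeneity of the coefficients is what makes
  a symmetric tensor available. A few rotations give only necessary conditions. Sufficiency comes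
  from exhibiting the symbol in a visibly isotropic form, built from \<xi>, |\<xi>|^2 and the matrix
  \<xi> \<xi>^T. The contradiction at fifth order is uniform: under the fourth order conditions the
  entry (\<rho>, q_x) is a multiple of x |\<xi>|^4 plus x^5/270, whatever the remaining parameters
  are.\<close>

lemma poly_sum_bigo_iff:
  fixes c :: "nat \<Rightarrow> real"
  shows "(\<lambda>t. \<Sum>n=1..N. c n * t ^ n) \<in> O[at_right 0](\<lambda>t. t ^ p) \<longleftrightarrow> (\<forall>n\<in>{1..N}. n < p \<longrightarrow> c n = 0)"
    (is "?f \<in> _ \<longleftrightarrow> ?R")
proof
  assume R: ?R
  show "?f \<in> O[at_right 0](\<lambda>t. t ^ p)"
  proof (intro big_sum_in_bigo)
    fix n assume n: "n \<in> {1..N}"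
    show "(\<lambda>t. c n * t ^ n) \<in> O[at_right 0](\<lambda>t. t ^ p)"
    proof (cases "n < p")
      case False
      have "eventually (\<lambda>t::real. norm (c n * t ^ n) \<le> \<bar>c n\<bar> * norm (t ^ p)) (at_right 0)"
        unfolding eventually_at_right_field
      proof (intro exI[of _ 1] conjI allI impI)
        fix t :: real assume "0 < t" "t < 1"
        then have "t ^ n \<le> t ^ p" using False by (intro power_decreasing) auto
        then show "norm (c n * t ^ n) \<le> \<bar>c n\<bar> * norm (t ^ p)"
          using \<open>0 < t\<close> by (simp add: abs_mult mult_left_mono)
      qed simp
      then show ?thesis by (rule bigoI)
    qed (use R n in simp)
  qed
next
  assume big: "?f \<in> O[at_right 0](\<lambda>t. t ^ p)"
  show ?R
  proof (rule ccontr)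
    assume "\<not> ?R"
    then have "\<exists>n. n \<in> {1..N} \<and> n < p \<and> c n \<noteq> 0" by blast
    \<comment> \<open>The lowest offending coefficient. Dividing the sum by t^n gives a function
      with limit \<open>c n\<close>, while the bound C t^p with p > n makes the same quotient at
      most C t, so its limit is 0.\<close>
    define n where "n = (LEAST n. n \<in> {1..N} \<and> n < p \<and> c n \<noteq> 0)"
    have n: "n \<in> {1..N} \<and> n < p \<and> c n \<noteq> 0"
      unfolding n_def by (rule LeastI_ex) fact
    have least: "c k = 0" if "k \<in> {1..N}" "k < n" for k
      using not_less_Least[of k "\<lambda>n. n \<in> {1..N} \<and> n < p \<and> c n \<noteq> 0"] that n
      unfolding n_def[symmetric] by auto
    have "((\<lambda>t::real. \<Sum>k=n..N. c k * t ^ (k - n)) \<longlongrightarrow> (\<Sum>k=n..N. c k * 0 ^ (k - n))) (at_right 0)"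
      by (intro tendsto_intros)
    also have "(\<Sum>k=n..N. c k * 0 ^ (k - n)) = c n"
      using n by (subst sum.atLeast_Suc_atMost) (auto intro!: sum.neutral)
    finally have lim: "((\<lambda>t::real. \<Sum>k=n..N. c k * t ^ (k - n)) \<longlongrightarrow> c n) (at_right 0)" .
    obtain C where C: "eventually (\<lambda>t. norm (?f t) \<le> C * norm (t ^ p)) (at_right 0)"
      using big by (auto elim: landau_o.bigE)
    have ev: "eventually (\<lambda>t::real. norm (\<Sum>k=n..N. c k * t ^ (k - n)) \<le> C * t) (at_right 0)"
      using C eventually_at_right_real[OF zero_less_one]
    proof eventually_elim
      case (elim t)
      have "?f t = (\<Sum>k=n..N. c k * t ^ k)"
        using least n by (intro sum.mono_neutral_right) auto
      also have "\<dots> = t ^ n * (\<Sum>k=n..N. c k * t ^ (k - n))"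
        unfolding sum_distrib_left by (intro sum.cong) (auto simp: power_add[symmetric])
      finally have "t ^ n * norm (\<Sum>k=n..N. c k * t ^ (k - n)) \<le> C * t ^ p"
        using elim by (simp add: abs_mult)
      moreover have "t ^ p = t ^ n * t ^ (p - n)"
        using n by (simp add: power_add[symmetric])
      ultimately have "t ^ n * norm (\<Sum>k=n..N. c k * t ^ (k - n)) \<le> t ^ n * (C * t ^ (p - n))"
        by (simp add: mult_ac)
      then have 1: "norm (\<Sum>k=n..N. c k * t ^ (k - n)) \<le> C * t ^ (p - n)"
        using elim by simp
      have 2: "t ^ (p - n) \<le> t ^ 1"
        using n elim by (intro power_decreasing) auto
      have "0 \<le> C * t ^ (p - n)"
        using 1 norm_ge_zero order_trans by blast
      moreover have "0 < t ^ (p - n)" using elim by simp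
      ultimately have C0: "0 \<le> C" by (simp only: zero_le_mult_iff) linarith
      show ?case
        using order_trans[OF 1 mult_left_mono[OF 2 C0]] by simp
    qed
    have "((\<lambda>t::real. \<Sum>k=n..N. c k * t ^ (k - n)) \<longlongrightarrow> 0) (at_right 0)"
      by (rule Lim_null_comparison[OF ev]) (auto intro!: tendsto_eq_intros)
    then have "c n = 0" using lim by (intro tendsto_unique[of "at_right (0::real)"]) auto
    then show False using n by simp
  qed
qed

text \<open>The coefficient of \<Delta>t^n in the lack of isotropy is the defect of A_n itself. The
  bound m \<le> 5 ensures that every A_n with n \<le> m occurs in the sum.\<close>

lemma isotropic_at_order_iff_bigo:
  assumes "m \<le> 5"
  shows "isotropic_at_order lam e s m \<longleftrightarrow> lack_of_isotropy5_bigo lam e s (m + 1)"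
proof -
  have "lack_of_isotropy5_bigo lam e s (m + 1) \<longleftrightarrow>
    (\<forall>r. rotation_matrix r \<longrightarrow> (\<forall>i \<alpha> j. \<forall>n\<in>{1..5}. n < m + 1 \<longrightarrow>
       tensor_rotation n r (equivalent_tensor lam e s n) i \<alpha> j - equivalent_tensor lam e s n i \<alpha> j = 0))"
    unfolding lack_of_isotropy5_bigo_def lack_of_isotropy5_def poly_sum_bigo_iff ..
  also have "\<dots> \<longleftrightarrow> isotropic_at_order lam e s m"
    using assms unfolding isotropic_at_order_def fun_eq_iff
    by (auto simp: Ball_def)
  finally show ?thesis ..
qed

section \<open>Existence and uniqueness of the equivalent pair\<close>

definition agree :: "nat \<Rightarrow> 'a::zero fps^'c^'r \<Rightarrow> 'a fps^'c^'r \<Rightarrow> bool" where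
  "agree n X Y \<longleftrightarrow> (\<forall>i j. \<forall>m<n. fps_nth (X $ i $ j) m = fps_nth (Y $ i $ j) m)"

lemma agree_refl [simp]: "agree n X X"
  and agree_sym: "agree n X Y \<Longrightarrow> agree n Y X"
  and agree_trans: "agree n X Y \<Longrightarrow> agree n Y Z \<Longrightarrow> agree n X Z"
  and agree_mono: "agree n X Y \<Longrightarrow> m \<le> n \<Longrightarrow> agree m X Y"
  and agree_0 [simp]: "agree 0 X Y"
  by (auto simp: agree_def)

lemma agree_imp_eq: "(\<And>n. agree n X Y) \<Longrightarrow> X = Y"
  unfolding agree_def vec_eq_iff fps_eq_iff by blast

text \<open>Contraction principle for congruence modulo \<Delta>t^n, which is what
  \<open>agree n\<close> expresses: each application of \<open>F\<close> makes one more coefficient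
  correct. The predicate \<open>P\<close> is carried along the iteration so that homogeneity of the
  solution comes together with its existence.\<close>

lemma causal_fixpoint:
  fixes F :: "'a::zero fps^'c^'r \<Rightarrow> 'a fps^'c^'r"
  assumes causal: "\<And>n X Y. agree n X Y \<Longrightarrow> agree (Suc n) (F X) (F Y)"
    and P0: "\<And>n. P n 0"
    and P: "\<And>X. \<forall>i j n. P n (fps_nth (X $ i $ j) n) \<Longrightarrow> \<forall>i j n. P n (fps_nth (F X $ i $ j) n)"
  shows "\<exists>X. (\<forall>Y. F Y = Y \<longleftrightarrow> Y = X) \<and> (\<forall>i j n. P n (fps_nth (X $ i $ j) n))"
proof -
  define S where "S k = (F ^^ k) 0" for k
  have S_Suc: "S (Suc k) = F (S k)" for k
    by (simp add: S_def)
  have S_P: "\<forall>i j n. P n (fps_nth (S k $ i $ j) n)" for k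
    by (induction k) (auto simp: S_Suc P[rule_format], auto simp: S_def P0)
  have step: "agree k (S k) (S (Suc k))" for k
    by (induction k) (auto simp: S_Suc intro: causal)
  have mono: "agree k (S k) (S (k + d))" for k d
  proof (induction d)
    case (Suc d)
    then show ?case using agree_mono[OF step[of "k + d"], of k] by (auto intro: agree_trans)
  qed simp
  \<comment> \<open>Coefficient n no longer changes from iterate n + 1 on, so it is read off
    there.\<close>
  define X where "X = (\<chi> i j. Abs_fps (\<lambda>n. fps_nth (S (Suc n) $ i $ j) n))"
  have X: "agree n X (S n)" for n
  proof -
    have "fps_nth (S (Suc m) $ i $ j) m = fps_nth (S n $ i $ j) m" if "m < n" for i j m
      using mono[of "Suc m" "n - Suc m"] that by (simp add: agree_def)
    then show ?thesis by (simp add: agree_def X_def)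
  qed
  have fixed: "F X = X"
  proof (rule agree_imp_eq)
    fix n
    have "agree (Suc n) (F X) (S (Suc n))"
      unfolding S_Suc by (rule causal[OF X])
    then show "agree n (F X) X"
      using X[of "Suc n"] by (blast intro: agree_trans agree_sym agree_mono le_SucI)
  qed
  have unique: "Y = X" if "F Y = Y" for Y
  proof (rule agree_imp_eq)
    show "agree n Y X" for n
      by (induction n) (auto simp: that fixed dest: causal)
  qed
  have "\<forall>i j n. P n (fps_nth (X $ i $ j) n)"
    using S_P by (simp add: X_def)
  moreover have "\<forall>Y. F Y = Y \<longleftrightarrow> Y = X"
    using fixed unique by blast
  ultimately show ?thesis by blast
qed

text \<open>Coefficient n of \<open>A\<close>, where \<open>A\<close> and \<open>A'\<close> may
  differ, can only meet the constant term of \<open>B\<close> in a coefficient of order n, and that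
  term is 0.\<close>

lemma agree_mult_Suc:
  fixes A :: "'a::comm_ring_1 fps^'m^'r"
  assumes A: "agree n A A'" and B: "agree (Suc n) B B'"
    and B0: "\<And>i j. fps_nth (B $ i $ j) 0 = 0"
  shows "agree (Suc n) (A ** B) (A' ** B')"
proof -
  have "fps_nth (A $ i $ k) p * fps_nth (B $ k $ j) (m - p) =
      fps_nth (A' $ i $ k) p * fps_nth (B' $ k $ j) (m - p)"
    if "m < Suc n" "p \<le> m" for i j k m p
  proof (cases "p < n")
    case True
    then show ?thesis using that A B by (simp add: agree_def)
  next
    case False
    then have "m - p = 0" using that by simp
    moreover have "fps_nth (B' $ k $ j) 0 = 0"
      using B B0[of k j] by (simp add: agree_def)
    ultimately show ?thesis using B0 by simp
  qed
  then show ?thesis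
    by (auto simp: agree_def matrix_matrix_mult_def fps_sum_nth fps_mult_nth intro!: sum.cong)
qed

text \<open>A left factor divisible by \<Delta>t shifts the unknown coefficients of \<open>B\<close>
  up by one order.\<close>

lemma agree_mult_left_Suc:
  fixes A :: "'a::comm_ring_1 fps^'m^'r"
  assumes A0: "\<And>i j. fps_nth (A $ i $ j) 0 = 0" and B: "agree n B B'"
  shows "agree (Suc n) (A ** B) (A ** B')"
proof -
  have "fps_nth (A $ i $ k) p * fps_nth (B $ k $ j) (m - p) =
      fps_nth (A $ i $ k) p * fps_nth (B' $ k $ j) (m - p)"
    if "m < Suc n" "p \<le> m" for i j k m p
    using that B A0 by (cases p) (simp_all add: agree_def)
  then show ?thesis
    by (auto simp: agree_def matrix_matrix_mult_def fps_sum_nth fps_mult_nth intro!: sum.cong)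
qed

lemma fps_nth_matrix_mult_0:
  "fps_nth ((A ** B) $ i $ j) 0 = (\<Sum>k\<in>UNIV. fps_nth (A $ i $ k) 0 * fps_nth (B $ k $ j) 0)"
  for A :: "'a::comm_ring_1 fps^'m^'r"
  by (simp add: matrix_matrix_mult_def fps_sum_nth)

lemma matrix_power_nth_eq_0:
  fixes B :: "'a::comm_ring_1 fps^'n^'n"
  assumes "\<And>i j. fps_nth (B $ i $ j) 0 = 0" and "m < k"
  shows "fps_nth (matrix_power B k $ i $ j) m = 0"
  using assms(2)
proof (induction k arbitrary: i m)
  case (Suc k)
  have "fps_nth (B $ i $ l) p * fps_nth (matrix_power B k $ l $ j) (m - p) = 0"
    if "p \<le> m" for l p
    using Suc that assms(1) by (cases p) auto
  then show ?case
    by (simp add: matrix_matrix_mult_def fps_sum_nth fps_mult_nth)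
qed simp

text \<open>In a product of at least two factors divisible by \<Delta>t, coefficient n of one factor
  would need constant terms from all the others. So B^k for k \<ge> 2 depends, up to order n, only
  on coefficients of \<open>B\<close> below n.\<close>

lemma agree_matrix_power_Suc:
  fixes B :: "'a::comm_ring_1 fps^'n^'n"
  assumes "agree n B B'" "n > 0" and B0: "\<And>i j. fps_nth (B $ i $ j) 0 = 0" and "k \<ge> 2"
  shows "agree (Suc n) (matrix_power B k) (matrix_power B' k)"
  using \<open>k \<ge> 2\<close>
proof (induction k rule: dec_induct)
  case base
  have B'0: "fps_nth (B' $ i $ j) 0 = 0" for i j
    using assms(1,2) B0[of i j] by (simp add: agree_def)
  have "fps_nth (B $ i $ k) p * fps_nth (B $ k $ j) (m - p) =
      fps_nth (B' $ i $ k) p * fps_nth (B' $ k $ j) (m - p)"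
    if "m < Suc n" "p \<le> m" for i j k m p
  proof (cases "p = 0 \<or> m - p = 0")
    case True
    then show ?thesis using B0 B'0 by auto
  next
    case False
    then have "p < n" "m - p < n" using that by auto
    then show ?thesis using assms(1) by (simp add: agree_def)
  qed
  then have "agree (Suc n) (B ** B) (B' ** B')"
    by (auto simp: agree_def matrix_matrix_mult_def fps_sum_nth fps_mult_nth intro!: sum.cong)
  then show ?case
    by (simp add: numeral_2_eq_2)
next
  case (step k)
  have "fps_nth (matrix_power B k $ i $ j) 0 = 0" for i j
    using step by (intro matrix_power_nth_eq_0 B0) auto
  then show ?case
    using step assms(1) by (auto intro!: agree_mult_Suc)
qed

section \<open>Homogeneous operators and graded series\<close>

definition homogeneous :: "nat \<Rightarrow> diffop \<Rightarrow> bool" where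
  "homogeneous n p \<longleftrightarrow> (\<forall>a b. a + b \<noteq> n \<longrightarrow> coeff (coeff p b) a = 0)"

lemma homogeneous_0 [simp]: "homogeneous n 0"
  by (simp add: homogeneous_def)

lemma homogeneous_const [simp]: "homogeneous 0 (diffop_const c)"
  by (auto simp: homogeneous_def diffop_const_def coeff_pCons split: nat.splits)

lemma homogeneous_partial [simp]: "homogeneous 1 (partial \<alpha>)"
  by (auto simp: homogeneous_def partial_def coeff_pCons split: nat.splits)

lemma homogeneous_add: "homogeneous n p \<Longrightarrow> homogeneous n q \<Longrightarrow> homogeneous n (p + q)"
  by (simp add: homogeneous_def)

lemma homogeneous_minus: "homogeneous n p \<Longrightarrow> homogeneous n (- p)"
  by (simp add: homogeneous_def)

lemma homogeneous_sum: "(\<And>x. x \<in> A \<Longrightarrow> homogeneous n (f x)) \<Longrightarrow> homogeneous n (sum f A)"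
  by (induction A rule: infinite_finite_induct) (auto intro: homogeneous_add)

lemma homogeneous_mult:
  assumes "homogeneous n p" "homogeneous m q" shows "homogeneous (n + m) (p * q)"
  unfolding homogeneous_def
proof (intro allI impI)
  fix a b assume ab: "a + b \<noteq> n + m"
  have "coeff (coeff p i) j * coeff (coeff q (b - i)) (a - j) = 0" if "i \<le> b" "j \<le> a" for i j
  proof (cases "j + i = n")
    case True
    then have "(a - j) + (b - i) \<noteq> m" using ab that by linarith
    then show ?thesis using assms(2) by (simp add: homogeneous_def)
  next
    case False
    then show ?thesis using assms(1) by (simp add: homogeneous_def)
  qed
  then show "coeff (coeff (p * q) b) a = 0"
    by (auto simp: coeff_mult coeff_sum simp del: mult_eq_0_iff intro!: sum.neutral)
qed

lemma diffop_const_add: "diffop_const (a + b) = diffop_const a + diffop_const b"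
  and diffop_const_mult: "diffop_const (a * b) = diffop_const a * diffop_const b"
  and diffop_const_minus: "diffop_const (- a) = - diffop_const a"
  and diffop_const_0 [simp]: "diffop_const 0 = 0"
  and diffop_const_1 [simp]: "diffop_const 1 = 1"
  by (simp_all add: diffop_const_def one_pCons)

text \<open>Every \<Delta>t comes with one derivative. The matrix \<A> itself is not graded in this
  sense: its coefficient of order n has degree n + 1, and only \<Delta>t \<A> is graded.\<close>

definition graded :: "diffop fps^'c^'r \<Rightarrow> bool" where
  "graded X \<longleftrightarrow> (\<forall>i j n. homogeneous n (fps_nth (X $ i $ j) n))"

lemma graded_mult: "graded A \<Longrightarrow> graded B \<Longrightarrow> graded (A ** B)"
  unfolding graded_def matrix_matrix_mult_def
proof (clarsimp simp: fps_sum_nth fps_mult_nth, intro homogeneous_sum)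
  fix i j k and n p :: nat
  assume "\<forall>i j n. homogeneous n (fps_nth (A $ i $ j) n)" "\<forall>i j n. homogeneous n (fps_nth (B $ i $ j) n)"
    and "p \<in> {0..n}"
  then show "homogeneous n (fps_nth (A $ i $ k) p * fps_nth (B $ k $ j) (n - p))"
    using homogeneous_mult[of p _ "n - p"] by fastforce
qed

lemma graded_mat_1 [simp]: "graded (mat 1)"
proof -
  have "homogeneous n (if n = 0 then 1 else 0)" for n
    using homogeneous_const[of 1] by simp
  then show ?thesis by (auto simp: graded_def mat_def)
qed

lemma graded_matrix_power: "graded B \<Longrightarrow> graded (matrix_power B k)"
  by (induction k) (auto intro: graded_mult)

lemma graded_lift_matrix: "graded (lift_matrix A)"
proof -
  have "homogeneous n (if n = 0 then diffop_const c else 0)" for n c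
    by simp
  then show ?thesis by (simp add: graded_def lift_matrix_def map_matrix_def)
qed

lemma homogeneous_const_mult: "homogeneous n p \<Longrightarrow> homogeneous n (diffop_const c * p)"
  using homogeneous_mult[OF homogeneous_const] by fastforce

lemma graded_formal_exp: "graded B \<Longrightarrow> graded (formal_exp B)"
  using graded_matrix_power[of B] unfolding graded_def formal_exp_def
  by (auto intro!: homogeneous_sum homogeneous_const_mult)

lemma fps_nth_minus_dt_times:
  "fps_nth (minus_dt_times A $ i $ j) n = (if n = 0 then 0 else - fps_nth (A $ i $ j) (n - 1))"
  by (simp add: minus_dt_times_def map_matrix_def)

lemma graded_minus_dt_times_advection: "graded (minus_dt_times (advection_matrix lam))"
proof -
  have "homogeneous 1 (- (diffop_const a * partial 1 + diffop_const b * partial 2))" for a b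
    by (intro homogeneous_minus homogeneous_add homogeneous_const_mult homogeneous_partial)
  then have "homogeneous n (fps_nth (minus_dt_times (advection_matrix lam) $ i $ j) n)" for i j n
    by (cases "n = 1") (auto simp: fps_nth_minus_dt_times advection_matrix_def)
  then show ?thesis by (simp add: graded_def)
qed

section \<open>Logarithms of matrices of formal power series\<close>

definition exp_tail :: "diffop fps^'n^'n \<Rightarrow> diffop fps^'n^'n" where
  "exp_tail B = (\<chi> i j. Abs_fps (\<lambda>n.
     \<Sum>k\<in>{2..n}. diffop_const (1 / fact k) * fps_nth (matrix_power B k $ i $ j) n))"

lemma formal_exp_eq_tail:
  assumes "\<And>i j. fps_nth (B $ i $ j) 0 = 0"
  shows "formal_exp B = mat 1 + B + exp_tail B"
proof -
  have "fps_nth (formal_exp B $ i $ j) n = fps_nth ((mat 1 + B + exp_tail B) $ i $ j) n" for i j n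
  proof -
    have mat: "fps_nth ((mat 1 :: diffop fps^'a^'a) $ i $ j) n = (if n = 0 then mat 1 $ i $ j else 0)"
      by (simp add: mat_def)
    consider "n = 0" | "n = 1" | "n \<ge> 2" by linarith
    then show ?thesis
    proof cases
      case 3
      have "{..n} = insert 0 (insert 1 {2..n})" using 3 by auto
      then show ?thesis using 3 by (simp add: formal_exp_def exp_tail_def mat)
    qed (use assms in \<open>simp_all add: formal_exp_def exp_tail_def mat\<close>)
  qed
  then show ?thesis by (simp add: vec_eq_iff fps_eq_iff)
qed

lemma fps_nth_formal_exp_0: "fps_nth (formal_exp B $ i $ j) 0 = mat 1 $ i $ j"
  by (simp add: formal_exp_def mat_def)

lemma agree_exp_tail:
  assumes "agree n B B'" "n > 0" "\<And>i j. fps_nth (B $ i $ j) 0 = 0"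
  shows "agree (Suc n) (exp_tail B) (exp_tail B')"
proof -
  have "fps_nth (matrix_power B k $ i $ j) m = fps_nth (matrix_power B' k $ i $ j) m"
    if "k \<ge> 2" "m < Suc n" for k m i j
    using agree_matrix_power_Suc[OF assms \<open>k \<ge> 2\<close>] that by (simp add: agree_def)
  then show ?thesis by (auto simp: agree_def exp_tail_def intro!: sum.cong)
qed

lemma graded_exp_tail: "graded B \<Longrightarrow> graded (exp_tail B)"
  using graded_matrix_power[of B] unfolding graded_def exp_tail_def
  by (auto intro!: homogeneous_sum homogeneous_const_mult)

lemma formal_log:
  fixes W :: "diffop fps^'n^'n"
  assumes W0: "\<And>i j. fps_nth (W $ i $ j) 0 = mat 1 $ i $ j" and "graded W"
  shows "\<exists>A. (\<forall>B. formal_exp (minus_dt_times B) = W \<longleftrightarrow> B = A) \<and>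
     (\<forall>i j n. homogeneous (Suc n) (fps_nth (A $ i $ j) n))"
proof -
  define R where "R B = mat 1 + exp_tail (minus_dt_times B) - W" for B :: "diffop fps^'n^'n"
  define F where "F B = map_matrix (fps_shift 1) (R B)" for B
  have F_nth: "fps_nth (F B $ i $ j) n = fps_nth (R B $ i $ j) (Suc n)" for B i j n
    by (simp add: F_def map_matrix_def)
  have md0: "fps_nth (minus_dt_times B $ i $ j) 0 = 0" for B :: "diffop fps^'n^'n" and i j
    by (simp add: fps_nth_minus_dt_times)
  have R0: "fps_nth (R B $ i $ j) 0 = 0" for B i j
    using W0[of i j] by (simp add: R_def exp_tail_def mat_def)
  have "\<exists>A. (\<forall>B. F B = B \<longleftrightarrow> B = A) \<and>
      (\<forall>i j n. homogeneous (Suc n) (fps_nth (A $ i $ j) n))"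
  proof (rule causal_fixpoint[where P = "\<lambda>n. homogeneous (Suc n)"])
    fix n and X Y :: "diffop fps^'n^'n" assume "agree n X Y"
    \<comment> \<open>The count of orders: the factor \<Delta>t gains one, the tail gains another
      because it begins with the square, and the shift in \<open>F\<close> loses one.\<close>
    then have "agree (Suc n) (minus_dt_times X) (minus_dt_times Y)"
      by (auto simp: agree_def fps_nth_minus_dt_times)
    then have "agree (Suc (Suc n)) (exp_tail (minus_dt_times X)) (exp_tail (minus_dt_times Y))"
      by (intro agree_exp_tail md0) auto
    then have "agree (Suc (Suc n)) (R X) (R Y)"
      by (simp add: agree_def R_def)
    then show "agree (Suc n) (F X) (F Y)"
      by (simp add: agree_def F_nth)
  next
    fix X :: "diffop fps^'n^'n"
    assume "\<forall>i j n. homogeneous (Suc n) (fps_nth (X $ i $ j) n)"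
    then have "graded (minus_dt_times X)"
      by (auto simp: graded_def fps_nth_minus_dt_times intro!: homogeneous_minus)
        (metis Suc_pred neq0_conv)
    moreover have "graded (mat 1 :: diffop fps^'n^'n)" by simp
    ultimately have "graded (R X)"
      using graded_exp_tail[of "minus_dt_times X"] \<open>graded W\<close>
      unfolding graded_def R_def
      by (auto simp: diff_conv_add_uminus simp del: add_uminus_conv_diff
          intro!: homogeneous_add homogeneous_minus)
    then show "\<forall>i j n. homogeneous (Suc n) (fps_nth (F X $ i $ j) n)"
      by (simp add: F_nth graded_def)
  qed simp
  moreover have "formal_exp (minus_dt_times B) = W \<longleftrightarrow> F B = B" for B
  proof -
    have "formal_exp (minus_dt_times B) = W \<longleftrightarrow> minus_dt_times B = - R B"
      unfolding formal_exp_eq_tail[OF md0] R_def by (auto simp: algebra_simps)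
    also have "\<dots> \<longleftrightarrow> (\<forall>i j n. fps_nth (minus_dt_times B $ i $ j) n = - fps_nth (R B $ i $ j) n)"
      by (simp add: vec_eq_iff fps_eq_iff)
    also have "\<dots> \<longleftrightarrow> (\<forall>i j n. fps_nth (B $ i $ j) n = fps_nth (R B $ i $ j) (Suc n))"
    proof safe
      fix i j n assume *: "\<forall>i j n. fps_nth (minus_dt_times B $ i $ j) n = - fps_nth (R B $ i $ j) n"
      show "fps_nth (B $ i $ j) n = fps_nth (R B $ i $ j) (Suc n)"
        using *[rule_format, of i j "Suc n"] by (simp add: fps_nth_minus_dt_times)
    next
      fix i j n assume *: "\<forall>i j n. fps_nth (B $ i $ j) n = fps_nth (R B $ i $ j) (Suc n)"
      show "fps_nth (minus_dt_times B $ i $ j) n = - fps_nth (R B $ i $ j) n"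
        by (cases n) (simp_all add: fps_nth_minus_dt_times R0 *)
    qed
    also have "\<dots> \<longleftrightarrow> F B = B"
      by (auto simp: vec_eq_iff fps_eq_iff F_nth)
    finally show ?thesis .
  qed
  ultimately show ?thesis by simp
qed

section \<open>Splitting a moment matrix into conserved and non-conserved rows\<close>

definition stack :: "'a::semiring_1 fps^conserved^nonconserved \<Rightarrow> 'a fps^conserved^moment" where
  "stack Y = (\<chi> i. case i of Inl i \<Rightarrow> mat 1 $ i | Inr k \<Rightarrow> Y $ k)"

definition top_rows :: "'a^'c^('m::finite + 'n::finite) \<Rightarrow> 'a^'c^'m" where
  "top_rows X = (\<chi> i. X $ Inl i)"

definition bottom_rows :: "'a^'c^('m::finite + 'n::finite) \<Rightarrow> 'a^'c^'n" where
  "bottom_rows X = (\<chi> i. X $ Inr i)"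

lemma rows_eq_iff: "X = Y \<longleftrightarrow> top_rows X = top_rows Y \<and> bottom_rows X = bottom_rows Y"
proof -
  have "X $ k = Y $ k" if "\<forall>i. X $ Inl i = Y $ Inl i" "\<forall>i. X $ Inr i = Y $ Inr i" for k
    using that by (cases k) auto
  then show ?thesis
    unfolding top_rows_def bottom_rows_def by (metis vec_eq_iff vec_lambda_beta)
qed

lemma top_rows_mult [simp]: "top_rows (X ** Y) = top_rows X ** Y"
  and bottom_rows_mult [simp]: "bottom_rows (X ** Y) = bottom_rows X ** Y"
  by (simp_all add: top_rows_def bottom_rows_def matrix_matrix_mult_def)

lemma rows_stack [simp]: "top_rows (stack Y) = mat 1" "bottom_rows (stack Y) = Y"
  by (simp_all add: top_rows_def bottom_rows_def stack_def vec_eq_iff)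

lemma UNIV_dir: "UNIV = {Neg, Zero, Pos}"
  by (auto intro: dir.exhaust)

lemma UNIV_conserved: "UNIV = {Rho, Qx, Qy}"
  by (auto intro: conserved.exhaust)

lemma UNIV_nonconserved: "UNIV = {Epsi, Epsi2, PhiX, PhiY, PhiXX, PhiXY}"
  by (auto intro: nonconserved.exhaust)

lemma sum_conserved: "(\<Sum>i\<in>UNIV. f i) = f Rho + f Qx + f Qy"
  by (simp add: UNIV_conserved add.assoc)

lemma sum_nonconserved:
  "(\<Sum>i\<in>UNIV. f i) = f Epsi + f Epsi2 + f PhiX + f PhiY + f PhiXX + f PhiXY"
  by (simp add: UNIV_nonconserved add.assoc)

lemma sum_Plus_UNIV:
  "(\<Sum>i\<in>UNIV. f i) = (\<Sum>i\<in>UNIV. f (Inl i)) + (\<Sum>k\<in>UNIV. f (Inr k))" for f :: "'a::finite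
    + 'b::finite \<Rightarrow> 'c::comm_monoid_add"
  unfolding UNIV_Plus_UNIV[symmetric] by (subst sum.Plus) auto

lemma sum_velocity:
  "(\<Sum>v\<in>UNIV. f v) =
     f (Neg, Neg) + f (Neg, Zero) + f (Neg, Pos) + f (Zero, Neg) + f (Zero, Zero) + f (Zero, Pos) +
     f (Pos, Neg) + f (Pos, Zero) + f (Pos, Pos)" for f :: "velocity \<Rightarrow> 'a::comm_monoid_add"
proof -
  have "(\<Sum>v\<in>UNIV. f v) = (\<Sum>a\<in>UNIV. \<Sum>b\<in>UNIV. f (a, b))"
    by (simp add: sum.cartesian_product flip: UNIV_Times_UNIV)
  then show ?thesis by (simp add: UNIV_dir add.assoc)
qed

section \<open>Orthogonality of the moments and the inverse of the moment matrix\<close>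

primrec moment_degree :: "moment \<Rightarrow> nat" where
  "moment_degree (Inl i) = conserved_degree i"
| "moment_degree (Inr k) = nonconserved_degree k"

abbreviation moment_unit :: "moment \<Rightarrow> velocity \<Rightarrow> real" where
  "moment_unit i v \<equiv> moment_poly 1 i (dir_coord (fst v)) (dir_coord (snd v))"

text \<open>Squared lengths of the rows of M for \<lambda> = 1. As the rows are orthogonal, these
  are all that is needed to invert M.\<close>

fun moment_norm2 :: "moment \<Rightarrow> real" where
  "moment_norm2 (Inl Rho) = 9"
| "moment_norm2 (Inl Qx) = 6"
| "moment_norm2 (Inl Qy) = 6"
| "moment_norm2 (Inr Epsi) = 36"
| "moment_norm2 (Inr Epsi2) = 36"
| "moment_norm2 (Inr PhiX) = 12"
| "moment_norm2 (Inr PhiY) = 12"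
| "moment_norm2 (Inr PhiXX) = 4"
| "moment_norm2 (Inr PhiXY) = 4"

lemma moment_cases [case_names Rho Qx Qy Epsi Epsi2 PhiX PhiY PhiXX PhiXY]:
  assumes "i = Inl Rho \<Longrightarrow> P" "i = Inl Qx \<Longrightarrow> P" "i = Inl Qy \<Longrightarrow> P" "i = Inr Epsi \<Longrightarrow> P"
    "i = Inr Epsi2 \<Longrightarrow> P" "i = Inr PhiX \<Longrightarrow> P" "i = Inr PhiY \<Longrightarrow> P" "i = Inr PhiXX \<Longrightarrow> P"
    "i = Inr PhiXY \<Longrightarrow> P"
  shows P
  using assms by (cases i) (metis conserved.exhaust nonconserved.exhaust)+

lemma moment_orthogonal:
  "(\<Sum>v\<in>UNIV. moment_unit i v * moment_unit j v) = (if i = j then moment_norm2 i else 0)"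
  unfolding sum_velocity
  by (cases i rule: moment_cases; cases j rule: moment_cases) simp_all

text \<open>Completeness relation of the orthogonal basis. Rows and columns of M have different
  index types, so the second one-sided inverse is also checked directly, over all pairs of
  velocities.\<close>

lemma moment_dual_orthogonal:
  "(\<Sum>i\<in>UNIV. moment_unit i v * moment_unit i w / moment_norm2 i) = (if v = w then 1 else 0)"
  unfolding sum_Plus_UNIV sum_conserved sum_nonconserved
  by (cases v; cases w; rule dir.exhaust[of "fst v"]; rule dir.exhaust[of "snd v"];
      rule dir.exhaust[of "fst w"]; rule dir.exhaust[of "snd w"]; simp)

lemma moment_norm2_pos: "moment_norm2 i > 0"
  by (cases i rule: moment_cases) simp_all

lemma moment_matrix_eq: "moment_matrix lam $ i $ v = lam ^ moment_degree i * moment_unit i v"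
  by (cases i rule: moment_cases)
    (simp_all add: moment_matrix_def vel_x_def vel_y_def power_mult_distrib algebra_simps power2_eq_square
      power3_eq_cube power4_eq_xxxx)

text \<open>The transpose of M with each column divided by the squared length of the corresponding
  row of M, after the powers of \<lambda> have been separated.\<close>

definition moment_inverse :: "real \<Rightarrow> real^moment^velocity" where
  "moment_inverse lam = (\<chi> v i. moment_unit i v / (moment_norm2 i * lam ^ moment_degree i))"

lemma moment_inverse_right:
  assumes "lam \<noteq> 0" shows "moment_matrix lam ** moment_inverse lam = mat 1"
proof -
  have "(moment_matrix lam ** moment_inverse lam) $ i $ j = mat 1 $ i $ j" for i j
  proof -
    have "(moment_matrix lam ** moment_inverse lam) $ i $ j =
        lam ^ moment_degree i / (moment_norm2 j * lam ^ moment_degree j) *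
        (\<Sum>v\<in>UNIV. moment_unit i v * moment_unit j v)"
      by (simp add: matrix_matrix_mult_def moment_matrix_eq moment_inverse_def sum_distrib_left mult_ac)
    then show ?thesis
      unfolding moment_orthogonal using assms moment_norm2_pos[of j] by (auto simp: mat_def)
  qed
  then show ?thesis by (simp add: vec_eq_iff)
qed

lemma moment_inverse_left:
  assumes "lam \<noteq> 0" shows "moment_inverse lam ** moment_matrix lam = mat 1"
proof -
  have "(moment_inverse lam ** moment_matrix lam) $ v $ w = mat 1 $ v $ w" for v w
  proof -
    have "(moment_inverse lam ** moment_matrix lam) $ v $ w =
        (\<Sum>i\<in>UNIV. moment_unit i v * moment_unit i w / moment_norm2 i)"
      using assms by (simp add: matrix_matrix_mult_def moment_matrix_eq moment_inverse_def)
    then show ?thesis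
      unfolding moment_dual_orthogonal by (simp add: mat_def)
  qed
  then show ?thesis by (simp add: vec_eq_iff)
qed

lemma matrix_inv_eqI:
  fixes A :: "'a::semiring_1^'n^'m"
  assumes "A ** B = mat 1" "B ** A = mat 1"
  shows "matrix_inv A = B"
proof -
  have "A ** matrix_inv A = mat 1 \<and> matrix_inv A ** A = mat 1"
    unfolding matrix_inv_def by (rule someI[of _ B]) (use assms in simp)
  then show ?thesis
    by (metis assms(1) matrix_mul_assoc matrix_mul_lid matrix_mul_rid)
qed

lemma matrix_inv_moment_matrix: "lam \<noteq> 0 \<Longrightarrow> matrix_inv (moment_matrix lam) = moment_inverse lam"
  by (intro matrix_inv_eqI moment_inverse_right moment_inverse_left)

abbreviation fps_scalar :: "real \<Rightarrow> diffop fps" where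
  "fps_scalar c \<equiv> fps_const (diffop_const c)"

lemma lift_matrix_nth [simp]: "lift_matrix A $ i $ j = fps_scalar (A $ i $ j)"
  by (simp add: lift_matrix_def map_matrix_def)

lemma fps_scalar_mult: "fps_scalar (a * b) = fps_scalar a * fps_scalar b"
  by (simp add: diffop_const_mult)

lemma graded_time_step: "graded (time_step_matrix lam e s)"
  unfolding time_step_matrix_def
  by (intro graded_mult graded_lift_matrix graded_formal_exp graded_minus_dt_times_advection)

lemma diffop_const_sum: "diffop_const (sum f A) = (\<Sum>x\<in>A. diffop_const (f x))"
  by (induction A rule: infinite_finite_induct) (simp_all add: diffop_const_add)

text \<open>At \<Delta>t = 0 there is no transport: the exponential is the identity, M cancels M^-1,
  and the collision J remains.\<close>

lemma fps_nth_time_step_0: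
  assumes "lam \<noteq> 0"
  shows "fps_nth (time_step_matrix lam e s $ i $ j) 0 = diffop_const (collision_matrix lam e s $ i $ j)"
proof -
  let ?M = "moment_matrix lam" and ?N = "moment_inverse lam"
  have at_0: "(\<chi> i j. fps_nth ((A ** B) $ i $ j) 0)
    = (\<chi> i j. fps_nth (A $ i $ j) 0) ** (\<chi> i j. fps_nth (B $ i $ j) 0)"
    for A :: "diffop fps^'m^'r" and B :: "diffop fps^'c^'m"
    by (simp add: vec_eq_iff fps_sum_nth matrix_matrix_mult_def)
  have const: "map_matrix diffop_const (A ** B) = map_matrix diffop_const A ** map_matrix diffop_const B"
    for A :: "real^'m^'r" and B :: "real^'c^'m"
    by (simp add: vec_eq_iff map_matrix_def matrix_matrix_mult_def diffop_const_sum diffop_const_mult)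
  have lift: "(\<chi> i j. fps_nth (lift_matrix A $ i $ j) 0) = map_matrix diffop_const A" for A :: "real^'c^'r"
    by (simp add: vec_eq_iff map_matrix_def)
  have exp: "(\<chi> i j. fps_nth (formal_exp B $ i $ j) 0) = (mat 1 :: diffop^'n^'n)" for B :: "diffop fps^'n^'n"
    by (simp add: vec_eq_iff fps_nth_formal_exp_0)
  have "(\<chi> i j. fps_nth (time_step_matrix lam e s $ i $ j) 0) =
      map_matrix diffop_const ?M ** map_matrix diffop_const ?N ** map_matrix diffop_const
        (collision_matrix lam e s)"
    unfolding time_step_matrix_def matrix_inv_moment_matrix[OF assms] at_0 lift exp matrix_mul_rid ..
  also have "\<dots> = map_matrix diffop_const (collision_matrix lam e s)"
    unfolding const[symmetric] by (simp add: moment_inverse_right assms)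
  finally show ?thesis by (simp add: vec_eq_iff map_matrix_def)
qed

lemma collision_matrix_nth [simp]:
  "collision_matrix lam e s $ Inl i $ a = mat 1 $ Inl i $ a"
  "collision_matrix lam e s $ Inr k $ Inl j = s k * equilibrium_matrix lam e $ k $ j"
  "collision_matrix lam e s $ Inr k $ Inr l = (if k = l then 1 - s k else 0)"
  by (cases a; auto simp: collision_matrix_def mat_def)
    (auto simp: collision_matrix_def mat_def relaxation_matrix_def matrix_matrix_mult_def
      if_distrib[where f = "\<lambda>x. x * _"] cong: if_cong)

lemma collision_stack:
  "(lift_matrix (collision_matrix lam e s) ** stack Y) $ Inl i $ j = mat 1 $ i $ j"
  "(lift_matrix (collision_matrix lam e s) ** stack Y) $ Inr k $ j =
     fps_scalar (s k * equilibrium_matrix lam e $ k $ j) + fps_scalar (1 - s k) * Y $ k $ j"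
  by (auto simp: matrix_matrix_mult_def sum_Plus_UNIV stack_def mat_def if_distrib[where f = "\<lambda>x. _ * x"] 
      if_distrib[where f = "\<lambda>x. x * _"] if_distrib[where f = diffop_const]
      if_distrib[where f = fps_const] cong: if_cong)

text \<open>The top rows of the defining equation say that exp(- \<Delta>t \<A>) is the top part of
  T \<Psi>. Inserting this in the bottom rows eliminates \<A> and leaves an equation for the lower
  block \<open>Y\<close> of \<Psi> alone, which is causal because T differs from the collision
  matrix by a multiple of \<Delta>t. After \<open>Y\<close> is found, \<A> is a formal
  logarithm.\<close>

lemma equivalent_pair_exists_unique:
  assumes "lam \<noteq> 0" and s: "\<And>k. s k \<noteq> 0"
  shows "\<exists>\<Psi> \<A>. (\<forall>\<Psi>' \<A>'. is_equivalent_pair lam e s \<Psi>' \<A>' \<longleftrightarrow> \<Psi>' = \<Psi> \<and> \<A>' = \<A>) \<and>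
    (\<forall>i j n. homogeneous (Suc n) (fps_nth (\<A> $ i $ j) n))"
proof -
  define T where "T = time_step_matrix lam e s"
  define C where "C = lift_matrix (collision_matrix lam e s)"
  define Q where "Q = T - C"
  \<comment> \<open>The contribution of \<open>Q\<close> to bottom(T \<Psi>) - Y top(T \<Psi>). The
    collision contributes s (E - Y), so the equation is s (E - Y) + N Y = 0; division by s, possible
    as s is nonzero, gives the map \<open>F\<close>.\<close>
  define N where "N Y = bottom_rows Q ** stack Y - Y ** (top_rows Q ** stack Y)"
    for Y :: "diffop fps^conserved^nonconserved"
  define F where "F Y = (\<chi> k j. fps_scalar (equilibrium_matrix lam e $ k $ j)
    + fps_scalar (1 / s k) * N Y $ k $ j)"
    for Y :: "diffop fps^conserved^nonconserved"
  have Q0: "fps_nth (Q $ i $ j) 0 = 0" for i j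
    by (simp add: Q_def T_def C_def fps_nth_time_step_0[OF assms(1)])
  have "graded T" "graded C"
    by (simp_all add: T_def C_def graded_time_step graded_lift_matrix)
  then have Q_graded: "graded Q"
    by (auto simp: graded_def Q_def diff_conv_add_uminus simp del: add_uminus_conv_diff
        intro!: homogeneous_add homogeneous_minus)
  have "\<exists>Y. (\<forall>Y'. F Y' = Y' \<longleftrightarrow> Y' = Y) \<and> (\<forall>i j n. homogeneous n (fps_nth (Y $ i $ j) n))"
  proof (rule causal_fixpoint)
    fix n and X Y :: "diffop fps^conserved^nonconserved" assume XY: "agree n X Y"
    have "stack X $ i $ j = (case i of Inl i \<Rightarrow> mat 1 $ i $ j | Inr k \<Rightarrow> X $ k $ j)" for X :: "diffop
      fps^conserved^nonconserved" and i j
      by (simp add: stack_def split: sum.split)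
    then have "agree n (stack X) (stack Y)"
      using XY by (auto simp: agree_def split: sum.split)
    then have "agree (Suc n) (Q ** stack X) (Q ** stack Y)"
      by (intro agree_mult_left_Suc Q0)
    then have top: "agree (Suc n) (top_rows Q ** stack X) (top_rows Q ** stack Y)"
      and bot: "agree (Suc n) (bottom_rows Q ** stack X) (bottom_rows Q ** stack Y)"
      by (simp_all add: agree_def top_rows_def bottom_rows_def matrix_matrix_mult_def)
    have "agree (Suc n) (X ** (top_rows Q ** stack X)) (Y ** (top_rows Q ** stack Y))"
      using XY top by (rule agree_mult_Suc) (simp add: fps_nth_matrix_mult_0 top_rows_def Q0)
    then have "agree (Suc n) (N X) (N Y)"
      using bot by (simp add: agree_def N_def)
    then show "agree (Suc n) (F X) (F Y)"
      by (auto simp: agree_def F_def)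
  next
    fix X :: "diffop fps^conserved^nonconserved"
    assume "\<forall>i j n. homogeneous n (fps_nth (X $ i $ j) n)"
    then have X: "graded X" by (simp add: graded_def)
    have mat: "homogeneous n (fps_nth ((mat 1 :: diffop fps^conserved^conserved) $ i $ j) n)" for i j n
      using graded_mat_1 by (auto simp: graded_def)
    have "graded (stack X)"
      unfolding graded_def
    proof (intro allI)
      fix i j n show "homogeneous n (fps_nth (stack X $ i $ j) n)"
        using X mat by (cases i) (auto simp: graded_def stack_def)
    qed
    moreover have "graded (top_rows Q)" "graded (bottom_rows Q)"
      using Q_graded by (simp_all add: graded_def top_rows_def bottom_rows_def)
    ultimately have "graded (bottom_rows Q ** stack X)" "graded (X ** (top_rows Q ** stack X))"
      using X by (auto intro!: graded_mult)
    then have N: "homogeneous n (fps_nth (N X $ i $ j) n)" for i j n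
      by (auto simp: graded_def N_def diff_conv_add_uminus simp del: add_uminus_conv_diff
        intro!: homogeneous_add homogeneous_minus)
    have E: "homogeneous n (fps_nth (fps_scalar c) n)" for n c
      by (cases n) auto
    show "\<forall>i j n. homogeneous n (fps_nth (F X $ i $ j) n)"
      by (auto simp: F_def simp del: fps_nth_fps_const intro!: homogeneous_add E homogeneous_const_mult N)
  qed simp
  then obtain Y where Y_iff: "\<And>Y'. F Y' = Y' \<longleftrightarrow> Y' = Y" and Y_graded: "graded Y"
    unfolding graded_def by blast
  define W where "W = top_rows (T ** stack Y)"
  have T_rows: "top_rows (T ** stack Y') = mat 1 + top_rows Q ** stack Y'"
    "bottom_rows (T ** stack Y') = (\<chi> k j. fps_scalar (s k * equilibrium_matrix lam e $ k $ j) +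
        fps_scalar (1 - s k) * Y' $ k $ j) + bottom_rows Q ** stack Y'" for Y'
  proof -
    have T: "T = C + Q" by (simp add: Q_def)
    have split: "(T ** stack Y') $ i $ j = (C ** stack Y') $ i $ j + (Q ** stack Y') $ i $ j" for i j
      unfolding T by (simp add: matrix_matrix_mult_def distrib_right sum.distrib)
    show "top_rows (T ** stack Y') = mat 1 + top_rows Q ** stack Y'"
      unfolding vec_eq_iff
      by (simp add: top_rows_mult[symmetric] del: top_rows_mult)
         (simp add: top_rows_def split C_def collision_stack)
    show "bottom_rows (T ** stack Y') = (\<chi> k j. fps_scalar (s k * equilibrium_matrix lam e $ k $ j) +
        fps_scalar (1 - s k) * Y' $ k $ j) + bottom_rows Q ** stack Y'"
      unfolding vec_eq_iff
      by (simp add: bottom_rows_mult[symmetric] del: bottom_rows_mult)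
         (simp add: bottom_rows_def split C_def collision_stack)
  qed
  \<comment> \<open>The equation with \<A> eliminated is equivalent to \<open>F Y' = Y'\<close>. The
    scalars s and 1 / s are inverse units in the ring of series, so multiplication by either loses
    nothing.\<close>
  have Y_eq: "bottom_rows (T ** stack Y') = Y' ** top_rows (T ** stack Y') \<longleftrightarrow> Y' = Y" for Y'
  proof -
    have "bottom_rows (T ** stack Y') = Y' ** top_rows (T ** stack Y') \<longleftrightarrow>
      (\<forall>k j. fps_scalar (s k * equilibrium_matrix lam e $ k $ j) + fps_scalar (1 - s k) * Y' $ k $ j +
        N Y' $ k $ j = Y' $ k $ j)"
      unfolding T_rows by (simp add: N_def vec_eq_iff matrix_add_ldistrib algebra_simps)
    also have "\<dots> \<longleftrightarrow> (\<forall>k j. F Y' $ k $ j = Y' $ k $ j)"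
    proof (intro all_cong1)
      fix k j
      let ?e = "fps_scalar (equilibrium_matrix lam e $ k $ j)" and ?s = "fps_scalar (s k)"
        and ?i = "fps_scalar (1 / s k)" and ?y = "Y' $ k $ j" and ?n = "N Y' $ k $ j"
      have si: "?i * ?s = 1"
        using s[of k] by (simp flip: diffop_const_mult)
      have 1: "fps_scalar (1 - s k) = 1 - ?s"
        by (simp add: diff_conv_add_uminus diffop_const_add diffop_const_minus
            del: add_uminus_conv_diff flip: fps_const_add fps_const_neg)
      have "fps_scalar (s k * equilibrium_matrix lam e $ k $ j) + fps_scalar (1 - s k) * ?y + ?n = ?y \<longleftrightarrow>
          ?s * (?e - ?y) + ?n = 0"
        unfolding fps_scalar_mult 1 by (simp add: algebra_simps)
      also have "\<dots> \<longleftrightarrow> ?e - ?y + ?i * ?n = 0"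
      proof
        assume "?s * (?e - ?y) + ?n = 0"
        then have "?i * (?s * (?e - ?y) + ?n) = 0" by simp
        then show "?e - ?y + ?i * ?n = 0"
          using si by (simp only: distrib_left mult.assoc[symmetric]) simp
      next
        assume "?e - ?y + ?i * ?n = 0"
        then have "?s * (?e - ?y + ?i * ?n) = 0" by simp
        moreover have "?s * (?i * ?n) = ?n"
          using si by (simp only: mult.assoc[symmetric] mult.commute[of ?s]) simp
        ultimately show "?s * (?e - ?y) + ?n = 0"
          by (simp only: distrib_left)
      qed
      also have "\<dots> \<longleftrightarrow> F Y' $ k $ j = ?y"
        by (auto simp: F_def algebra_simps)
      finally show "fps_scalar (s k * equilibrium_matrix lam e $ k $ j) + fps_scalar (1 - s k) * ?y + ?n = ?y \<longleftrightarrow>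
        F Y' $ k $ j = ?y" .
    qed
    also have "\<dots> \<longleftrightarrow> F Y' = Y'"
      by (simp add: vec_eq_iff)
    finally show ?thesis by (simp only: Y_iff)
  qed
  have W0: "fps_nth (W $ i $ j) 0 = mat 1 $ i $ j" for i j
    by (simp add: W_def T_rows fps_nth_matrix_mult_0 del: top_rows_mult) (simp add: top_rows_def Q0 mat_def)
  have "graded W"
  proof -
    have mat: "homogeneous n (fps_nth ((mat 1 :: diffop fps^conserved^conserved) $ i $ j) n)" for i j n
      using graded_mat_1 by (auto simp: graded_def)
    have "graded (stack Y)"
      unfolding graded_def
    proof (intro allI)
      fix i j n show "homogeneous n (fps_nth (stack Y $ i $ j) n)"
        using Y_graded mat by (cases i) (auto simp: graded_def stack_def)
    qed
    then have "graded (T ** stack Y)"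
      using \<open>graded T\<close> by (intro graded_mult)
    then show ?thesis by (simp add: W_def graded_def top_rows_def del: top_rows_mult)
  qed
  with W0 obtain A where A_iff: "\<And>B. formal_exp (minus_dt_times B) = W \<longleftrightarrow> B = A"
    and A_hom: "\<forall>i j n. homogeneous (Suc n) (fps_nth (A $ i $ j) n)"
    using formal_log[of W] by blast
  have "is_equivalent_pair lam e s \<Psi>' \<A>' \<longleftrightarrow> \<Psi>' = stack Y \<and> \<A>' = A" for \<Psi>' \<A>'
  proof -
    have 1: "(\<forall>i j. \<Psi>' $ Inl i $ j = mat 1 $ i $ j) \<longleftrightarrow> \<Psi>' = stack (bottom_rows \<Psi>')"
      unfolding rows_eq_iff[of \<Psi>'] rows_stack by (simp add: vec_eq_iff top_rows_def)
    have "is_equivalent_pair lam e s \<Psi>' \<A>' \<longleftrightarrow> \<Psi>' = stack (bottom_rows \<Psi>') \<and>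
        T ** stack (bottom_rows \<Psi>') = stack (bottom_rows \<Psi>') ** formal_exp (minus_dt_times \<A>')"
      unfolding is_equivalent_pair_def 1 T_def[symmetric] by metis
    also have "\<dots> \<longleftrightarrow> \<Psi>' = stack (bottom_rows \<Psi>') \<and>
        top_rows (T ** stack (bottom_rows \<Psi>')) = formal_exp (minus_dt_times \<A>') \<and>
        bottom_rows (T ** stack (bottom_rows \<Psi>')) = bottom_rows \<Psi>' ** formal_exp (minus_dt_times \<A>')"
      unfolding rows_eq_iff[of "T ** stack (bottom_rows \<Psi>')"] top_rows_mult[of "stack _"]
        bottom_rows_mult[of "stack _"]
        rows_stack matrix_mul_lid ..
    \<comment> \<open>The expression for the exponential from the top rows is substituted into the
      bottom rows, which then have \<open>Y\<close> as their only solution.\<close>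
    also have "\<dots> \<longleftrightarrow> \<Psi>' = stack (bottom_rows \<Psi>') \<and> bottom_rows \<Psi>' = Y \<and>
        formal_exp (minus_dt_times \<A>') = top_rows (T ** stack (bottom_rows \<Psi>'))"
      using Y_eq[of "bottom_rows \<Psi>'"] by metis
    also have "\<dots> \<longleftrightarrow> \<Psi>' = stack Y \<and> formal_exp (minus_dt_times \<A>') = W"
      unfolding W_def by (metis rows_stack(2))
    finally show ?thesis unfolding A_iff .
  qed
  then show ?thesis using A_hom by blast
qed

text \<open>Unique existence lets the definite description be used; from here on only the defining
  equation and homogeneity of \<A> matter.\<close>

lemma equivalent_operator:
  assumes "lam \<noteq> 0" and "\<And>k. s k \<noteq> 0"
  obtains \<Psi> where "is_equivalent_pair lam e s \<Psi> (equivalent_operator lam e s)"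
    and "\<And>i j n. homogeneous (Suc n) (fps_nth (equivalent_operator lam e s $ i $ j) n)"
proof -
  obtain \<Psi> \<A> where *: "\<And>\<Psi>' \<A>'. is_equivalent_pair lam e s \<Psi>' \<A>' \<longleftrightarrow> \<Psi>' = \<Psi> \<and> \<A>' = \<A>"
    and hom: "\<forall>i j n. homogeneous (Suc n) (fps_nth (\<A> $ i $ j) n)"
    using equivalent_pair_exists_unique[where lam = lam and s = s and e = e, OF assms] by blast
  have "(THE p. is_equivalent_pair lam e s (fst p) (snd p)) = (\<Psi>, \<A>)"
    by (rule the_equality) (auto simp: * prod_eq_iff)
  then have "equivalent_operator lam e s = \<A>"
    by (simp add: equivalent_operator_def)
  then show ?thesis using that * hom by simp
qed

section \<open>Evaluation of the differential operators\<close>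

text \<open>Evaluation of the indeterminates \<partial>_1 and \<partial>_2 at real numbers, without
  the imaginary unit of Fourier symbols. It is a ring homomorphism, so identities between operators
  become identities between real polynomials in x and y.\<close>

definition symbol :: "real \<Rightarrow> real \<Rightarrow> diffop \<Rightarrow> real" where
  "symbol x y p = poly (poly p [:y:]) x"

lemma symbol_simps [simp]:
  "symbol x y 0 = 0" "symbol x y 1 = 1" "symbol x y (p + q) = symbol x y p + symbol x y q"
  "symbol x y (p - q) = symbol x y p - symbol x y q" "symbol x y (- p) = - symbol x y p"
  "symbol x y (p * q) = symbol x y p * symbol x y q"
  "symbol x y (diffop_const c) = c" "symbol x y (partial 1) = x" "symbol x y (partial 2) = y"
  "symbol x y (p ^ n) = symbol x y p ^ n"
  by (simp_all add: symbol_def diffop_const_def partial_def)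

lemma symbol_sum: "symbol x y (sum f A) = (\<Sum>a\<in>A. symbol x y (f a))"
  by (induction A rule: infinite_finite_induct) simp_all

definition symbol_fps :: "real \<Rightarrow> real \<Rightarrow> diffop fps \<Rightarrow> real fps" where
  "symbol_fps x y f = Abs_fps (\<lambda>n. symbol x y (fps_nth f n))"

lemma symbol_fps_nth [simp]: "fps_nth (symbol_fps x y f) n = symbol x y (fps_nth f n)"
  by (simp add: symbol_fps_def)

lemma symbol_fps_mult: "symbol_fps x y (f * g) = symbol_fps x y f * symbol_fps x y g"
  by (simp add: fps_eq_iff fps_mult_nth symbol_sum)

lemma symbol_fps_sum: "symbol_fps x y (sum f A) = (\<Sum>a\<in>A. symbol_fps x y (f a))"
  by (simp add: fps_eq_iff fps_sum_nth symbol_sum)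

lemma symbol_fps_0 [simp]: "symbol_fps x y 0 = 0" and symbol_fps_1 [simp]: "symbol_fps x y 1 = 1"
  by (auto simp: fps_eq_iff)

definition fps_matrix_exp :: "real fps^'n^'n \<Rightarrow> real fps^'n^'n" where
  "fps_matrix_exp B = (\<chi> i j. Abs_fps (\<lambda>n. \<Sum>k\<le>n. fps_nth (matrix_power B k $ i $ j) n / fact k))"

text \<open>Rows and columns are rescaled by the weights \<open>wr\<close> and \<open>wc\<close>; with powers of \<open>\<lambda>\<close> as weights
  this makes all the matrices of the scheme independent of \<open>\<lambda>\<close>.\<close>

definition symbol_matrix ::
  "real \<Rightarrow> real \<Rightarrow> ('r \<Rightarrow> real) \<Rightarrow> ('c \<Rightarrow> real) \<Rightarrow> diffop fps^'c^'r \<Rightarrow> real fps^'c^'r" where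
  "symbol_matrix x y wr wc X = (\<chi> i j. fps_const (wc j / wr i) * symbol_fps x y (X $ i $ j))"

text \<open>The weight of the summation index enters once as a column weight and once as a row
  weight, and cancels.\<close>

lemma symbol_matrix_mult:
  assumes "\<And>k. wm k \<noteq> 0"
  shows "symbol_matrix x y wr wc (X ** Y) = symbol_matrix x y wr wm X ** symbol_matrix x y wm wc Y"
proof -
  have "fps_const (wc j / wr i) * (symbol_fps x y (X $ i $ k) * symbol_fps x y (Y $ k $ j)) =
     fps_const (wm k / wr i) * symbol_fps x y (X $ i $ k) * (fps_const (wc j / wm k) * symbol_fps x y (Y $
       k $ j))" for i j k
  proof -
    have "fps_const (wc j / wr i) = fps_const (wm k / wr i) * fps_const (wc j / wm k)"
      using assms[of k] by simp
    then show ?thesis by (simp only: mult_ac)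
  qed
  then have "(\<Sum>k\<in>UNIV. fps_const (wc j / wr i) * (symbol_fps x y (X $ i $ k) * symbol_fps x y (Y $ k $ j))) =
    (\<Sum>k\<in>UNIV. fps_const (wm k / wr i) * symbol_fps x y (X $ i $ k) * (fps_const (wc j / wm k) * symbol_fps
      x y (Y $ k $ j)))" for i j
    by (intro sum.cong refl)
  then show ?thesis
    by (simp only: symbol_matrix_def matrix_matrix_mult_def vec_eq_iff symbol_fps_sum symbol_fps_mult
        sum_distrib_left vec_lambda_beta) blast
qed

lemma symbol_matrix_power:
  assumes "\<And>k. w k \<noteq> 0"
  shows "symbol_matrix x y w w (matrix_power B k) = matrix_power (symbol_matrix x y w w B) k"
proof (induction k)
  case 0
  then show ?case using assms by (simp add: symbol_matrix_def mat_def vec_eq_iff)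
qed (simp add: symbol_matrix_mult[where wm = w, OF assms])

lemma symbol_matrix_exp:
  assumes "\<And>k. w k \<noteq> 0"
  shows "symbol_matrix x y w w (formal_exp B) = fps_matrix_exp (symbol_matrix x y w w B)"
  unfolding fps_matrix_exp_def symbol_matrix_power[OF assms, symmetric]
  by (simp add: symbol_matrix_def formal_exp_def vec_eq_iff fps_eq_iff symbol_sum sum_distrib_left)

section \<open>Exponentials of matrices of power series\<close>

text \<open>The binomial theorem holds since scalar matrices commute with \<open>B\<close>. It is
  stated for entries with a fixed column, so the induction only has to peel off factors on the
  left.\<close>

lemma matrix_power_add_scalar:
  fixes B :: "'a::comm_ring_1^'n^'n"
  shows "matrix_power (mat c + B) k $ i $ j =
    (\<Sum>m\<le>k. of_nat (k choose m) * c ^ m * matrix_power B (k - m) $ i $ j)"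
proof (induction k arbitrary: i)
  case (Suc k)
  define b where "b m i = matrix_power B m $ i $ j" for m i
  have b_Suc: "(\<Sum>l\<in>UNIV. B $ i $ l * b m l) = b (Suc m) i" for m i
    by (simp add: b_def matrix_matrix_mult_def)
  have "matrix_power (mat c + B) (Suc k) $ i $ j =
     (\<Sum>l\<in>UNIV. (mat c $ i $ l + B $ i $ l) * (\<Sum>m\<le>k. of_nat (k choose m) * c ^ m * b (k - m) l))"
    by (simp add: matrix_matrix_mult_def Suc b_def)
  also have "\<dots> = c * (\<Sum>m\<le>k. of_nat (k choose m) * c ^ m * b (k - m) i) +
     (\<Sum>l\<in>UNIV. B $ i $ l * (\<Sum>m\<le>k. of_nat (k choose m) * c ^ m * b (k - m) l))"
    by (simp add: distrib_right sum.distrib mat_def if_distrib[where f = "\<lambda>x. x * _"] cong: if_cong)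
  also have "(\<Sum>l\<in>UNIV. B $ i $ l * (\<Sum>m\<le>k. of_nat (k choose m) * c ^ m * b (k - m) l)) =
     (\<Sum>m\<le>k. of_nat (k choose m) * c ^ m * (\<Sum>l\<in>UNIV. B $ i $ l * b (k - m) l))"
    unfolding sum_distrib_left by (subst sum.swap) (simp add: mult_ac)
  also have "\<dots> = (\<Sum>m\<le>k. of_nat (k choose m) * c ^ m * b (Suc k - m) i)"
    unfolding b_Suc by (intro sum.cong) (auto simp: Suc_diff_le)
  also have "\<dots> = (\<Sum>m\<le>Suc k. of_nat (k choose m) * c ^ m * b (Suc k - m) i)"
    by (simp add: binomial_eq_0)
  also have "\<dots> = b (Suc k) i + (\<Sum>m\<le>k. of_nat (k choose Suc m) * c ^ Suc m * b (k - m) i)"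
    by (subst sum.atMost_Suc_shift) simp
  also have "c * (\<Sum>m\<le>k. of_nat (k choose m) * c ^ m * b (k - m) i) + \<dots> =
     b (Suc k) i + (\<Sum>m\<le>k. of_nat (Suc k choose Suc m) * c ^ Suc m * b (k - m) i)"
    by (simp add: sum_distrib_left sum.distrib algebra_simps)
  also have "\<dots> = (\<Sum>m\<le>Suc k. of_nat (Suc k choose m) * c ^ m * b (Suc k - m) i)"
    by (subst sum.atMost_Suc_shift[of _ k]) simp
  finally show ?case by (simp add: b_def)
qed simp

text \<open>Exponentials of commuting matrices multiply. This is what separates transport along one
  velocity, a scalar, from right multiplication by exp(- \<Delta>t \<A>).\<close>

lemma fps_matrix_exp_add_scalar:
  fixes C :: "real fps^'n^'n"
  assumes C0: "\<And>i j. fps_nth (C $ i $ j) 0 = 0"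
  shows "fps_matrix_exp (mat (fps_const c * fps_X) + C) $ i $ j = fps_exp c * fps_matrix_exp C $ i $ j"
proof (rule fps_ext)
  fix n
  define q where "q p m = fps_nth (matrix_power C p $ i $ j) m" for p m
  have q0: "q p m = 0" if "m < p" for p m
    using matrix_power_nth_eq_0[OF C0 that] by (simp add: q_def)
  have pw: "fps_nth (matrix_power (mat (fps_const c * fps_X) + C) k $ i $ j) n / fact k =
      (\<Sum>m\<le>k. c ^ m / fact m * (q (k - m) (n - m) / fact (k - m)))" if "k \<le> n" for k
  proof -
    have scalar: "of_nat N * (fps_const c * fps_X) ^ m = fps_const (of_nat N * c ^ m) * fps_X ^ m" for N m
      by (simp add: power_mult_distrib fps_const_power fps_of_nat mult_ac flip: fps_const_mult)
    have "fps_nth (of_nat (k choose m) * (fps_const c * fps_X) ^ m * matrix_power C (k - m) $ i $ j) n =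
       of_nat (k choose m) * c ^ m * q (k - m) (n - m)" if "m \<le> k" for m
    proof -
      have eq: "of_nat (k choose m) * (fps_const c * fps_X) ^ m * matrix_power C (k - m) $ i $ j =
         fps_const (of_nat (k choose m) * c ^ m) * (fps_X ^ m * matrix_power C (k - m) $ i $ j)"
        by (simp only: scalar mult.assoc)
      show ?thesis
        unfolding eq using that \<open>k \<le> n\<close> by (simp add: q_def fps_X_power_mult_nth)
    qed
    then have "fps_nth (matrix_power (mat (fps_const c * fps_X) + C) k $ i $ j) n / fact k =
      (\<Sum>m\<le>k. of_nat (k choose m) * c ^ m * q (k - m) (n - m) / fact k)"
      unfolding matrix_power_add_scalar fps_sum_nth by (simp add: sum_divide_distrib)
    also have "\<dots> = (\<Sum>m\<le>k. c ^ m / fact m * (q (k - m) (n - m) / fact (k - m)))"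
      by (intro sum.cong) (auto simp: binomial_fact)
    finally show ?thesis .
  qed
  have "fps_nth (fps_matrix_exp (mat (fps_const c * fps_X) + C) $ i $ j) n =
      (\<Sum>k\<le>n. \<Sum>m\<le>k. c ^ m / fact m * (q (k - m) (n - m) / fact (k - m)))"
    unfolding fps_matrix_exp_def by (simp add: pw)
  \<comment> \<open>With k = m + p the triangle m \<le> k \<le> n becomes p \<le> n - m, which is
    exactly the range of summation for coefficient n - m of the exponential of
    \<open>C\<close>.\<close>
  also have "\<dots> = (\<Sum>m\<le>n. \<Sum>p\<le>n - m. c ^ m / fact m * (q p (n - m) / fact p))"
    by (simp add: sum.triangle_reindex_eq[symmetric] sum.Sigma)
      (intro sum.reindex_bij_witness[where i = "\<lambda>(m, p). (m + p, m)" and j = "\<lambda>(k, m). (m, k - m)"]; auto)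
  also have "\<dots> = fps_nth (fps_exp c * fps_matrix_exp C $ i $ j) n"
    by (simp add: fps_mult_nth fps_matrix_exp_def q_def sum_distrib_left atLeast0AtMost)
  finally show "fps_nth (fps_matrix_exp (mat (fps_const c * fps_X) + C) $ i $ j) n =
    fps_nth (fps_exp c * fps_matrix_exp C $ i $ j) n" .
qed

lemma matrix_power_diagonal:
  "matrix_power (\<chi> i j. if i = j then d i else 0) k = (\<chi> i j. if i = j then d i ^ k else 0)"
  for d :: "'n::finite \<Rightarrow> 'a::comm_ring_1"
proof (induction k)
  case (Suc k)
  then show ?case
    by (simp add: matrix_matrix_mult_def vec_eq_iff if_distrib[where f = "\<lambda>x. x * _"] cong: if_cong)
qed (simp add: mat_def vec_eq_iff)

lemma fps_matrix_exp_diagonal: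
  "fps_matrix_exp (\<chi> i j. if i = j then fps_const (c i) * fps_X else 0) = (\<chi> i j. if i
    = j then fps_exp (c i) else 0)"
proof -
  have "(\<Sum>k\<le>n. fps_nth ((fps_const a * fps_X) ^ k) n / fact k) = a ^ n / fact n" for a :: real and n
  proof -
    have "fps_nth ((fps_const a * fps_X) ^ k) n = (if k = n then a ^ n else 0)" for k
      by (simp add: power_mult_distrib fps_const_power fps_X_power_nth)
    then show ?thesis by (simp add: if_distrib[where f = "\<lambda>x. x / _"] cong: if_cong)
  qed
  then show ?thesis
    by (auto simp: fps_matrix_exp_def matrix_power_diagonal vec_eq_iff fps_eq_iff)
qed

text \<open>\<open>(e\<^sup>B - 1) (e\<^sup>B + 1)\<^sup>-\<^sup>1 = tanh (B / 2)\<close>, which is odd in \<open>B\<close>, and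
  \<open>2 tanh (B / 2) = B - B\<^sup>3 / 12 + B\<^sup>5 / 120 - \<dots>\<close>.\<close>

lemma fps_matrix_exp_tanh:
  fixes f :: "real fps^'n" and B :: "real fps^'n^'n"
  assumes B0: "\<And>i j. fps_nth (B $ i $ j) 0 = 0" and "n \<le> 5"
  defines "g \<equiv> f v* fps_matrix_exp B"
  shows "2 * fps_nth ((g - f) $ j) n = fps_nth (((g + f) v* matrix_power B 1) $ j) n
     - fps_nth (((g + f) v* matrix_power B 3) $ j) n / 12 + fps_nth (((g + f) v* matrix_power B 5) $ j) n / 120"
proof -
  define w where "w k = f v* matrix_power B k" for k
  have power_add: "matrix_power B (k + m) = matrix_power B k ** matrix_power B m" for k m
    by (induction k) (simp_all add: matrix_mul_assoc)
  have w0: "fps_nth (w k $ i) p = 0" if "p < k" for k p i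
    using that by (auto simp: w_def vector_matrix_mult_def fps_sum_nth fps_mult_nth
        matrix_power_nth_eq_0[OF B0] intro!: sum.neutral)
  \<comment> \<open>Powers of \<open>B\<close> beyond the fifth have no coefficient of order at most
    5, so \<open>g\<close> may be replaced by this finite sum.\<close>
  define g' where "g' = (\<chi> i. \<Sum>k\<le>5. fps_const (1 / fact k) * w k $ i)"
  have g: "fps_nth (g $ i) p = fps_nth (g' $ i) p" if "p \<le> 5" for i p
  proof -
    have "fps_nth (fps_matrix_exp B $ l $ i) q
      = (\<Sum>k\<le>5. fps_nth (matrix_power B k $ l $ i) q / fact k)" if "q \<le> 5" for l q
      unfolding fps_matrix_exp_def using that
      by (auto intro!: sum.mono_neutral_left) (metis matrix_power_nth_eq_0[OF B0] not_le)
    then have "fps_nth (g $ i) p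
      = (\<Sum>l\<in>UNIV. \<Sum>q=0..p. fps_nth (f $ l) q * (\<Sum>k\<le>5. fps_nth (matrix_power B k $ l $ i) (p - q) / fact k))"
      using that by (simp add: g_def vector_matrix_mult_def fps_sum_nth fps_mult_nth)
    also have "\<dots> = (\<Sum>l\<in>UNIV. \<Sum>q=0..p. \<Sum>k\<le>5. fps_nth (f $ l) q * fps_nth (matrix_power B k $ l $ i) (p
      - q) / fact k)"
      by (simp add: sum_distrib_left)
    also have "\<dots> = (\<Sum>l\<in>UNIV. \<Sum>k\<le>5. \<Sum>q=0..p. fps_nth (f $ l) q * fps_nth (matrix_power B k $ l $ i) (p
      - q) / fact k)"
      by (intro sum.cong refl sum.swap)
    also have "\<dots> = (\<Sum>k\<le>5. \<Sum>l\<in>UNIV. \<Sum>q=0..p. fps_nth (f $ l) q * fps_nth (matrix_power B k $ l $ i) (p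
      - q) / fact k)"
      by (rule sum.swap)
    also have "\<dots> = (\<Sum>k\<le>5. fps_nth (w k $ i) p / fact k)"
      by (simp add: w_def vector_matrix_mult_def fps_sum_nth fps_mult_nth sum_divide_distrib)
    also have "\<dots> = fps_nth (g' $ i) p"
      by (simp add: g'_def fps_sum_nth)
    finally show ?thesis .
  qed
  have "fps_nth ((g v* A) $ j) n = fps_nth ((g' v* A) $ j) n" for A :: "real fps^'n^'n"
    using g \<open>n \<le> 5\<close> by (simp add: vector_matrix_mult_def fps_sum_nth fps_mult_nth)
  moreover have "fps_nth ((g' v* matrix_power B m) $ j) n = (\<Sum>k\<le>5. fps_nth (w (k + m) $ j) n / fact k)" for m
  proof -
    have "(g' v* matrix_power B m) $ j
      = (\<Sum>l\<in>UNIV. \<Sum>k\<le>5. fps_const (1 / fact k) * (w k $ l * matrix_power B m $ l $ j))"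
      by (simp add: g'_def vector_matrix_mult_def sum_distrib_right mult.assoc)
    also have "\<dots> = (\<Sum>k\<le>5. fps_const (1 / fact k) * (w k v* matrix_power B m) $ j)"
      by (subst sum.swap) (simp add: vector_matrix_mult_def sum_distrib_left)
    also have "\<dots> = (\<Sum>k\<le>5. fps_const (1 / fact k) * w (k + m) $ j)"
      by (simp add: w_def power_add vector_matrix_mul_assoc)
    finally show ?thesis by (simp add: fps_sum_nth)
  qed
  ultimately have gm: "fps_nth ((g v* matrix_power B m) $ j) n = (\<Sum>k\<le>5. fps_nth (w (k + m) $ j) n / fact k)" for m
    by metis
  have fm: "fps_nth ((f v* matrix_power B m) $ j) n = fps_nth (w m $ j) n" for m
    by (simp add: w_def)
  have gf: "fps_nth (((g + f) v* matrix_power B m) $ j) n =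
      (\<Sum>k\<le>5. fps_nth (w (k + m) $ j) n / fact k) + fps_nth (w m $ j) n" for m
    by (simp add: vector_matrix_left_distrib gm fm)
  have atMost5: "{..5::nat} = {0, 1, 2, 3, 4, 5}" by auto
  have w0': "fps_nth (w k $ j) n = 0" if "k > 5" for k
    using that \<open>n \<le> 5\<close> by (intro w0) simp
  have g0: "fps_nth (g $ j) n - fps_nth (f $ j) n = (\<Sum>k\<le>5. fps_nth (w k $ j) n / fact k) - fps_nth (w 0 $ j) n"
    using gm[of 0] fm[of 0] by simp
  \<comment> \<open>Both sides are now combinations of \<open>w 0\<close> to \<open>w 5\<close>;
    they agree because (exp z + 1) (z - z^3/12 + z^5/120) = 2 (exp z - 1) up to the power
    z^5.\<close>
  show ?thesis
    unfolding gf vector_minus_component fps_sub_nth g0 atMost5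
    by (simp add: w0' fact_numeral field_simps flip: numeral_2_eq_2)
qed

section \<open>The recursion for the coefficients of the equivalent equations\<close>

text \<open>The matrix M \<Lambda> M^-1 for \<lambda> = 1, applied to one column \<open>u\<close>.
  The coefficients arise by multiplying each moment polynomial by x v_x + y v_y and expanding in the
  nine moments again, with (v_x)^3 = v_x and (v_y)^3 = v_y on the lattice; for instance (v_x)^2 =
  2/3 + m_\<epsilon>/6 + m_xx/2.\<close>

fun flux :: "real \<Rightarrow> real \<Rightarrow> (moment \<Rightarrow> real) \<Rightarrow> moment \<Rightarrow> real" where
  "flux x y u (Inl Rho) = x * u (Inl Qx) + y * u (Inl Qy)"
| "flux x y u (Inl Qx) = x * (2/3 * u (Inl Rho) + 1/6 * u (Inr Epsi) + 1/2 * u (Inr PhiXX)) + y * u (Inr PhiXY)"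
| "flux x y u (Inl Qy) = y * (2/3 * u (Inl Rho) + 1/6 * u (Inr Epsi) - 1/2 * u (Inr PhiXX)) + x * u (Inr PhiXY)"
| "flux x y u (Inr Epsi) = x * (u (Inl Qx) + u (Inr PhiX)) + y * (u (Inl Qy) + u (Inr PhiY))"
| "flux x y u (Inr Epsi2) = x * u (Inr PhiX) + y * u (Inr PhiY)"
| "flux x y u (Inr PhiX) = x * (1/3 * u (Inr Epsi) + 1/3 * u (Inr Epsi2) - u (Inr PhiXX)) + y * u (Inr PhiXY)"
| "flux x y u (Inr PhiY) = y * (1/3 * u (Inr Epsi) + 1/3 * u (Inr Epsi2) + u (Inr PhiXX)) + x * u (Inr PhiXY)"
| "flux x y u (Inr PhiXX) = 1/3 * x * (u (Inl Qx) - u (Inr PhiX)) - 1/3 * y * (u (Inl Qy) - u (Inr PhiY))"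
| "flux x y u (Inr PhiXY) = 1/3 * y * (2 * u (Inl Qx) + u (Inr PhiX)) + 1/3 * x * (2 * u (Inl Qy) + u (Inr PhiY))"

abbreviation speed :: "real \<Rightarrow> real \<Rightarrow> velocity \<Rightarrow> real" where
  "speed x y v \<equiv> x * dir_coord (fst v) + y * dir_coord (snd v)"

lemma flux_moment_unit: "flux x y (\<lambda>k. moment_unit k v) i = speed x y v * moment_unit i v"
  by (cases i rule: moment_cases; rule dir.exhaust[of "fst v"]; rule dir.exhaust[of "snd v"])
    (simp_all add: algebra_simps)

lemma flux_sum: "flux x y (\<lambda>k. \<Sum>v\<in>A. u v k * c v) i = (\<Sum>v\<in>A. flux x y (u v) i * c v)"
  by (cases i rule: moment_cases)
    (simp_all add: sum.distrib sum_subtractf sum_distrib_left algebra_simps)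

type_synonym moment_series = "nat \<Rightarrow> moment \<Rightarrow> conserved \<Rightarrow> real"

text \<open>Coefficient n of L X = \<Gamma> X - X \<A>. The factor \<Delta>t is left out, so that
  \<open>commutator\<close> preserves the order and powers of \<Delta>t are accounted for by index
  shifts.\<close>

definition commutator ::
  "real \<Rightarrow> real \<Rightarrow> (nat \<Rightarrow> conserved \<Rightarrow> conserved \<Rightarrow> real) \<Rightarrow> moment_series \<Rightarrow> moment_series" where
  "commutator x y a X n i j = flux x y (\<lambda>k. X n k j) i - (\<Sum>l\<in>UNIV. \<Sum>p=0..n. X p i l * a (n - p) l j)"

text \<open>\<open>V\<close> and \<open>D\<close> are the average and the difference of the moments before and after the collision,
  \<open>a n\<close> is the symbol of \<open>A\<^sub>n\<^sub>+\<^sub>1\<close>, and the last assumption is \<open>D = 2 tanh (\<Delta>t L / 2) V\<close> up to order 5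
  with \<open>L\<close> the commutator.\<close>

locale moment_expansion =
  fixes x y :: real and E :: "nonconserved \<Rightarrow> conserved \<Rightarrow> real" and \<sigma> :: "nonconserved \<Rightarrow> real"
    and a :: "nat \<Rightarrow> conserved \<Rightarrow> conserved \<Rightarrow> real" and V D :: moment_series
  assumes V_conserved: "V n (Inl i) j = (if n = 0 \<and> i = j then 1 else 0)"
    and V_nonconserved: "V n (Inr k) j = (if n = 0 then E k j else 0) - \<sigma> k * D n (Inr k) j"
    and D_conserved: "D n (Inl i) j = 0"
    and D_0: "D 0 r j = 0"
    and D_Suc: "n < 5 \<Longrightarrow> D (Suc n) r j = commutator x y a V n r j
        - (if n < 2 then 0 else (commutator x y a ^^ 3) V (n - 2) r j / 12)
        + (if n < 4 then 0 else (commutator x y a ^^ 5) V (n - 4) r j / 120)"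

text \<open>The same operator L before the change of basis by M: here \<Gamma> is diagonal, and each
  row is treated separately.\<close>

definition velocity_commutator ::
  "(velocity \<Rightarrow> real) \<Rightarrow> real fps^conserved^conserved \<Rightarrow> real fps^conserved^velocity \<Rightarrow> real
    fps^conserved^velocity" where
  "velocity_commutator c A X = (\<chi> v. fps_const (c v) *s (X $ v) - (X $ v) v* A)"

definition moments_of :: "real fps^conserved^velocity \<Rightarrow> moment_series" where
  "moments_of X n i j = (\<Sum>v\<in>UNIV. moment_unit i v * fps_nth (X $ v $ j) n)"

lemma moments_of_commutator:
  "moments_of (velocity_commutator (speed x y) A X) =
     commutator x y (\<lambda>n i j. fps_nth (A $ i $ j) n) (moments_of X)"
proof (intro ext)
  fix n i j
  have "flux x y (\<lambda>k. moments_of X n k j) i = (\<Sum>v\<in>UNIV. speed x y v * moment_unit i v * fps_nth (X $ v $ j) n)"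
    unfolding moments_of_def flux_sum flux_moment_unit ..
  moreover have "(\<Sum>l\<in>UNIV. \<Sum>p=0..n. moments_of X p i l * fps_nth (A $ l $ j) (n - p)) =
      (\<Sum>v\<in>UNIV. moment_unit i v * fps_nth ((X $ v v* A) $ j) n)"
  proof -
    have "(\<Sum>l\<in>UNIV. \<Sum>p=0..n. moments_of X p i l * fps_nth (A $ l $ j) (n - p)) =
      (\<Sum>l\<in>UNIV. \<Sum>p=0..n. \<Sum>v\<in>UNIV. moment_unit i v * (fps_nth (X $ v $ l) p * fps_nth (A $ l $ j) (n - p)))"
      by (simp add: moments_of_def sum_distrib_right mult.assoc)
    also have "\<dots> = (\<Sum>l\<in>UNIV. \<Sum>v\<in>UNIV. \<Sum>p=0..n. moment_unit i v * (fps_nth (X $ v $ l) p * fps_nth (A $ l $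
      j) (n - p)))"
      by (intro sum.cong refl sum.swap)
    also have "\<dots> = (\<Sum>v\<in>UNIV. \<Sum>l\<in>UNIV. \<Sum>p=0..n. moment_unit i v * (fps_nth (X $ v $ l) p * fps_nth (A $ l $
      j) (n - p)))"
      by (rule sum.swap)
    finally show ?thesis
      by (simp add: vector_matrix_mult_def fps_sum_nth fps_mult_nth sum_distrib_left)
  qed
  ultimately show "moments_of (velocity_commutator (speed x y) A X) n i j =
      commutator x y (\<lambda>n i j. fps_nth (A $ i $ j) n) (moments_of X) n i j"
    by (simp add: commutator_def moments_of_def velocity_commutator_def sum_subtractf algebra_simps)
qed

lemma smult_vector_matrix_assoc: "(c *s u) v* A = c *s (u v* A)"
  for c :: "'a::comm_semiring_1"
  by (simp add: vector_matrix_mult_def vec_eq_iff sum_distrib_left mult.assoc)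

text \<open>For row v of \<open>X\<close>, the left multiplication by \<Lambda> is the scalar c(v),
  so multiplying that row by \<Delta>t (c(v) - A) is the same as taking row v of \<Delta>t L X.
  Iteration turns a power of a 3 x 3 matrix into a power of L.\<close>

lemma row_mult_scalar_minus_power:
  fixes X :: "real fps^conserved^velocity" and c :: "velocity \<Rightarrow> real" and A :: "real fps^conserved^conserved"
  defines "B \<equiv> \<lambda>v. mat (fps_const (c v) * fps_X) + map_matrix (\<lambda>f. - (fps_X * f)) A"
  shows "X $ v v* matrix_power (B v) k = fps_X ^ k *s ((velocity_commutator c A ^^ k) X $ v)"
proof (induction k arbitrary: X)
  case (Suc k)
  have "X $ v v* B v = fps_X *s (velocity_commutator c A X $ v)"
    by (simp add: B_def vec_eq_iff vector_matrix_mult_def velocity_commutator_def map_matrix_def mat_def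
        distrib_left sum.distrib sum_negf sum_distrib_left right_diff_distrib sum_subtractf
        if_distrib[where f = "\<lambda>x. _ * x"] mult_ac cong: if_cong)
  then have "X $ v v* matrix_power (B v) (Suc k) =
      fps_X *s (velocity_commutator c A X $ v v* matrix_power (B v) k)"
    by (simp add: vector_matrix_mul_assoc[symmetric] smult_vector_matrix_assoc)
  also have "\<dots> = fps_X ^ Suc k *s ((velocity_commutator c A ^^ Suc k) X $ v)"
    unfolding Suc by (simp add: vector_smult_assoc funpow_swap1)
  finally show ?case .
qed simp

text \<open>In velocity coordinates let f = M^-1 \<Psi> and g = M^-1 J \<Psi>. The scheme gives, for
  each v, that row v of g is row v of f times exp(\<Delta>t (c(v) - A)). The tanh identity is
  applied to each row, and M carries the result back to moments, where L becomes
  \<open>commutator\<close>.\<close>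

lemma moment_expansion_of_scheme:
  assumes lam: "lam \<noteq> 0" and s: "\<And>k. s k \<noteq> 0"
    and pair: "is_equivalent_pair lam E s \<Psi> \<A>"
  shows "\<exists>V D. moment_expansion x y E (relax_sigma s)
    (\<lambda>n i j. lam ^ conserved_degree j / lam ^ conserved_degree i *
       symbol (x / lam) (y / lam) (fps_nth (\<A> $ i $ j) n)) V D"
proof -
  \<comment> \<open>The weights are \<lambda>^degree on moments and 1 on velocities. Together with
    evaluation at (x/\<lambda>, y/\<lambda>), which cancels the factor \<lambda> of every velocity,
    they turn all matrices of the scheme into those for \<lambda> = 1.\<close>
  define wm where "wm i = lam ^ moment_degree i" for i
  define ww where "ww i = lam ^ conserved_degree i" for i
  define one where "one v = (1::real)" for v :: velocity
  have wm: "wm i \<noteq> 0" and ww: "ww j \<noteq> 0" and one: "one v \<noteq> 0" for i j v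
    using lam by (simp_all add: wm_def ww_def one_def)
  define MA where "MA = (map_matrix fps_const (moment_matrix 1) :: real fps^velocity^moment)"
  define NA where "NA = (map_matrix fps_const (moment_inverse 1) :: real fps^moment^velocity)"
  define CA where "CA = (map_matrix fps_const (collision_matrix 1 E s) :: real fps^moment^moment)"
  define A where "A = symbol_matrix (x / lam) (y / lam) ww ww \<A>"
  define U where "U = symbol_matrix (x / lam) (y / lam) wm ww \<Psi>"
  define md where "md = map_matrix (\<lambda>f. - (fps_X * f)) A"
  define f where "f = NA ** U"
  define g where "g = NA ** (CA ** U)"
  have S_lift_M: "symbol_matrix (x / lam) (y / lam) wm one (lift_matrix (moment_matrix lam)) = MA"
    using lam by (simp add: symbol_matrix_def MA_def map_matrix_def vec_eq_iff fps_eq_iff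
        moment_matrix_eq one_def wm_def)
  have S_lift_N: "symbol_matrix (x / lam) (y / lam) one wm (lift_matrix (matrix_inv (moment_matrix lam))) = NA"
    using lam by (simp add: symbol_matrix_def NA_def map_matrix_def vec_eq_iff fps_eq_iff
        matrix_inv_moment_matrix moment_inverse_def one_def wm_def)
  have degree: "lam ^ (nonconserved_degree k - conserved_degree j) * lam ^ conserved_degree j
    = lam ^ nonconserved_degree k" for k j
  proof -
    have "conserved_degree j \<le> nonconserved_degree k" by (cases k; cases j) simp_all
    then show ?thesis by (simp flip: power_add)
  qed
  have S_lift_C: "symbol_matrix (x / lam) (y / lam) wm wm (lift_matrix (collision_matrix lam E s)) = CA"
  proof -
    have "wm j / wm i * collision_matrix lam E s $ i $ j = collision_matrix 1 E s $ i $ j" for i j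
    proof (cases i)
      case (Inl i')
      then show ?thesis using wm by (auto simp: mat_def)
    next
      case (Inr k)
      then show ?thesis
      proof (cases j)
        case (Inl j')
        have "wm j / wm i * (s k * (E k j' * lam ^ (nonconserved_degree k - conserved_degree j'))) =
           s k * E k j' * (lam ^ (nonconserved_degree k
             - conserved_degree j') * lam ^ conserved_degree j') / wm i"
          by (simp add: Inl wm_def mult_ac)
        also have "\<dots> = s k * E k j'"
          unfolding degree using lam by (simp add: Inr wm_def)
        finally show ?thesis
          by (simp add: Inl Inr equilibrium_matrix_def)
      qed (use wm Inr in auto)
    qed
    then show ?thesis
      by (simp add: symbol_matrix_def CA_def map_matrix_def vec_eq_iff fps_eq_iff
          if_distrib[where f = "symbol _ _"] cong: if_cong)
  qed
  have S_adv: "symbol_matrix (x / lam) (y / lam) one one (minus_dt_times (advection_matrix lam)) =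
      (\<chi> v w. if v = w then fps_const (- speed x y v) * fps_X else 0)"
    using lam by (auto simp: symbol_matrix_def vec_eq_iff fps_eq_iff fps_nth_minus_dt_times
        advection_matrix_def one_def vel_x_def vel_y_def)
  have S_md: "symbol_matrix (x / lam) (y / lam) ww ww (minus_dt_times \<A>) = md"
    by (auto simp: symbol_matrix_def vec_eq_iff fps_eq_iff fps_nth_minus_dt_times md_def A_def map_matrix_def)
  have scheme: "MA ** (\<chi> v w. if v = w then fps_exp (- speed x y v) else 0) ** NA ** CA ** U =
      U ** fps_matrix_exp md"
  proof -
    have "symbol_matrix (x / lam) (y / lam) wm ww (time_step_matrix lam E s ** \<Psi>)
      = symbol_matrix (x / lam) (y / lam) wm ww (\<Psi> ** formal_exp (minus_dt_times \<A>))"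
      using pair by (simp add: is_equivalent_pair_def)
    then show ?thesis
      unfolding time_step_matrix_def
        symbol_matrix_mult[where wm = wm, OF wm, of _ _ wm ww] symbol_matrix_mult[where wm
          = wm, OF wm, of _ _ wm wm]
        symbol_matrix_mult[where wm = one, OF one] symbol_matrix_mult[where wm = ww, OF ww]
        symbol_matrix_exp[OF one] symbol_matrix_exp[OF ww]
      unfolding S_lift_M S_lift_N S_lift_C S_adv S_md fps_matrix_exp_diagonal U_def .
  qed
  have const_mult: "map_matrix fps_const P ** map_matrix fps_const Q = map_matrix fps_const (P ** Q)"
    for P :: "real^'q^'p" and Q :: "real^'r^'q"
    by (simp add: matrix_matrix_mult_def map_matrix_def vec_eq_iff fps_eq_iff fps_sum_nth)
  have const_1: "map_matrix fps_const (mat 1 :: real^'q^'q) = mat 1"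
    by (simp add: map_matrix_def vec_eq_iff mat_def)
  have MN: "MA ** NA = mat 1" and NM: "NA ** MA = mat 1"
    by (simp_all add: MA_def NA_def const_mult const_1 moment_inverse_left moment_inverse_right)
  \<comment> \<open>Multiplication by M^-1 decouples the velocities; multiplication by exp(c(v)
    \<Delta>t) then moves the transport factor to the right side, where it merges with exp(-
    \<Delta>t A).\<close>
  have row: "g $ v = f $ v v* fps_matrix_exp (mat (fps_const (speed x y v) * fps_X) + md)" for v
  proof -
    have md0: "fps_nth (md $ i $ j) 0 = 0" for i j
      by (simp add: md_def map_matrix_def)
    have "NA ** (MA ** (\<chi> v w. if v = w then fps_exp (- speed x y v) else 0) ** NA ** CA ** U) =
       NA ** (U ** fps_matrix_exp md)"
      unfolding scheme ..
    then have "(\<chi> v w. if v = w then fps_exp (- speed x y v) else 0) ** g = f ** fps_matrix_exp md"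
      unfolding g_def f_def matrix_mul_assoc NM matrix_mul_lid .
    then have "((\<chi> v w. if v = w then fps_exp (- speed x y v) else 0) ** g) $ v $ j
      = (f ** fps_matrix_exp md) $ v $ j" for j
      by simp
    then have "fps_exp (- speed x y v) * g $ v $ j = (\<Sum>i\<in>UNIV. f $ v $ i * fps_matrix_exp md $ i $ j)" for j
      by (simp add: matrix_matrix_mult_def if_distrib[where f = "\<lambda>x. x * _"] cong: if_cong)
    then have "fps_exp (speed x y v) * (fps_exp (- speed x y v) * g $ v $ j) =
        (\<Sum>i\<in>UNIV. f $ v $ i * (fps_exp (speed x y v) * fps_matrix_exp md $ i $ j))" for j
      by (simp add: sum_distrib_left mult_ac)
    moreover have "fps_exp (speed x y v) * fps_exp (- speed x y v) = 1"
      by (simp flip: fps_exp_add_mult)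
    ultimately show ?thesis
      unfolding vec_eq_iff vector_matrix_mult_def
      by (simp add: fps_matrix_exp_add_scalar[OF md0] flip: mult.assoc)
  qed
  \<comment> \<open>The average of the states before and after collision; the factor 1/2 absorbs the
    2 in the tanh identity.\<close>
  define h where "h = (\<chi> v. fps_const (1/2) *s (g $ v + f $ v))"
  let ?K = "velocity_commutator (speed x y) A"
  have tanh: "fps_nth (g $ v $ j) n - fps_nth (f $ v $ j) n = fps_nth (fps_X ^ 1 * (?K ^^ 1) h $ v $ j) n
      - fps_nth (fps_X ^ 3 * (?K ^^ 3) h $ v $ j) n / 12 + fps_nth (fps_X ^ 5 * (?K ^^ 5) h $ v $ j) n / 120"
    if "n \<le> 5" for n v j
  proof -
    define B where "B = mat (fps_const (speed x y v) * fps_X) + md"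
    have B0: "fps_nth (B $ i $ j) 0 = 0" for i j
      by (simp add: B_def md_def map_matrix_def mat_def)
    have pw: "fps_nth (((g $ v + f $ v) v* matrix_power B k) $ j) n
      = 2 * fps_nth (fps_X ^ k * (?K ^^ k) h $ v $ j) n" for k
    proof -
      have "fps_const (1/2) *s ((g $ v + f $ v) v* matrix_power B k) = h $ v v* matrix_power B k"
        by (simp only: h_def smult_vector_matrix_assoc vec_lambda_beta)
      also have "\<dots> = fps_X ^ k *s ((?K ^^ k) h $ v)"
        unfolding B_def md_def by (rule row_mult_scalar_minus_power)
      finally have "fps_nth ((fps_const (1/2) *s ((g $ v + f $ v) v* matrix_power B k)) $ j) n =
          fps_nth ((fps_X ^ k *s ((?K ^^ k) h $ v)) $ j) n" by (rule arg_cong)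
      then show ?thesis by simp
    qed
    have halve: "p = q - r / 12 + t / 120" if "2 * p = 2 * q - 2 * r / 12 + 2 * t / 120" for p q r t :: real
      using that by linarith
    show ?thesis
      using fps_matrix_exp_tanh[OF B0 \<open>n \<le> 5\<close>, of "f $ v" j]
      unfolding row[of v, folded B_def, symmetric] pw vector_minus_component fps_sub_nth by (rule halve)
  qed
  define V where "V = moments_of h"
  define D where "D n i j = moments_of g n i j - moments_of f n i j" for n i j
  have moments: "moments_of X n i j = fps_nth ((MA ** X) $ i $ j) n" for X n i j
    by (simp add: moments_of_def MA_def matrix_matrix_mult_def map_matrix_def fps_sum_nth moment_matrix_eq)
  have mf: "moments_of f n i j = fps_nth (U $ i $ j) n" for n i j
    by (simp add: moments f_def matrix_mul_assoc MN)
  have mg: "moments_of g n i j = fps_nth ((CA ** U) $ i $ j) n" for n i j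
    by (simp add: moments g_def matrix_mul_assoc MN)
  have V: "V n i j = (moments_of g n i j + moments_of f n i j) / 2" for n i j
    by (simp add: V_def moments_of_def h_def sum.distrib sum_divide_distrib algebra_simps add_divide_distrib)
  have U_conserved: "U $ Inl i $ j = mat 1 $ i $ j" for i j
    using pair wm[of "Inl i"]
    by (auto simp: U_def symbol_matrix_def is_equivalent_pair_def mat_def wm_def ww_def)
  have CU_conserved: "(CA ** U) $ Inl i $ j = mat 1 $ i $ j" for i j
    by (simp add: CA_def matrix_matrix_mult_def map_matrix_def mat_def U_conserved
        if_distrib[where f = "\<lambda>x. x * _"] if_distrib[where f = fps_const] cong: if_cong)
  have CU_nonconserved: "fps_nth ((CA ** U) $ Inr k $ j) n =
      (if n = 0 then s k * E k j else 0) + (1 - s k) * fps_nth (U $ Inr k $ j) n" for k j n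
    by (simp add: CA_def matrix_matrix_mult_def map_matrix_def mat_def U_conserved sum_Plus_UNIV
        equilibrium_matrix_def if_distrib[where f = "\<lambda>x. x * _"] if_distrib[where f = "\<lambda>x. _ * x"]
        if_distrib[where f = fps_const] cong: if_cong)
  have comm: "moments_of ((?K ^^ k) h) = (commutator x y (\<lambda>n i j. fps_nth (A $ i $ j) n) ^^ k) V" for k
    by (induction k) (simp_all add: V_def moments_of_commutator)
  have D: "D n i j = (if n < 1 then 0 else moments_of ((?K ^^ 1) h) (n - 1) i j) -
      (if n < 3 then 0 else moments_of ((?K ^^ 3) h) (n - 3) i j) / 12 +
      (if n < 5 then 0 else moments_of ((?K ^^ 5) h) (n - 5) i j) / 120" if "n \<le> 5" for n i j
  proof -
    have shift: "(\<Sum>v\<in>UNIV. moment_unit i v * fps_nth (fps_X ^ k * (?K ^^ k) h $ v $ j) n) =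
      (if n < k then 0 else moments_of ((?K ^^ k) h) (n - k) i j)" for k
      by (simp add: fps_X_power_mult_nth moments_of_def)
    have "D n i j = (\<Sum>v\<in>UNIV. moment_unit i v * (fps_nth (g $ v $ j) n - fps_nth (f $ v $ j) n))"
      by (simp add: D_def moments_of_def sum_subtractf algebra_simps)
    also have "\<dots> = (\<Sum>v\<in>UNIV. moment_unit i v * fps_nth (fps_X ^ 1 * (?K ^^ 1) h $ v $ j) n)
      - (\<Sum>v\<in>UNIV. moment_unit i v * fps_nth (fps_X ^ 3 * (?K ^^ 3) h $ v $ j) n) / 12
      + (\<Sum>v\<in>UNIV. moment_unit i v * fps_nth (fps_X ^ 5 * (?K ^^ 5) h $ v $ j) n) / 120"
      unfolding tanh[OF that] by (simp only: distrib_left right_diff_distrib sum.distrib sum_subtractf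
          times_divide_eq_right sum_divide_distrib)
    finally show ?thesis unfolding shift .
  qed
  have "moment_expansion x y E (relax_sigma s) (\<lambda>n i j. fps_nth (A $ i $ j) n) V D"
  proof
    show "V n (Inl i) j = (if n = 0 \<and> i = j then 1 else 0)" for n i j
      by (simp add: V mf mg U_conserved CU_conserved mat_def)
    show "D n (Inl i) j = 0" for n i j
      by (simp add: D_def mf mg U_conserved CU_conserved)
    \<comment> \<open>With lower block Y of \<Psi>, the collision produces s E + (1 - s) Y, so D = s
      (E - Y) and V = Y + D/2 = E - (1/s - 1/2) D, where \<open>E\<close> enters only at order
      0.\<close>
    show "V n (Inr k) j = (if n = 0 then E k j else 0) - relax_sigma s k * D n (Inr k) j" for n k j
      using s[of k] by (simp add: V D_def mf mg CU_nonconserved relax_sigma_def field_simps)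
    show "D 0 i j = 0" for i j
      using D[of 0] by simp
    show "D (Suc n) i j = commutator x y (\<lambda>n i j. fps_nth (A $ i $ j) n) V n i j
        - (if n < 2 then 0 else (commutator x y (\<lambda>n i j. fps_nth (A $ i $ j) n) ^^ 3) V (n - 2) i j / 12)
        + (if n < 4 then 0 else (commutator x y (\<lambda>n i j. fps_nth (A $ i $ j) n) ^^ 5) V (n - 4) i j / 120)"
      if "n < 5" for n i j
      using that unfolding comm[symmetric] using comm[of 1] by (subst D) auto
  qed
  moreover have "(\<lambda>n i j. fps_nth (A $ i $ j) n) = (\<lambda>n i j. lam ^ conserved_degree j / lam ^ conserved_degree i *
       symbol (x / lam) (y / lam) (fps_nth (\<A> $ i $ j) n))"
    by (simp add: A_def symbol_matrix_def ww_def)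
  ultimately show ?thesis by metis
qed

section \<open>Symmetric tensors and isotropy\<close>

abbreviation twos :: "2 list \<Rightarrow> nat" where
  "twos \<alpha> \<equiv> length (filter (\<lambda>a. a \<noteq> 1) \<alpha>)"

abbreviation list_monom :: "'a \<Rightarrow> 'a \<Rightarrow> 2 list \<Rightarrow> 'a::comm_monoid_mult" where
  "list_monom x y \<alpha> \<equiv> prod_list (map (\<lambda>a. if a = 1 then x else y) \<alpha>)"

lemma finite_lists_length: "finite {\<alpha> :: 2 list. length \<alpha> = n}"
  using finite_lists_length_eq[of "UNIV :: 2 set" n] by simp

lemma sum_lists_Suc:
  "(\<Sum>\<alpha> | length \<alpha> = Suc n. f \<alpha>) = (\<Sum>\<alpha> | length \<alpha> = n. f (1 # \<alpha>)) + (\<Sum>\<alpha> | length \<alpha> = n. f (2 # \<alpha>))"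
  for f :: "2 list \<Rightarrow> 'a::comm_monoid_add"
proof -
  have "{\<alpha> :: 2 list. length \<alpha> = Suc n} = (#) 1 ` {\<alpha>. length \<alpha> = n} \<union> (#) 2 ` {\<alpha>. length \<alpha> = n}"
  proof safe
    fix \<alpha> :: "2 list" assume "length \<alpha> = Suc n" and "\<alpha> \<notin> (#) 2 ` {\<alpha>. length \<alpha> = n}"
    then show "\<alpha> \<in> (#) 1 ` {\<alpha>. length \<alpha> = n}"
      by (cases \<alpha>) (use exhaust_2 in \<open>auto simp: image_iff\<close>)
  qed auto
  moreover have "(#) 1 ` {\<alpha>. length \<alpha> = n} \<inter> (#) (2::2) ` {\<alpha>. length \<alpha> = n} = {}"
    by auto
  ultimately show ?thesis
    by (simp add: sum.union_disjoint finite_lists_length sum.reindex)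
qed

text \<open>Index lists are grouped by their number of entries 2; there are n choose k lists with k
  such entries, all with the same summand. The induction changes \<open>f\<close>, since a leading 2
  shifts its argument.\<close>

lemma sum_lists_twos:
  fixes x y :: "'a::comm_ring_1"
  shows "(\<Sum>\<alpha> | length \<alpha> = n. f (twos \<alpha>) * list_monom x y \<alpha>) = (\<Sum>k\<le>n. of_nat (n choose k) * f k * x ^ (n
    - k) * y ^ k)"
proof (induction n arbitrary: f)
  case (Suc n)
  have "(\<Sum>\<alpha> | length \<alpha> = Suc n. f (twos \<alpha>) * list_monom x y \<alpha>) =
     x * (\<Sum>\<alpha> | length \<alpha> = n. f (twos \<alpha>) * list_monom x y \<alpha>) +
     y * (\<Sum>\<alpha> | length \<alpha> = n. f (Suc (twos \<alpha>)) * list_monom x y \<alpha>)"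
    by (simp add: sum_lists_Suc sum_distrib_left mult_ac)
  also have "\<dots> = x * (\<Sum>k\<le>n. of_nat (n choose k) * f k * x ^ (n - k) * y ^ k) +
     y * (\<Sum>k\<le>n. of_nat (n choose k) * f (Suc k) * x ^ (n - k) * y ^ k)"
    unfolding Suc.IH[of f] Suc.IH[of "\<lambda>k. f (Suc k)"] ..
  also have "x * (\<Sum>k\<le>n. of_nat (n choose k) * f k * x ^ (n - k) * y ^ k) =
     (\<Sum>k\<le>n. of_nat (n choose k) * f k * x ^ (Suc n - k) * y ^ k)"
    unfolding sum_distrib_left by (intro sum.cong) (auto simp: Suc_diff_le mult_ac)
  also have "\<dots> = (\<Sum>k\<le>Suc n. of_nat (n choose k) * f k * x ^ (Suc n - k) * y ^ k)"
    by (simp add: binomial_eq_0)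
  also have "\<dots> = f 0 * x ^ Suc n + (\<Sum>k\<le>n. of_nat (n choose Suc k) * f (Suc k) * x ^ (n - k) * y ^ Suc k)"
    by (subst sum.atMost_Suc_shift) simp
  also have "\<dots> + y * (\<Sum>k\<le>n. of_nat (n choose k) * f (Suc k) * x ^ (n - k) * y ^ k) =
     f 0 * x ^ Suc n + (\<Sum>k\<le>n. of_nat (Suc n choose Suc k) * f (Suc k) * x ^ (n - k) * y ^ Suc k)"
    by (simp add: sum_distrib_left sum.distrib algebra_simps)
  also have "\<dots> = (\<Sum>k\<le>Suc n. of_nat (Suc n choose k) * f k * x ^ (Suc n - k) * y ^ k)"
    by (subst sum.atMost_Suc_shift[of _ n]) simp
  finally show ?case .
qed simp

lemma symmetric_tensor_twos:
  assumes "symmetric_tensor T" "length \<alpha> = n"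
  shows "T i \<alpha> j = T i (replicate (n - twos \<alpha>) 1 @ replicate (twos \<alpha>) 2) j"
proof -
  have "mset \<alpha> = replicate_mset (length \<alpha> - twos \<alpha>) 1 + replicate_mset (twos \<alpha>) 2"
  proof (induction \<alpha>)
    case (Cons b \<alpha>)
    have "twos \<alpha> \<le> length \<alpha>" by simp
    then show ?case using Cons exhaust_2[of b] by (auto simp: Suc_diff_le)
  qed simp
  then show ?thesis
    using assms unfolding symmetric_tensor_def by (metis mset_append mset_replicate)
qed

definition tensor_symbol :: "nat \<Rightarrow> tensor \<Rightarrow> real \<Rightarrow> real \<Rightarrow> conserved \<Rightarrow> conserved \<Rightarrow> real" where
  "tensor_symbol n T x y i j = (\<Sum>\<alpha> | length \<alpha> = n. T i \<alpha> j * list_monom x y \<alpha>)"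

text \<open>Polarization: at x = 1 the symbol is a polynomial in y whose coefficients are the tensor
  entries times binomial coefficients, so it determines a symmetric tensor completely.\<close>

lemma tensor_symbol_eqD:
  assumes T: "is_tensor n T" "symmetric_tensor T" and T': "is_tensor n T'" "symmetric_tensor T'"
    and eq: "\<And>x y i j. tensor_symbol n T x y i j = tensor_symbol n T' x y i j"
  shows "T = T'"
proof (intro ext)
  fix i \<alpha> j
  define l where "l k = replicate (n - k) (1::2) @ replicate k 2" for k
  have symb: "tensor_symbol n S 1 y i j = (\<Sum>k\<le>n. (real (n choose k) * S i (l k) j) * y ^ k)"
    if "symmetric_tensor S" for S y
  proof -
    have "tensor_symbol n S 1 y i j = (\<Sum>\<alpha> | length \<alpha> = n. S i (l (twos \<alpha>)) j * list_monom 1 y \<alpha>)"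
      unfolding tensor_symbol_def l_def using symmetric_tensor_twos[OF that, of _ n i j]
      by (intro sum.cong) auto
    then show ?thesis using sum_lists_twos[of "\<lambda>k. S i (l k) j" 1 y n] by simp
  qed
  have "(\<Sum>k\<le>n. real (n choose k) * (T i (l k) j - T' i (l k) j) * y ^ k) = 0" for y
    using eq[of 1 y i j] symb[OF T(2), of y] symb[OF T'(2), of y]
    by (simp add: sum_subtractf algebra_simps)
  then have *: "T i (l k) j = T' i (l k) j" if "k \<le> n" for k
    using polyfun_eq_0[of "\<lambda>k. real (n choose k) * (T i (l k) j - T' i (l k) j)" n] that by simp
  show "T i \<alpha> j = T' i \<alpha> j"
  proof (cases "length \<alpha> = n")
    case True
    then show ?thesis
      using symmetric_tensor_twos[OF T(2) True] symmetric_tensor_twos[OF T'(2) True]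
        *[of "twos \<alpha>"] length_filter_le[of _ \<alpha>] by (simp add: l_def)
  next
    case False
    then show ?thesis using T(1) T'(1) by (simp add: is_tensor_def)
  qed
qed

lemma symbol_tensor_operator: "symbol x y (tensor_operator n T $ i $ j) = tensor_symbol n T x y i j"
proof -
  have "symbol x y (prod_list (map partial \<alpha>)) = list_monom x y \<alpha>" for \<alpha>
  proof (induction \<alpha>)
    case (Cons a \<alpha>)
    have "symbol x y (partial a) = (if a = 1 then x else y)"
      by (simp add: symbol_def partial_def)
    then show ?case using Cons by simp
  qed simp
  then show ?thesis
    by (simp add: tensor_operator_def tensor_symbol_def symbol_sum)
qed

lemma diffop_monom: "diffop_const c * partial 1 ^ a * partial 2 ^ b = monom (monom c a) b"
proof -
  have "partial 1 = monom (monom 1 1) 0" "partial 2 = monom 1 1" "diffop_const c = monom (monom c 0) 0"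
    by (simp_all add: partial_def diffop_const_def monom_altdef)
  then show ?thesis by (simp add: monom_power mult_monom)
qed

lemma homogeneous_eq_sum:
  assumes "homogeneous n p"
  shows "p = (\<Sum>k\<le>n. diffop_const (coeff (coeff p k) (n - k)) * partial 1 ^ (n - k) * partial 2 ^ k)"
proof (rule poly_eqI, rule poly_eqI)
  fix b a
  have "coeff (coeff p b) a = (if b \<le> n \<and> a = n - b then coeff (coeff p b) (n - b) else 0)"
    using assms by (auto simp: homogeneous_def)
  also have "\<dots> = (\<Sum>k\<le>n. if k = b then (if n - k = a then coeff (coeff p k) (n - k) else 0) else 0)"
    by auto
  also have "\<dots> = coeff (coeff (\<Sum>k\<le>n. diffop_const (coeff (coeff p k) (n - k)) * partial 1 ^ (n
    - k) * partial 2 ^ k) b) a"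
    unfolding diffop_monom by (simp add: coeff_sum if_distrib[where f = "\<lambda>p. coeff p a"] cong: if_cong)
  finally show "coeff (coeff p b) a =
    coeff (coeff (\<Sum>k\<le>n. diffop_const (coeff (coeff p k) (n - k)) * partial 1 ^ (n - k) * partial 2 ^ k) b) a" .
qed

text \<open>The coefficient of the monomial with k factors \<partial>_2 is shared equally among the
  n choose k index lists that produce it; uniqueness follows from polarization.\<close>

lemma tensor_of_homogeneous:
  assumes hom: "\<And>i j. homogeneous n (P $ i $ j)"
  shows "\<exists>!T. is_tensor n T \<and> symmetric_tensor T \<and> tensor_operator n T = P"
proof (rule ex_ex1I)
  define T where "T i \<alpha> j = (if length \<alpha> = n then
     coeff (coeff (P $ i $ j) (twos \<alpha>)) (n - twos \<alpha>) / real (n choose twos \<alpha>) else 0)" for i \<alpha> j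
  have "tensor_operator n T $ i $ j = P $ i $ j" for i j
  proof -
    have partial: "prod_list (map partial \<alpha>) = list_monom (partial 1) (partial 2) \<alpha>" for \<alpha>
    proof (induction \<alpha>)
      case (Cons a \<alpha>)
      then show ?case using exhaust_2[of a] by auto
    qed simp
    have "tensor_operator n T $ i $ j =
      (\<Sum>\<alpha> | length \<alpha> = n. diffop_const (coeff (coeff (P $ i $ j) (twos \<alpha>)) (n
        - twos \<alpha>) / real (n choose twos \<alpha>)) *
         list_monom (partial 1) (partial 2) \<alpha>)"
      by (simp add: tensor_operator_def T_def partial)
    also have "\<dots> = (\<Sum>k\<le>n. of_nat (n choose k) * diffop_const (coeff (coeff (P $ i $ j) k) (n
      - k) / real (n choose k)) *
        partial 1 ^ (n - k) * partial 2 ^ k)"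
      by (rule sum_lists_twos)
    also have "\<dots> = (\<Sum>k\<le>n. diffop_const (coeff (coeff (P $ i $ j) k) (n - k)) * partial 1 ^ (n
      - k) * partial 2 ^ k)"
    proof (intro sum.cong refl)
      fix k assume "k \<in> {..n}"
      have of_nat: "of_nat m = diffop_const (real m)" for m
        by (induction m) (simp_all add: diffop_const_add)
      show "of_nat (n choose k) * diffop_const (coeff (coeff (P $ i $ j) k) (n - k) / real (n choose k)) *
          partial 1 ^ (n - k) * partial 2 ^ k =
        diffop_const (coeff (coeff (P $ i $ j) k) (n - k)) * partial 1 ^ (n - k) * partial 2 ^ k"
        using \<open>k \<in> {..n}\<close> by (simp add: of_nat flip: diffop_const_mult)
    qed
    also have "\<dots> = P $ i $ j"
      using homogeneous_eq_sum[OF hom] by simp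
    finally show ?thesis .
  qed
  moreover have "symmetric_tensor T"
    unfolding symmetric_tensor_def
  proof (intro allI impI)
    fix i j and \<alpha> \<beta> :: "2 list" assume m: "mset \<alpha> = mset \<beta>"
    have "size (filter_mset (\<lambda>a. a \<noteq> 1) (mset \<alpha>)) = twos \<alpha>" for \<alpha> :: "2 list"
      by (metis mset_filter size_mset)
    then have "twos \<alpha> = twos \<beta>" using m by metis
    then show "T i \<alpha> j = T i \<beta> j"
      using mset_eq_length[OF m] by (simp add: T_def)
  qed
  ultimately show "\<exists>T. is_tensor n T \<and> symmetric_tensor T \<and> tensor_operator n T = P"
    by (intro exI[of _ T]) (auto simp: vec_eq_iff is_tensor_def T_def)
next
  fix T T'
  assume "is_tensor n T \<and> symmetric_tensor T \<and> tensor_operator n T = P"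
    and "is_tensor n T' \<and> symmetric_tensor T' \<and> tensor_operator n T' = P"
  then show "T = T'"
    by (intro tensor_symbol_eqD) (auto simp flip: symbol_tensor_operator)
qed

lemma equivalent_tensor:
  assumes "lam \<noteq> 0" and "\<And>k. s k \<noteq> 0" and "n > 0"
  shows "is_tensor n (equivalent_tensor lam e s n)" "symmetric_tensor (equivalent_tensor lam e s n)"
    and "tensor_symbol n (equivalent_tensor lam e s n) x y i j =
      symbol x y (fps_nth (equivalent_operator lam e s $ i $ j) (n - 1))"
proof -
  let ?P = "map_matrix (\<lambda>f. fps_nth f (n - 1)) (equivalent_operator lam e s)"
  have "homogeneous (Suc (n - 1)) (fps_nth (equivalent_operator lam e s $ i $ j) (n - 1))" for i j
    by (rule equivalent_operator[where lam = lam and s = s and e = e, OF assms(1,2)])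
  then have "homogeneous n (?P $ i $ j)" for i j
    using \<open>n > 0\<close> by (simp add: map_matrix_def)
  from theI'[OF tensor_of_homogeneous[OF this], folded equivalent_tensor_def]
  show "is_tensor n (equivalent_tensor lam e s n)" "symmetric_tensor (equivalent_tensor lam e s n)"
    and "tensor_symbol n (equivalent_tensor lam e s n) x y i j =
      symbol x y (fps_nth (equivalent_operator lam e s $ i $ j) (n - 1))"
    by (auto simp: map_matrix_def simp flip: symbol_tensor_operator)
qed

lemma is_tensor_rotation: "is_tensor n (tensor_rotation n r T)"
  by (simp add: is_tensor_def tensor_rotation_def)

text \<open>A permutation relating \<open>\<alpha>\<close> to \<open>\<alpha>'\<close> is applied to
  the summation index \<open>\<beta>\<close> as well. The product of rotation entries is then only
  reordered, and the tensor entry is unchanged by symmetry.\<close>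

lemma symmetric_tensor_rotation:
  assumes "symmetric_tensor T"
  shows "symmetric_tensor (tensor_rotation n r T)"
  unfolding symmetric_tensor_def
proof (intro allI impI)
  fix i j and \<alpha> \<alpha>' :: "2 list" assume m: "mset \<alpha> = mset \<alpha>'"
  show "tensor_rotation n r T i \<alpha> j = tensor_rotation n r T i \<alpha>' j"
  proof (cases "length \<alpha> = n")
    case True
    then have len: "length \<alpha>' = n" using m by (metis size_mset)
    obtain p where p: "p permutes {..<n}" and \<alpha>: "permute_list p \<alpha>' = \<alpha>"
      using mset_eq_permutation[OF m] len by metis
    have inv: "inv p permutes {..<n}" using p by (rule permutes_inv)
    have "(\<Sum>\<beta> | length \<beta> = n. \<Sum>k\<in>UNIV. \<Sum>l\<in>UNIV. conserved_rotation r $ i $ l * T l \<beta> k *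
        (\<Prod>m<n. r $ (\<alpha> ! m) $ (\<beta> ! m)) * matrix_inv (conserved_rotation r) $ k $ j) =
      (\<Sum>\<beta> | length \<beta> = n. \<Sum>k\<in>UNIV. \<Sum>l\<in>UNIV. conserved_rotation r $ i $ l * T l \<beta> k *
        (\<Prod>m<n. r $ (\<alpha>' ! m) $ (\<beta> ! m)) * matrix_inv (conserved_rotation r) $ k $ j)"
    proof (rule sum.reindex_bij_witness[where i = "permute_list p" and j = "permute_list (inv p)"])
      fix \<beta> :: "2 list" assume "\<beta> \<in> {\<beta>. length \<beta> = n}"
      then have lb: "length \<beta> = n" by simp
      show "permute_list p (permute_list (inv p) \<beta>) = \<beta>"
        using permute_list_compose[of p \<beta> "inv p"] p lb by (simp add: permutes_inv_o)
      show "permute_list (inv p) (permute_list p \<beta>) = \<beta>"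
        using permute_list_compose[of "inv p" \<beta> p] inv lb p by (simp add: permutes_inv_o)
      have T: "T l (permute_list (inv p) \<beta>) k = T l \<beta> k" for l k
        using assms inv lb unfolding symmetric_tensor_def by (metis mset_permute_list)
      have "(\<Prod>m<n. r $ (\<alpha>' ! m) $ (permute_list (inv p) \<beta> ! m)) =
          (\<Prod>m<n. r $ (\<alpha>' ! p m) $ (permute_list (inv p) \<beta> ! p m))"
        by (rule prod.permute[OF p, unfolded comp_def])
      also have "\<dots> = (\<Prod>m<n. r $ (\<alpha> ! m) $ (\<beta> ! m))"
      proof (intro prod.cong refl)
        fix m assume "m \<in> {..<n}"
        then have "p m < n" using p by (metis lessThan_iff permutes_in_image)
        then show "r $ (\<alpha>' ! p m) $ (permute_list (inv p) \<beta> ! p m) = r $ (\<alpha> ! m) $ (\<beta> ! m)"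
          using \<open>m \<in> {..<n}\<close> p inv lb len \<alpha>[symmetric]
          by (simp add: permute_list_nth permutes_inverses)
      qed
      finally show "(\<Sum>k\<in>UNIV. \<Sum>l\<in>UNIV. conserved_rotation r $ i $ l * T l (permute_list (inv p) \<beta>) k *
        (\<Prod>m<n. r $ (\<alpha>' ! m) $ (permute_list (inv p) \<beta> ! m)) * matrix_inv (conserved_rotation r) $ k $ j) =
        (\<Sum>k\<in>UNIV. \<Sum>l\<in>UNIV. conserved_rotation r $ i $ l * T l \<beta> k *
        (\<Prod>m<n. r $ (\<alpha> ! m) $ (\<beta> ! m)) * matrix_inv (conserved_rotation r) $ k $ j)"
        by (simp add: T)
    qed auto
    then show ?thesis using True len by (simp add: tensor_rotation_def)
  next
    case False
    then show ?thesis using m by (metis tensor_rotation_def mset_eq_length)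
  qed
qed

text \<open>Summing over \<open>\<alpha>\<close> first replaces each factor of the monomial by a
  linear form, so the spatial indices of the rotation amount to evaluation at r^T \<xi>: the symbol
  becomes R(r) A(r^T \<xi>) R(r)^-1.\<close>

lemma tensor_symbol_rotation:
  "tensor_symbol n (tensor_rotation n r T) x y i j =
     (\<Sum>k\<in>UNIV. \<Sum>l\<in>UNIV. conserved_rotation r $ i $ l *
        tensor_symbol n T (r $ 1 $ 1 * x + r $ 2 $ 1 * y) (r $ 1 $ 2 * x + r $ 2 $ 2 * y) l k *
        matrix_inv (conserved_rotation r) $ k $ j)"
proof -
  define x' y' where "x' = r $ 1 $ 1 * x + r $ 2 $ 1 * y" and "y' = r $ 1 $ 2 * x + r $ 2 $ 2 * y"
  have inner: "(\<Sum>\<alpha> | length \<alpha> = length \<beta>. (\<Prod>m<length \<beta>. r $ (\<alpha> ! m) $ (\<beta> ! m)) * list_monom x y \<alpha>)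
    = list_monom x' y' \<beta>"
    for \<beta>
  proof (induction \<beta>)
    case (Cons b \<beta>)
    have "(\<Sum>\<alpha> | length \<alpha> = length (b # \<beta>). (\<Prod>m<length (b # \<beta>). r $ (\<alpha> ! m) $ ((b # \<beta>) ! m)) * list_monom x y \<alpha>) =
      (r $ 1 $ b * x + r $ 2 $ b * y) *
      (\<Sum>\<alpha> | length \<alpha> = length \<beta>. (\<Prod>m<length \<beta>. r $ (\<alpha> ! m) $ (\<beta> ! m)) * list_monom x y \<alpha>)"
      by (simp add: sum_lists_Suc prod.lessThan_Suc_shift sum_distrib_left sum.distrib algebra_simps del:
        prod.lessThan_Suc)
    then show ?case using Cons.IH exhaust_2[of b] by (auto simp: x'_def y'_def)
  qed simp
  have "tensor_symbol n (tensor_rotation n r T) x y i j =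
    (\<Sum>\<alpha> | length \<alpha> = n. \<Sum>\<beta> | length \<beta> = n. \<Sum>k\<in>UNIV. \<Sum>l\<in>UNIV. conserved_rotation r $ i $ l * T l \<beta> k *
        matrix_inv (conserved_rotation r) $ k $ j * ((\<Prod>m<n. r $ (\<alpha> ! m) $ (\<beta> ! m)) * list_monom x y \<alpha>))"
    by (simp add: tensor_symbol_def tensor_rotation_def sum_distrib_left mult_ac)
  also have "\<dots> = (\<Sum>\<beta> | length \<beta> = n. \<Sum>\<alpha> | length \<alpha> = n. \<Sum>k\<in>UNIV. \<Sum>l\<in>UNIV. conserved_rotation r $ i $ l * T l \<beta> k *
        matrix_inv (conserved_rotation r) $ k $ j * ((\<Prod>m<n. r $ (\<alpha> ! m) $ (\<beta> ! m)) * list_monom x y \<alpha>))"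
    by (rule sum.swap)
  also have "\<dots> = (\<Sum>\<beta> | length \<beta> = n. \<Sum>k\<in>UNIV. \<Sum>l\<in>UNIV. \<Sum>\<alpha> | length \<alpha> = n. conserved_rotation r $ i $ l * T l \<beta> k *
        matrix_inv (conserved_rotation r) $ k $ j * ((\<Prod>m<n. r $ (\<alpha> ! m) $ (\<beta> ! m)) * list_monom x y \<alpha>))"
    by (intro sum.cong refl) (subst sum.swap, intro sum.cong refl sum.swap)
  also have "\<dots> = (\<Sum>\<beta> | length \<beta> = n. \<Sum>k\<in>UNIV. \<Sum>l\<in>UNIV. conserved_rotation r $ i $ l * T l \<beta> k *
        matrix_inv (conserved_rotation r) $ k $ j * list_monom x' y' \<beta>)"
    unfolding sum_distrib_left[symmetric] by (intro sum.cong refl) (use inner in auto)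
  also have "\<dots> = (\<Sum>k\<in>UNIV. \<Sum>l\<in>UNIV. \<Sum>\<beta> | length \<beta> = n. conserved_rotation r $ i $ l * T l \<beta> k *
        matrix_inv (conserved_rotation r) $ k $ j * list_monom x' y' \<beta>)"
    by (subst sum.swap, intro sum.cong refl sum.swap)
  finally show ?thesis
    unfolding x'_def[symmetric] y'_def[symmetric]
    by (simp add: tensor_symbol_def sum_distrib_left sum_distrib_right mult_ac)
qed

text \<open>\<open>A (r \<xi>) = R(r) A(\<xi>) R(r)\<^sup>-\<^sup>1\<close> for the rotation \<open>r\<close> with rows \<open>(c, -s)\<close> and \<open>(s, c)\<close>.\<close>

definition isotropic_symbol :: "(real \<Rightarrow> real \<Rightarrow> conserved \<Rightarrow> conserved \<Rightarrow> real) \<Rightarrow> bool" where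
  "isotropic_symbol A \<longleftrightarrow> (\<forall>c s x y. c\<^sup>2 + s\<^sup>2 = 1 \<longrightarrow>
     (let B = A (c * x - s * y) (s * x + c * y); A = A x y in
       B Rho Rho = A Rho Rho \<and>
       B Rho Qx = c * A Rho Qx - s * A Rho Qy \<and>
       B Rho Qy = s * A Rho Qx + c * A Rho Qy \<and>
       B Qx Rho = c * A Qx Rho - s * A Qy Rho \<and>
       B Qy Rho = s * A Qx Rho + c * A Qy Rho \<and>
       B Qx Qx = c * (c * A Qx Qx - s * A Qy Qx) - s * (c * A Qx Qy - s * A Qy Qy) \<and>
       B Qx Qy = s * (c * A Qx Qx - s * A Qy Qx) + c * (c * A Qx Qy - s * A Qy Qy) \<and>
       B Qy Qx = c * (s * A Qx Qx + c * A Qy Qx) - s * (s * A Qx Qy + c * A Qy Qy) \<and>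
       B Qy Qy = s * (s * A Qx Qx + c * A Qy Qx) + c * (s * A Qx Qy + c * A Qy Qy)))"

section \<open>Rotations by parameters (c, s) and isotropy of tensors in terms of symbols\<close>

lemma rotation_matrix_2:
  fixes r :: "real^2^2"
  assumes "rotation_matrix r"
  obtains c s where "r $ 1 $ 1 = c" "r $ 1 $ 2 = - s" "r $ 2 $ 1 = s" "r $ 2 $ 2 = c" "c\<^sup>2 + s\<^sup>2 = 1"
proof -
  have o: "transpose r ** r = mat 1" and d: "det r = 1"
    using assms by (simp_all add: rotation_matrix_def orthogonal_matrix)
  have 1: "(transpose r ** r) $ 1 $ 1 = 1" "(transpose r ** r) $ 1 $ 2 = 0" "(transpose r ** r) $ 2 $ 2 = 1"
    unfolding o by (simp_all add: mat_def)
  have a: "r $ 1 $ 1 * r $ 1 $ 1 + r $ 2 $ 1 * r $ 2 $ 1 = 1"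
    and b: "r $ 1 $ 1 * r $ 1 $ 2 + r $ 2 $ 1 * r $ 2 $ 2 = 0"
    and e: "r $ 1 $ 1 * r $ 2 $ 2 - r $ 1 $ 2 * r $ 2 $ 1 = 1"
    using 1 d by (simp_all add: matrix_matrix_mult_def transpose_def sum_2 det_2)
  have "r $ 2 $ 2 = r $ 1 $ 1" "r $ 1 $ 2 = - r $ 2 $ 1"
    using a b e by algebra+
  then show ?thesis using that[of "r $ 1 $ 1" "r $ 2 $ 1"] a by (simp add: power2_eq_square)
qed

lemma rotation_matrixI:
  assumes "c\<^sup>2 + s\<^sup>2 = (1::real)"
  defines "r \<equiv> \<chi> i j. if i = 1 then (if j = 1 then c else - s) else (if j = 1 then s else c) :: real^2^2"
  shows "rotation_matrix r"
  using assms(1)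
  by (simp add: r_def rotation_matrix_def orthogonal_matrix det_2 matrix_matrix_mult_def transpose_def
      sum_2 mat_def vec_eq_iff forall_2 power2_eq_square algebra_simps)

lemma matrix_inv_conserved_rotation:
  assumes "rotation_matrix r"
  shows "matrix_inv (conserved_rotation r) = transpose (conserved_rotation r)"
proof (rule matrix_inv_eqI)
  obtain c s where r: "r $ 1 $ 1 = c" "r $ 1 $ 2 = - s" "r $ 2 $ 1 = s" "r $ 2 $ 2 = c" "c\<^sup>2 + s\<^sup>2 = 1"
    using rotation_matrix_2[OF assms] .
  have all: "(\<forall>i. P i) \<longleftrightarrow> P Rho \<and> P Qx \<and> P Qy" for P
    by (metis conserved.exhaust)
  show "conserved_rotation r ** transpose (conserved_rotation r) = mat 1"
    "transpose (conserved_rotation r) ** conserved_rotation r = mat 1"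
    using r(5) by (simp_all add: vec_eq_iff all matrix_matrix_mult_def transpose_def sum_conserved
        conserved_rotation_def r mat_def power2_eq_square algebra_simps)
qed

text \<open>Invariance says R A(r^T \<xi>) R^-1 = A(\<xi>). The substitution \<xi> = r \<eta>,
  surjective as r is invertible, moves the rotated argument to the other side and gives the form
  used in \<open>isotropic_symbol\<close>.\<close>

lemma tensor_rotation_eq_iff:
  assumes T: "is_tensor n T" "symmetric_tensor T"
  shows "(\<forall>r. rotation_matrix r \<longrightarrow> tensor_rotation n r T = T) \<longleftrightarrow> isotropic_symbol (tensor_symbol n T)"
    (is "?L \<longleftrightarrow> ?R")
proof -
  have all: "(\<forall>i. P i) \<longleftrightarrow> P Rho \<and> P Qx \<and> P Qy" for P
    by (metis conserved.exhaust)
  define Q where "Q c s x y \<longleftrightarrow> (let B = tensor_symbol n T (c * x - s * y) (s * x + c * y); A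
    = tensor_symbol n T x y in
       B Rho Rho = A Rho Rho \<and>
       B Rho Qx = c * A Rho Qx - s * A Rho Qy \<and>
       B Rho Qy = s * A Rho Qx + c * A Rho Qy \<and>
       B Qx Rho = c * A Qx Rho - s * A Qy Rho \<and>
       B Qy Rho = s * A Qx Rho + c * A Qy Rho \<and>
       B Qx Qx = c * (c * A Qx Qx - s * A Qy Qx) - s * (c * A Qx Qy - s * A Qy Qy) \<and>
       B Qx Qy = s * (c * A Qx Qx - s * A Qy Qx) + c * (c * A Qx Qy - s * A Qy Qy) \<and>
       B Qy Qx = c * (s * A Qx Qx + c * A Qy Qx) - s * (s * A Qx Qy + c * A Qy Qy) \<and>
       B Qy Qy = s * (s * A Qx Qx + c * A Qy Qx) + c * (s * A Qx Qy + c * A Qy Qy))" for c s x y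
  have iff: "tensor_rotation n r T = T \<longleftrightarrow> (\<forall>x y. Q c s x y)"
    if r: "rotation_matrix r" "r $ 1 $ 1 = c" "r $ 1 $ 2 = - s" "r $ 2 $ 1 = s" "r $ 2 $ 2 = c" "c\<^sup>2 + s\<^sup>2 = 1"
    for r c s
  proof -
    have Q: "(\<forall>i j. tensor_symbol n (tensor_rotation n r T) (c * x - s * y) (s * x + c * y) i j =
        tensor_symbol n T (c * x - s * y) (s * x + c * y) i j) \<longleftrightarrow> Q c s x y" for x y
    proof -
      \<comment> \<open>This is r^T (r \<xi>) = \<xi>, so the inner symbol is evaluated at the
        original point.\<close>
      have *: "c * (c * x - s * y) + s * (s * x + c * y) = x" "- s * (c * x - s * y) + c * (s * x + c * y) = y"
        using r(6) by algebra+
      show ?thesis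
        unfolding tensor_symbol_rotation matrix_inv_conserved_rotation[OF r(1)] r * Q_def
        by (simp add: all sum_conserved conserved_rotation_def transpose_def r Let_def algebra_simps)
          (auto simp: algebra_simps)
    qed
    have surj: "\<exists>u v. x = c * u - s * v \<and> y = s * u + c * v" for x y
      by (intro exI[of _ "c * x + s * y"] exI[of _ "- s * x + c * y"] conjI) (use r(6) in algebra)+
    have "tensor_rotation n r T = T \<longleftrightarrow>
        (\<forall>x y i j. tensor_symbol n (tensor_rotation n r T) x y i j = tensor_symbol n T x y i j)"
      using tensor_symbol_eqD[OF is_tensor_rotation symmetric_tensor_rotation[OF T(2)] T, of r] by metis
    also have "\<dots> \<longleftrightarrow> (\<forall>x y i j. tensor_symbol n (tensor_rotation n r T) (c * x - s * y) (s * x + c * y) i j =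
        tensor_symbol n T (c * x - s * y) (s * x + c * y) i j)"
      using surj by metis
    finally show ?thesis unfolding Q .
  qed
  have R: "?R \<longleftrightarrow> (\<forall>c s x y. c\<^sup>2 + s\<^sup>2 = 1 \<longrightarrow> Q c s x y)"
    by (simp add: isotropic_symbol_def Q_def)
  show ?thesis
    unfolding R
  proof safe
    fix c s x y :: real assume L: ?L and 1: "c\<^sup>2 + s\<^sup>2 = 1"
    let ?r = "\<chi> i j. if i = 1 then (if j = 1 then c else - s) else (if j = 1 then s else c) :: real^2^2"
    have "tensor_rotation n ?r T = T" using L rotation_matrixI[OF 1] by blast
    then show "Q c s x y"
      by (subst (asm) iff[OF rotation_matrixI[OF 1], of c s]) (simp_all add: 1)
  next
    fix r :: "real^2^2" assume Q: "\<forall>c s x y. c\<^sup>2 + s\<^sup>2 = 1 \<longrightarrow> Q c s x y" and r: "rotation_matrix r"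
    show "tensor_rotation n r T = T"
      using rotation_matrix_2[OF r] iff[OF r] Q by metis
  qed
qed

definition scaled_symbol ::
  "real \<Rightarrow> (nonconserved \<Rightarrow> conserved \<Rightarrow> real) \<Rightarrow> (nonconserved \<Rightarrow> real) \<Rightarrow> real \<Rightarrow> real \<Rightarrow>
   nat \<Rightarrow> conserved \<Rightarrow> conserved \<Rightarrow> real" where
  "scaled_symbol lam E s x y n i j = lam ^ conserved_degree j / lam ^ conserved_degree i *
     symbol (x / lam) (y / lam) (fps_nth (equivalent_operator lam E s $ i $ j) n)"

text \<open>The weights conjugate by diag(1, \<lambda>, \<lambda>), which commutes with R(r) because
  both momenta have the same degree; the dilation of (x, y) commutes with r.\<close>

lemma isotropic_symbol_scale:
  assumes "lam \<noteq> 0"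
  shows "isotropic_symbol (\<lambda>x y i j. lam ^ conserved_degree j / lam ^ conserved_degree i * A (x / lam) (y
    / lam) i j)
    \<longleftrightarrow> isotropic_symbol A"
proof -
  have "lam * B = c * (lam * B1) + d * (lam * B2) \<longleftrightarrow> lam * B = lam * (c * B1 + d * B2)"
    "lam * B = c * (lam * B1) - d * (lam * B2) \<longleftrightarrow> lam * B = lam * (c * B1 - d * B2)" for B B1 B2 c d
    by (simp_all add: algebra_simps)
  then have [simp]: "lam * B = c * (lam * B1) + d * (lam * B2) \<longleftrightarrow> B = c * B1 + d * B2"
    "lam * B = c * (lam * B1) - d * (lam * B2) \<longleftrightarrow> B = c * B1 - d * B2" for B B1 B2 c d
    using assms by (simp_all only: mult_cancel_left simp_thms)
  have [simp]: "B / lam = c * B1 / lam + d * B2 / lam \<longleftrightarrow> B = c * B1 + d * B2"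
    "B / lam = c * B1 / lam - d * B2 / lam \<longleftrightarrow> B = c * B1 - d * B2" for B B1 B2 c d
    using assms by (simp_all add: field_simps)
  have eq: "(c * x - s * y) / lam = c * (x / lam) - s * (y / lam)"
    "(s * x + c * y) / lam = s * (x / lam) + c * (y / lam)" for c s x y
    by (simp_all add: diff_divide_distrib add_divide_distrib)
  have all2: "(\<forall>x y. P (x / lam) (y / lam)) \<longleftrightarrow> (\<forall>x y. P x y)" for P
    using assms by (metis nonzero_mult_div_cancel_left)
  define Q where "Q c s x y \<longleftrightarrow>
     (let B = A (c * x - s * y) (s * x + c * y); A = A x y in
       B Rho Rho = A Rho Rho \<and>
       B Rho Qx = c * A Rho Qx - s * A Rho Qy \<and>
       B Rho Qy = s * A Rho Qx + c * A Rho Qy \<and>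
       B Qx Rho = c * A Qx Rho - s * A Qy Rho \<and>
       B Qy Rho = s * A Qx Rho + c * A Qy Rho \<and>
       B Qx Qx = c * (c * A Qx Qx - s * A Qy Qx) - s * (c * A Qx Qy - s * A Qy Qy) \<and>
       B Qx Qy = s * (c * A Qx Qx - s * A Qy Qx) + c * (c * A Qx Qy - s * A Qy Qy) \<and>
       B Qy Qx = c * (s * A Qx Qx + c * A Qy Qx) - s * (s * A Qx Qy + c * A Qy Qy) \<and>
       B Qy Qy = s * (s * A Qx Qx + c * A Qy Qx) + c * (s * A Qx Qy + c * A Qy Qy))" for c s x y
  have "isotropic_symbol (\<lambda>x y i j. lam ^ conserved_degree j / lam ^ conserved_degree i * A (x / lam) (y /
    lam) i j)
    \<longleftrightarrow> (\<forall>c s x y. c\<^sup>2 + s\<^sup>2 = 1 \<longrightarrow> Q c s (x / lam) (y / lam))"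
    unfolding isotropic_symbol_def Q_def eq using assms by (simp add: Let_def)
  also have "\<dots> \<longleftrightarrow> isotropic_symbol A"
    unfolding all2[of "\<lambda>x y. _ \<longrightarrow> Q _ _ x y"] by (simp add: isotropic_symbol_def Q_def)
  finally show ?thesis .
qed

text \<open>The index is shifted: \<open>scaled_symbol\<close> at n belongs to A_(n+1), since
  A_(n+1) is multiplied by \<Delta>t^n in \<A>.\<close>

lemma isotropic_at_order_iff:
  assumes "lam \<noteq> 0" and "\<And>k. s k \<noteq> 0"
  shows "isotropic_at_order lam E s m \<longleftrightarrow>
    (\<forall>n<m. isotropic_symbol (\<lambda>x y. scaled_symbol lam E s x y n))"
proof -
  have "isotropic_at_order lam E s m \<longleftrightarrow> (\<forall>n\<in>{1..m}. \<forall>r. rotation_matrix r \<longrightarrow>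
      tensor_rotation n r (equivalent_tensor lam E s n) = equivalent_tensor lam E s n)"
    unfolding isotropic_at_order_def by blast
  also have "\<dots> \<longleftrightarrow> (\<forall>n\<in>{1..m}. isotropic_symbol (\<lambda>x y. scaled_symbol lam E s x y (n - 1)))"
  proof (intro ball_cong refl)
    fix n assume n: "n \<in> {1..m}"
    then have "n > 0" by simp
    note t = equivalent_tensor[where lam = lam and s = s and e = E, OF assms this]
    have "(\<forall>r. rotation_matrix r \<longrightarrow>
      tensor_rotation n r (equivalent_tensor lam E s n) = equivalent_tensor lam E s n) \<longleftrightarrow>
      isotropic_symbol (tensor_symbol n (equivalent_tensor lam E s n))"
      by (rule tensor_rotation_eq_iff[OF t(1,2)])
    also have "tensor_symbol n (equivalent_tensor lam E s n) =
       (\<lambda>x y i j. symbol x y (fps_nth (equivalent_operator lam E s $ i $ j) (n - 1)))"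
      by (intro ext t(3))
    also have "isotropic_symbol \<dots> \<longleftrightarrow> isotropic_symbol (\<lambda>x y. scaled_symbol lam E s x y (n - 1))"
      unfolding scaled_symbol_def by (rule isotropic_symbol_scale[OF assms(1), symmetric])
    finally show "(\<forall>r. rotation_matrix r \<longrightarrow>
      tensor_rotation n r (equivalent_tensor lam E s n) = equivalent_tensor lam E s n) \<longleftrightarrow>
      isotropic_symbol (\<lambda>x y. scaled_symbol lam E s x y (n - 1))" .
  qed
  also have "\<dots> \<longleftrightarrow> (\<forall>n<m. isotropic_symbol (\<lambda>x y. scaled_symbol lam E s x y n))"
    unfolding image_Suc_lessThan[symmetric] by auto
  finally show ?thesis .
qed

lemma scaled_symbol_expansion:
  assumes "lam \<noteq> 0" and "\<And>k. s k \<noteq> 0"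
  obtains V D where "moment_expansion x y E (relax_sigma s) (scaled_symbol lam E s x y) V D"
proof -
  obtain \<Psi> where "is_equivalent_pair lam E s \<Psi> (equivalent_operator lam E s)"
    by (rule equivalent_operator[where lam = lam and s = s and e = E, OF assms])
  from moment_expansion_of_scheme[where lam = lam and s = s, OF assms this, of x y] show ?thesis
    using that unfolding scaled_symbol_def by blast
qed

section \<open>Matrices given by their entries\<close>

fun conserved_index :: "conserved \<Rightarrow> nat" where
  "conserved_index Rho = 0"
| "conserved_index Qx = 1"
| "conserved_index Qy = 2"

fun nonconserved_index :: "nonconserved \<Rightarrow> nat" where
  "nonconserved_index Epsi = 0"
| "nonconserved_index Epsi2 = 1"
| "nonconserved_index PhiX = 2"
| "nonconserved_index PhiY = 3"
| "nonconserved_index PhiXX = 4"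
| "nonconserved_index PhiXY = 5"

text \<open>With literal lists of rows an entry is selected by rewriting with
  \<open>table_simps\<close> alone, so only the entries that occur in a formula are
  expanded.\<close>

definition conserved_table :: "real list list \<Rightarrow> conserved \<Rightarrow> conserved \<Rightarrow> real" where
  "conserved_table t i j = t ! conserved_index i ! conserved_index j"

definition nonconserved_table :: "real list list \<Rightarrow> nonconserved \<Rightarrow> conserved \<Rightarrow> real" where
  "nonconserved_table t k j = t ! nonconserved_index k ! conserved_index j"

definition nonconserved_list :: "real list \<Rightarrow> nonconserved \<Rightarrow> real" where
  "nonconserved_list t k = t ! nonconserved_index k"

definition moment_table :: "real list list \<Rightarrow> real list list \<Rightarrow> moment \<Rightarrow> conserved \<Rightarrow> real" where
  "moment_table t u i j = (case i of Inl i \<Rightarrow> conserved_table t i j | Inr k \<Rightarrow> nonconserved_table u k j)"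

abbreviation conserved_zero :: "real list list" where
  "conserved_zero \<equiv> [[0, 0, 0], [0, 0, 0], [0, 0, 0]]"

abbreviation conserved_one :: "real list list" where
  "conserved_one \<equiv> [[1, 0, 0], [0, 1, 0], [0, 0, 1]]"

lemma moment_table_simps:
  "moment_table t u (Inl i) j = conserved_table t i j"
  "moment_table t u (Inr k) j = nonconserved_table u k j"
  by (simp_all add: moment_table_def)

lemma conserved_table_simps:
  "conserved_table [[a00, a01, a02], r1, r2] Rho Rho = a00"
  "conserved_table [[a00, a01, a02], r1, r2] Rho Qx = a01"
  "conserved_table [[a00, a01, a02], r1, r2] Rho Qy = a02"
  "conserved_table [r0, [a10, a11, a12], r2] Qx Rho = a10"
  "conserved_table [r0, [a10, a11, a12], r2] Qx Qx = a11"
  "conserved_table [r0, [a10, a11, a12], r2] Qx Qy = a12"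
  "conserved_table [r0, r1, [a20, a21, a22]] Qy Rho = a20"
  "conserved_table [r0, r1, [a20, a21, a22]] Qy Qx = a21"
  "conserved_table [r0, r1, [a20, a21, a22]] Qy Qy = a22"
  by (simp_all add: conserved_table_def)

lemma nonconserved_row_simps:
  "nonconserved_table [[a, b, c], r1, r2, r3, r4, r5] Epsi Rho = a"
  "nonconserved_table [[a, b, c], r1, r2, r3, r4, r5] Epsi Qx = b"
  "nonconserved_table [[a, b, c], r1, r2, r3, r4, r5] Epsi Qy = c"
  "nonconserved_table [r0, [a, b, c], r2, r3, r4, r5] Epsi2 Rho = a"
  "nonconserved_table [r0, [a, b, c], r2, r3, r4, r5] Epsi2 Qx = b"
  "nonconserved_table [r0, [a, b, c], r2, r3, r4, r5] Epsi2 Qy = c"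
  "nonconserved_table [r0, r1, [a, b, c], r3, r4, r5] PhiX Rho = a"
  "nonconserved_table [r0, r1, [a, b, c], r3, r4, r5] PhiX Qx = b"
  "nonconserved_table [r0, r1, [a, b, c], r3, r4, r5] PhiX Qy = c"
  "nonconserved_table [r0, r1, r2, [a, b, c], r4, r5] PhiY Rho = a"
  "nonconserved_table [r0, r1, r2, [a, b, c], r4, r5] PhiY Qx = b"
  "nonconserved_table [r0, r1, r2, [a, b, c], r4, r5] PhiY Qy = c"
  "nonconserved_table [r0, r1, r2, r3, [a, b, c], r5] PhiXX Rho = a"
  "nonconserved_table [r0, r1, r2, r3, [a, b, c], r5] PhiXX Qx = b"
  "nonconserved_table [r0, r1, r2, r3, [a, b, c], r5] PhiXX Qy = c"
  "nonconserved_table [r0, r1, r2, r3, r4, [a, b, c]] PhiXY Rho = a"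
  "nonconserved_table [r0, r1, r2, r3, r4, [a, b, c]] PhiXY Qx = b"
  "nonconserved_table [r0, r1, r2, r3, r4, [a, b, c]] PhiXY Qy = c"
  by (simp_all add: nonconserved_table_def)

lemma nonconserved_list_simps:
  "nonconserved_list [a, b, c, d, e, f] Epsi = a"
  "nonconserved_list [a, b, c, d, e, f] Epsi2 = b"
  "nonconserved_list [a, b, c, d, e, f] PhiX = c"
  "nonconserved_list [a, b, c, d, e, f] PhiY = d"
  "nonconserved_list [a, b, c, d, e, f] PhiXX = e"
  "nonconserved_list [a, b, c, d, e, f] PhiXY = f"
  by (simp_all add: nonconserved_list_def)

lemmas table_simps = moment_table_simps conserved_table_simps nonconserved_row_simps nonconserved_list_simps

lemma conserved_tableI:
  assumes "A Rho Rho = a00" "A Rho Qx = a01" "A Rho Qy = a02"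
    "A Qx Rho = a10" "A Qx Qx = a11" "A Qx Qy = a12"
    "A Qy Rho = a20" "A Qy Qx = a21" "A Qy Qy = a22"
  shows "A = conserved_table [[a00, a01, a02], [a10, a11, a12], [a20, a21, a22]]"
proof (intro ext)
  show "A i j = conserved_table [[a00, a01, a02], [a10, a11, a12], [a20, a21, a22]] i j" for i j
    by (cases i; cases j) (simp_all add: assms table_simps)
qed

lemma nonconserved_tableI:
  assumes "A Epsi Rho = a00" "A Epsi Qx = a01" "A Epsi Qy = a02"
    "A Epsi2 Rho = a10" "A Epsi2 Qx = a11" "A Epsi2 Qy = a12"
    "A PhiX Rho = a20" "A PhiX Qx = a21" "A PhiX Qy = a22"
    "A PhiY Rho = a30" "A PhiY Qx = a31" "A PhiY Qy = a32"
    "A PhiXX Rho = a40" "A PhiXX Qx = a41" "A PhiXX Qy = a42"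
    "A PhiXY Rho = a50" "A PhiXY Qx = a51" "A PhiXY Qy = a52"
  shows "A = nonconserved_table [[a00, a01, a02], [a10, a11, a12], [a20, a21, a22],
    [a30, a31, a32], [a40, a41, a42], [a50, a51, a52]]"
proof (intro ext)
  show "A k j = nonconserved_table [[a00, a01, a02], [a10, a11, a12], [a20, a21, a22],
    [a30, a31, a32], [a40, a41, a42], [a50, a51, a52]] k j" for k j
    by (cases k; cases j) (simp_all add: assms table_simps)
qed

lemma nonconserved_listI:
  "s = nonconserved_list [s Epsi, s Epsi2, s PhiX, s PhiY, s PhiXX, s PhiXY]"
proof
  show "s k = nonconserved_list [s Epsi, s Epsi2, s PhiX, s PhiY, s PhiXX, s PhiXY] k" for k
    by (cases k) (simp_all add: table_simps)
qed

lemma moment_tableI: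
  assumes "(\<lambda>i. X (Inl i)) = conserved_table t" "(\<lambda>k. X (Inr k)) = nonconserved_table u"
  shows "X = moment_table t u"
proof (intro ext)
  show "X i j = moment_table t u i j" for i j
    using assms by (cases i) (simp_all add: table_simps fun_eq_iff)
qed

section \<open>The recursion written out at low orders\<close>

lemma commutator_0:
  "commutator x y a X 0 i j = flux x y (\<lambda>k. X 0 k j) i
     - (X 0 i Rho * a 0 Rho j + X 0 i Qx * a 0 Qx j + X 0 i Qy * a 0 Qy j)"
  by (simp add: commutator_def sum_conserved)

lemma commutator_1:
  "commutator x y a X 1 i j = flux x y (\<lambda>k. X 1 k j) i
     - (X 1 i Rho * a 0 Rho j + X 1 i Qx * a 0 Qx j + X 1 i Qy * a 0 Qy j)
     - (X 0 i Rho * a 1 Rho j + X 0 i Qx * a 1 Qx j + X 0 i Qy * a 1 Qy j)"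
  by (simp add: commutator_def sum_conserved)

lemma commutator_2:
  "commutator x y a X 2 i j = flux x y (\<lambda>k. X 2 k j) i
     - (X 2 i Rho * a 0 Rho j + X 2 i Qx * a 0 Qx j + X 2 i Qy * a 0 Qy j)
     - (X 1 i Rho * a 1 Rho j + X 1 i Qx * a 1 Qx j + X 1 i Qy * a 1 Qy j)
     - (X 0 i Rho * a 2 Rho j + X 0 i Qx * a 2 Qx j + X 0 i Qy * a 2 Qy j)"
proof -
  have "{0..2::nat} = {0, 1, 2}" by auto
  then show ?thesis by (simp add: commutator_def sum_conserved numeral_2_eq_2)
qed

context moment_expansion
begin

definition "K1 = commutator x y a V"
definition "K2 = commutator x y a K1"
definition "K3 = commutator x y a K2"
definition "K4 = commutator x y a K3"
definition "K5 = commutator x y a K4"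

lemmas K1_0 = commutator_0[of x y a V, folded K1_def]
  and K1_1 = commutator_1[of x y a V, folded K1_def]
  and K1_2 = commutator_2[of x y a V, folded K1_def]

lemma D_Suc': "n < 5 \<Longrightarrow> D (Suc n) r j = K1 n r j
    - (if n < 2 then 0 else K3 (n - 2) r j / 12) + (if n < 4 then 0 else K5 (n - 4) r j / 120)"
  unfolding D_Suc K1_def K2_def K3_def K4_def K5_def by (simp add: numeral_3_eq_3 numeral_eq_Suc)

text \<open>The conserved rows of V are the identity at order 0 and nothing else, so in those rows
  the term X \<A> of the commutator reduces to \<open>a n\<close>. As the same rows of D vanish, the
  equation for D can be solved for \<open>a n\<close>. The right side involves only coefficients of
  \<A> of index below n, which makes this a recursion.\<close>

lemma a_eq:
  assumes "n < 5"
  shows "a n i j = flux x y (\<lambda>k. V n k j) (Inl i)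
    - (if n < 2 then 0 else K3 (n - 2) (Inl i) j / 12) + (if n < 4 then 0 else K5 (n - 4) (Inl i) j / 120)"
proof -
  have "(\<Sum>l\<in>UNIV. \<Sum>p=0..n. V p (Inl i) l * a (n - p) l j) = (\<Sum>l\<in>UNIV. V 0 (Inl i) l * a n l j)"
  proof (intro sum.cong refl)
    fix l show "(\<Sum>p=0..n. V p (Inl i) l * a (n - p) l j) = V 0 (Inl i) l * a n l j"
      by (simp add: sum.atLeast_Suc_atMost V_conserved)
  qed
  also have "\<dots> = a n i j"
    by (simp add: V_conserved if_distrib[where f = "\<lambda>x. x * _"] cong: if_cong)
  finally have "K1 n (Inl i) j = flux x y (\<lambda>k. V n k j) (Inl i) - a n i j"
    by (simp add: K1_def commutator_def)
  then show ?thesis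
    using D_Suc'[OF assms, of "Inl i" j] D_conserved[of "Suc n" i j] by linarith
qed

lemma a_0: "a 0 i j = flux x y (\<lambda>k. V 0 k j) (Inl i)"
  and a_1: "a 1 i j = flux x y (\<lambda>k. V 1 k j) (Inl i)"
  and a_2: "a 2 i j = flux x y (\<lambda>k. V 2 k j) (Inl i) - 1/12 * K3 0 (Inl i) j"
  and a_3: "a 3 i j = flux x y (\<lambda>k. V 3 k j) (Inl i) - 1/12 * K3 1 (Inl i) j"
  and a_4: "a 4 i j = flux x y (\<lambda>k. V 4 k j) (Inl i) - 1/12 * K3 2 (Inl i) j + 1/120 * K5 0 (Inl i) j"
  by (simp_all add: a_eq)

lemma V_0: "V 0 (Inl i) j = conserved_table conserved_one i j" "V 0 (Inr k) j = E k j"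
  by (cases i; cases j) (simp_all add: V_conserved table_simps V_nonconserved D_0)

lemma D_1: "D 1 r j = K1 0 r j"
  and D_2: "D 2 r j = K1 1 r j"
  and D_3: "D 3 r j = K1 2 r j - 1/12 * K3 0 r j"
  using D_Suc'[of 0 r j] D_Suc'[of 1 r j] D_Suc'[of 2 r j] by (simp_all flip: numeral_2_eq_2)

lemma V_1: "V 1 (Inl i) j = 0" "V 1 (Inr k) j = - (\<sigma> k * K1 0 (Inr k) j)"
  and V_2: "V 2 (Inl i) j = 0" "V 2 (Inr k) j = - (\<sigma> k * K1 1 (Inr k) j)"
  and V_3: "V 3 (Inl i) j = 0" "V 3 (Inr k) j = - (\<sigma> k * (K1 2 (Inr k) j - 1/12 * K3 0 (Inr k) j))"
  and V_4: "V 4 (Inl i) j = 0"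
  unfolding D_1[symmetric] D_2[symmetric] D_3[symmetric] by (simp_all add: V_conserved V_nonconserved)

lemma a_0_eq: "a 0 = conserved_table
   [[0, x, y],
    [x * (2/3 + E Epsi Rho / 6 + E PhiXX Rho / 2) + y * E PhiXY Rho,
     x * (E Epsi Qx / 6 + E PhiXX Qx / 2) + y * E PhiXY Qx, x * (E Epsi Qy / 6 + E PhiXX Qy / 2)
       + y * E PhiXY Qy],
    [y * (2/3 + E Epsi Rho / 6 - E PhiXX Rho / 2) + x * E PhiXY Rho,
     y * (E Epsi Qx / 6 - E PhiXX Qx / 2) + x * E PhiXY Qx, y * (E Epsi Qy / 6 - E PhiXX Qy / 2)
       + x * E PhiXY Qy]]"
  by (rule conserved_tableI) (simp_all add: a_0 V_0 table_simps)

end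

text \<open>A symbol of odd degree exchanges \<rho> with the momentum. A radial function times the
  vector \<xi> rotates as required in either place.\<close>

lemma isotropic_symbol_odd:
  assumes "\<And>x y. A x y = conserved_table
    [[0, p (x\<^sup>2 + y\<^sup>2) * x, p (x\<^sup>2 + y\<^sup>2) * y], [q (x\<^sup>2 + y\<^sup>2) * x, 0, 0], [q (x\<^sup>2 + y\<^sup>2) * y, 0, 0]]"
  shows "isotropic_symbol A"
proof -
  have "(c * x - s * y)\<^sup>2 + (s * x + c * y)\<^sup>2 = x\<^sup>2 + y\<^sup>2" if "c\<^sup>2 + s\<^sup>2 = 1" for c s x y :: real
    using that by algebra
  then show ?thesis
    by (auto simp: isotropic_symbol_def Let_def assms table_simps algebra_simps)
qed

text \<open>In even degree the momentum block has the form v Id + w \<xi> \<xi>^T with radial v and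
  w: conjugation by r fixes Id and sends \<xi> \<xi>^T to (r \<xi>) (r \<xi>)^T.\<close>

lemma isotropic_symbol_even:
  assumes "\<And>x y. A x y = conserved_table
    [[u (x\<^sup>2 + y\<^sup>2), 0, 0],
     [0, v (x\<^sup>2 + y\<^sup>2) + w (x\<^sup>2 + y\<^sup>2) * x\<^sup>2, w (x\<^sup>2 + y\<^sup>2) * x * y],
     [0, w (x\<^sup>2 + y\<^sup>2) * x * y, v (x\<^sup>2 + y\<^sup>2) + w (x\<^sup>2 + y\<^sup>2) * y\<^sup>2]]"
  shows "isotropic_symbol A"
proof -
  have 1: "(c * x - s * y)\<^sup>2 + (s * x + c * y)\<^sup>2 = x\<^sup>2 + y\<^sup>2" if "c\<^sup>2 + s\<^sup>2 = 1" for c s x y :: real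
    using that by algebra
  have 2: "V + W * (c * x - s * y)\<^sup>2 = c * (c * (V + W * x\<^sup>2) - s * (W * x * y)) - s * (c * (W * x * y)
    - s * (V + W * y\<^sup>2))"
    "W * (c * x - s * y) * (s * x + c * y) = s * (c * (V + W * x\<^sup>2) - s * (W * x * y))
      + c * (c * (W * x * y) - s * (V + W * y\<^sup>2))"
    "W * (c * x - s * y) * (s * x + c * y) = c * (s * (V + W * x\<^sup>2) + c * (W * x * y))
      - s * (s * (W * x * y) + c * (V + W * y\<^sup>2))"
    "V + W * (s * x + c * y)\<^sup>2 = s * (s * (V + W * x\<^sup>2) + c * (W * x * y)) + c * (s * (W * x * y) + c * (V
      + W * y\<^sup>2))"
    if "c\<^sup>2 + s\<^sup>2 = 1" for c s x y V W :: real
    using that by algebra+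
  show ?thesis
    unfolding isotropic_symbol_def Let_def assms table_simps
    using 1 2 by simp
qed

section \<open>The symbols of the first five equivalent equations\<close>

text \<open>The entries below were obtained with computer algebra. The equilibrium coefficients that have to
  vanish at the lower orders are already replaced by 0; the remaining ones are
  \<open>e = E\<^sub>\<epsilon>\<^sup>\<rho>\<close>, the row \<open>(f, g, h)\<close> of \<open>\<epsilon>\<^sub>2\<close>, and \<open>d\<close> or the rows \<open>(p0, p1, p2)\<close> and \<open>(r0, r1, r2)\<close> for
  \<open>\<phi>\<^sub>x\<close> and \<open>\<phi>\<^sub>y\<close>.\<close>

definition second_order_table ::
  "real \<Rightarrow> real \<Rightarrow> real \<Rightarrow> real \<Rightarrow> real \<Rightarrow> real \<Rightarrow> real \<Rightarrow> real \<Rightarrow> real \<Rightarrow> real \<Rightarrow> real \<Rightarrow> real \<Rightarrow> conserved \<Rightarrow>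
    conserved \<Rightarrow> real" where
  "second_order_table e p0 p1 p2 r0 r1 r2 se sxx sxy x y = conserved_table
      [[0, 0, 0],
       [-1/6 * (p0 * se - p0 * sxx) * x^2 - 1/3 * p0 * sxy * y^2 - 1/6 * (r0 * se + r0 * sxx
         + 2 * r0 * sxy) * x * y,
        1/6 * (se * (e - p1 - 1) + p1 * sxx - sxx) * x^2 - 1/3 * (p1 * sxy + 2 * sxy) * y^2
          - 1/6 * (r1 * se + r1 * sxx + 2 * r1 * sxy) * x * y,
        1/6 * (se * (e - 1) + sxx - r2 * (se + sxx + 2 * sxy) - 4 * sxy) * x * y - 1/6 * (p2 * se
          - p2 * sxx) * x^2 - 1/3 * p2 * sxy * y^2],
       [-1/3 * r0 * sxy * x^2 - 1/6 * (r0 * se - r0 * sxx) * y^2 - 1/6 * (p0 * se + p0 * sxx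
         + 2 * p0 * sxy) * x * y,
        1/6 * (se * (e - 1) + sxx - p1 * (se + sxx + 2 * sxy) - 4 * sxy) * x * y - 1/3 * r1 * sxy * x^2
          - 1/6 * (r1 * se - r1 * sxx) * y^2,
        1/6 * (se * (e - r2 - 1) + r2 * sxx - sxx) * y^2 - 1/3 * (r2 * sxy + 2 * sxy) * x^2
          - 1/6 * (p2 * se + p2 * sxx + 2 * p2 * sxy) * x * y]]"

text \<open>The zeros in \<open>E\<close> are the first order conditions. A_2 is the flux of -
  \<sigma> K1 at order 0, so the table of \<open>K1 0\<close> is the only intermediate
  result.\<close>

lemma (in moment_expansion) a_1_eq:
  assumes E: "E = nonconserved_table
      [[e, 0, 0],
       [f, g, h],
       [p0, p1, p2],
       [r0, r1, r2],
       [0, 0, 0],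
       [0, 0, 0]]"
    and s: "\<sigma> = nonconserved_list [se, se2, sx, sy, sxx, sxy]"
  shows "a 1 = second_order_table e p0 p1 p2 r0 r1 r2 se sxx sxy x y"
proof -
  have a_0_eq': "a 0 = conserved_table
      [[0, x, y],
       [1/6 * (e + 4) * x, 0, 0],
       [1/6 * (e + 4) * y, 0, 0]]"
    by (rule conserved_tableI; simp only: a_0 flux.simps V_0 E table_simps; ((simp; fail) | algebra))
  have K1_0_eq: "K1 0 = moment_table conserved_zero
      [[p0 * x + r0 * y, r1 * y - (e - p1 - 1) * x, p2 * x - (e - r2 - 1) * y],
       [-1/6 * (e * g + 4 * g - 6 * p0) * x - 1/6 * (e * h + 4 * h - 6 * r0) * y,
        r1 * y - (f - p1) * x,
        p2 * x - (f - r2) * y],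
       [-1/6 * (e * (p1 - 2) - 2 * f + 4 * p1) * x - 1/6 * (e * p2 + 4 * p2) * y,
        1/3 * (g - 3 * p0) * x,
        1/3 * h * x - p0 * y],
       [-1/6 * (e * r1 + 4 * r1) * x - 1/6 * (e * (r2 - 2) - 2 * f + 4 * r2) * y,
        1/3 * g * y - r0 * x,
        1/3 * (h - 3 * r0) * y],
       [1/3 * r0 * y - 1/3 * p0 * x,
        1/3 * r1 * y - 1/3 * (p1 - 1) * x,
        1/3 * (r2 - 1) * y - 1/3 * p2 * x],
       [1/3 * r0 * x + 1/3 * p0 * y,
        1/3 * r1 * x + 1/3 * (p1 + 2) * y,
        1/3 * (r2 + 2) * x + 1/3 * p2 * y]]"
    by (rule moment_tableI; (rule conserved_tableI | rule nonconserved_tableI);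
        simp only: K1_0 flux.simps V_0 E a_0_eq' table_simps; ((simp; fail) | algebra))
  show ?thesis
    unfolding second_order_table_def
    by (rule conserved_tableI; simp only: a_1 flux.simps V_1 s K1_0_eq table_simps; ((simp; fail) | algebra))
qed

definition third_order_table ::
  "real \<Rightarrow> real \<Rightarrow> real \<Rightarrow> real \<Rightarrow> real \<Rightarrow> real \<Rightarrow> real \<Rightarrow> real \<Rightarrow> real \<Rightarrow> real \<Rightarrow> real \<Rightarrow> real \<Rightarrow> conserved \<Rightarrow>
    conserved \<Rightarrow> real" where
  "third_order_table d e f g h se sx sy sxx sxy x y = conserved_table
      [[0,
        1/72 * (e - 2) * x^3 - 1/72 * (6 * d - e + 8) * x * y^2,
        1/72 * (e - 2) * y^3 - 1/72 * (6 * d - e + 8) * x^2 * y],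
       [-1/216 * (e * (6 * se * (se * (d - e - 3) + d * sx - 2 * sx) - 6 * sxx * (d * (sx + sxx) - 2 * sx
         - sxx) + e + 2) + 24 * d * (se * (se + sx) - sx * sxx - sxx^2) - 12 * f * (se * sx - sx * sxx)
         + 24 * se^2 + 24 * sxx^2 - 8) * x^3 - 1/216 * (e * (3 * d * (4 * sxy * (sx + 2 * sxy + sy)
         + 2 * se * (se + sy) + 2 * sxx * sy + 2 * sxx^2 - 3) - 6 * se * (e * se + 3 * se + 2 * sy)
         - 24 * sxy * (sx - 2 * sxy + sy) - 6 * sxx * (sxx + 2 * sy) + e + 2) + 12 * d * (4 * sxy * (sx
         + 2 * sxy + sy) + 2 * se * (se + sy) + 2 * sxx * sy + 2 * sxx^2 - 3) - 6 * f * (2 * sy * (se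
         + sxx + 2 * sxy) + 4 * sx * sxy - 1) + 24 * se^2 - 24 * sxx^2 + 192 * sxy^2 - 32) * x * y^2,
        1/18 * (g * se * sx - g * sx * sxx) * x^3 + 1/36 * (g * (2 * sy * (se + sxx + 2 * sxy)
          + 4 * sx * sxy - 1)) * x * y^2,
        1/18 * (h * se * sx - h * sx * sxx) * x^3 + 1/36 * (h * (2 * sy * (se + sxx + 2 * sxy)
          + 4 * sx * sxy - 1)) * x * y^2],
       [-1/216 * (e * (6 * se * (se * (d - e - 3) + d * sy - 2 * sy) - 6 * sxx * (d * (sxx + sy) - sxx
         - 2 * sy) + e + 2) + 24 * d * (se * (se + sy) - sxx * sy - sxx^2) - 12 * f * (se * sy - sxx * sy)
         + 24 * se^2 + 24 * sxx^2 - 8) * y^3 - 1/216 * (e * (3 * d * (2 * sx * (se + sxx + 2 * sxy)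
         + 4 * sxy * (2 * sxy + sy) + 2 * se^2 + 2 * sxx^2 - 3) - 6 * se * (e * se + 3 * se + 2 * sx)
         - 24 * sxy * (sx - 2 * sxy + sy) - 6 * sxx * (2 * sx + sxx) + e + 2) + 12 * d * (2 * sx * (se
         + sxx + 2 * sxy) + 4 * sxy * (2 * sxy + sy) + 2 * se^2 + 2 * sxx^2 - 3) - 6 * f * (2 * sx * (se
         + sxx + 2 * sxy) + 4 * sxy * sy - 1) + 24 * se^2 - 24 * sxx^2 + 192 * sxy^2 - 32) * x^2 * y,
        1/18 * (g * se * sy - g * sxx * sy) * y^3 + 1/36 * (g * (2 * sx * (se + sxx + 2 * sxy)
          + 4 * sxy * sy - 1)) * x^2 * y,
        1/18 * (h * se * sy - h * sxx * sy) * y^3 + 1/36 * (h * (2 * sx * (se + sxx + 2 * sxy)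
          + 4 * sxy * sy - 1)) * x^2 * y]]"

text \<open>\<open>d\<close> stands for the common value E_\<phi>x^qx = E_\<phi>y^qy obtained at
  second order; its expression through \<open>sxx\<close> and \<open>sxy\<close> is kept out of the
  tables, which stay polynomial. The tables of the iterated commutators are part of the conclusion
  because the fourth and fifth orders use them again.\<close>

lemma (in moment_expansion) low_order_eq:
  assumes E: "E = nonconserved_table
      [[e, 0, 0],
       [f, g, h],
       [0, d, 0],
       [0, 0, d],
       [0, 0, 0],
       [0, 0, 0]]"
    and s: "\<sigma> = nonconserved_list [se, se2, sx, sy, sxx, sxy]"
  shows "a 0 = conserved_table
      [[0, x, y],
       [1/6 * (e + 4) * x, 0, 0],
       [1/6 * (e + 4) * y, 0, 0]]" (is ?a0)
    and "K1 0 = moment_table conserved_zero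
      [[0, (d - e + 1) * x, (d - e + 1) * y],
       [-1/6 * (e * g + 4 * g) * x - 1/6 * (e * h + 4 * h) * y, (d - f) * x, (d - f) * y],
       [-1/6 * (d * (e + 4) - 2 * e - 2 * f) * x, 1/3 * g * x, 1/3 * h * x],
       [-1/6 * (d * (e + 4) - 2 * e - 2 * f) * y, 1/3 * g * y, 1/3 * h * y],
       [0, -1/3 * (d - 1) * x, 1/3 * (d - 1) * y],
       [0, 1/3 * (d + 2) * y, 1/3 * (d + 2) * x]]" (is ?K10)
    and "a 1 = conserved_table
      [[0, 0, 0],
       [0,
        -1/6 * (se * (d - e + 1) - d * sxx + sxx) * x^2 - 1/3 * (d * sxy + 2 * sxy) * y^2,
        -1/6 * (d * (se + sxx + 2 * sxy) - se * (e - 1) - sxx + 4 * sxy) * x * y],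
       [0,
        -1/6 * (d * (se + sxx + 2 * sxy) - se * (e - 1) - sxx + 4 * sxy) * x * y,
        -1/3 * (d * sxy + 2 * sxy) * x^2 - 1/6 * (se * (d - e + 1) - d * sxx + sxx) * y^2]]" (is ?a1)
    and "K1 1 = moment_table conserved_zero
      [[1/6 * (e * (se * (d - e - 3) + d * sx - 2 * sx) + 4 * d * (se + sx) - 2 * f * sx + 4 * se) * x^2
        + 1/6 * (e * (se * (d - e - 3) + d * sy - 2 * sy) + 4 * d * (se + sy) - 2 * f * sy + 4 * se) * y^2,
        -1/3 * g * sx * x^2 - 1/3 * g * sy * y^2,
        -1/3 * h * sx * x^2 - 1/3 * h * sy * y^2],
       [1/6 * (d * (e * (se2 + sx) + 4 * se2 + 4 * sx) - f * (e * se2 + 4 * se2 + 2 * sx)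
         - 2 * e * sx) * x^2 + 1/6 * (d * (e * (se2 + sy) + 4 * se2 + 4 * sy) - f * (e * se2 + 4 * se2
         + 2 * sy) - 2 * e * sy) * y^2,
        1/6 * (g * (se * (d - e + 1) - se2 * (e + 4) - d * sxx - 2 * sx + sxx)) * x^2 + 1/3 * (d * g * sxy
          + 2 * g * sxy - g * sy) * y^2 + 1/6 * (h * (d * (se + sxx + 2 * sxy) - e * (se + se2) + se
          - 4 * se2 - sxx + 4 * sxy)) * x * y,
        1/3 * (d * h * sxy - h * sx + 2 * h * sxy) * x^2 + 1/6 * (h * (se * (d - e + 1) - se2 * (e + 4)
          - d * sxx + sxx - 2 * sy)) * y^2 + 1/6 * (g * (d * (se + sxx + 2 * sxy) - e * (se + se2) + se
          - 4 * se2 - sxx + 4 * sxy)) * x * y],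
       [1/18 * (g * (e * (se2 + sx) + 4 * se2 + 4 * sx)) * x^2 + 1/18 * (h * (e * (se2 + sx) + 4 * se2
         + 4 * sx)) * x * y,
        1/3 * (d^2 * sxy + d * sxy - 2 * sxy) * y^2 - 1/6 * (2 * se - d * (se * (d - e - 1) - sx * (e + 4)
          - d * sxx - 2 * se2 - sxx) - 2 * e * (se + sx) - 2 * f * (se2 + sx) - 2 * sxx) * x^2,
        -1/6 * (2 * se + 2 * sxx + 4 * sxy - d * (d * (se + sxx + 2 * sxy) - e * (se + sx) - se - 2 * se2
          - 4 * sx + sxx + 2 * sxy) - 2 * e * (se + sx) - 2 * f * (se2 + sx)) * x * y],
       [1/18 * (h * (e * (se2 + sy) + 4 * se2 + 4 * sy)) * y^2 + 1/18 * (g * (e * (se2 + sy) + 4 * se2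
         + 4 * sy)) * x * y,
        -1/6 * (2 * se + 2 * sxx + 4 * sxy - d * (d * (se + sxx + 2 * sxy) - e * (se + sy) - se - 2 * se2
          + sxx + 2 * sxy - 4 * sy) - 2 * e * (se + sy) - 2 * f * (se2 + sy)) * x * y,
        1/3 * (d^2 * sxy + d * sxy - 2 * sxy) * x^2 - 1/6 * (2 * se - d * (se * (d - e - 1) - sxx * (d
          + 1) - e * sy - 2 * se2 - 4 * sy) - 2 * e * (se + sy) - 2 * f * (se2 + sy) - 2 * sxx) * y^2],
       [1/18 * (d * (e * (sxx + sy) + 4 * sxx + 4 * sy) - e * (sxx + 2 * sy) - 2 * f * sy - 4 * sxx) * y^2
         - 1/18 * (d * (e * (sx + sxx) + 4 * sx + 4 * sxx) - e * (2 * sx + sxx) - 2 * f * sx - 4 * sxx) * x^2,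
        1/9 * g * sx * x^2 - 1/9 * g * sy * y^2,
        1/9 * h * sx * x^2 - 1/9 * h * sy * y^2],
       [1/18 * (d * (e * (sx + 2 * sxy + sy) + 4 * sx + 8 * sxy + 4 * sy) - 2 * e * (sx - 2 * sxy + sy)
         - 2 * f * sx - 2 * f * sy + 16 * sxy) * x * y,
        -1/9 * (g * sx + g * sy) * x * y,
        -1/9 * (h * sx + h * sy) * x * y]]" (is ?K11)
    and "K2 0 = moment_table
      [[0, 0, 0],
       [0, 1/3 * (d + 2) * y^2 - 1/6 * (e - 2) * x^2, 1/6 * (4 * d - e + 4) * x * y],
       [0, 1/6 * (4 * d - e + 4) * x * y, 1/3 * (d + 2) * x^2 - 1/6 * (e - 2) * y^2]]
      [[-1/6 * (e * (2 * d - e - 5) + 8 * d - 2 * f + 4) * (x^2 + y^2),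
        1/3 * g * (x^2 + y^2),
        1/3 * h * (x^2 + y^2)],
       [-1/6 * (e * (2 * d - f - 2) + 8 * d - 6 * f) * (x^2 + y^2),
        1/6 * (e * g + 6 * g) * x^2 + 1/3 * g * y^2 + 1/6 * (e * h + 4 * h) * x * y,
        1/3 * h * x^2 + 1/6 * (e * h + 6 * h) * y^2 + 1/6 * (e * g + 4 * g) * x * y],
       [-1/9 * (e * g + 4 * g) * x^2 - 1/9 * (e * h + 4 * h) * x * y,
        1/6 * (d * (e + 10) - 4 * e - 4 * f) * x^2 + 1/3 * (d + 2) * y^2,
        1/6 * (d * (e + 8) - 4 * e - 4 * f + 8) * x * y],
       [-1/9 * (e * h + 4 * h) * y^2 - 1/9 * (e * g + 4 * g) * x * y,
        1/6 * (d * (e + 8) - 4 * e - 4 * f + 8) * x * y,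
        1/3 * (d + 2) * x^2 + 1/6 * (d * (e + 10) - 4 * e - 4 * f) * y^2],
       [1/18 * (2 * d * (e + 4) - 3 * e - 2 * f - 4) * (x^2 - y^2),
        -1/9 * g * (x^2 - y^2),
        -1/9 * h * (x^2 - y^2)],
       [-2/9 * (d * (e + 4) - f + 4) * x * y, 2/9 * g * x * y, 2/9 * h * x * y]]" (is ?K20)
    and "K3 0 = moment_table
      [[0,
        1/6 * (6 * d - e + 8) * x * y^2 - 1/6 * (e - 2) * x^3,
        1/6 * (6 * d - e + 8) * x^2 * y - 1/6 * (e - 2) * y^3],
       [1/18 * (e^2 + 2 * e - 8) * x^3 - 1/18 * (e * (9 * d - e - 2) + 36 * d - 6 * f + 32) * x * y^2,
        1/3 * g * x * y^2,
        1/3 * h * x * y^2],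
       [1/18 * (e^2 + 2 * e - 8) * y^3 - 1/18 * (e * (9 * d - e - 2) + 36 * d - 6 * f + 32) * x^2 * y,
        1/3 * g * x^2 * y,
        1/3 * h * x^2 * y]]
      [[-1/6 * (e * g + 4 * g) * (x * y^2 + x^3) - 1/6 * (e * h + 4 * h) * (x^2 * y + y^3),
        1/6 * (e * (3 * d - e - 10) + 18 * d - 6 * f + 6) * x^3 + 1/6 * (e * (3 * d - e - 10) + 24 * d
          - 6 * f + 24) * x * y^2,
        1/6 * (e * (3 * d - e - 10) + 18 * d - 6 * f + 6) * y^3 + 1/6 * (e * (3 * d - e - 10) + 24 * d
          - 6 * f + 24) * x^2 * y],
       [-1/36 * (e^2 * g + 14 * e * g + 40 * g) * (x * y^2 + x^3) - 1/36 * (e^2 * h + 14 * e * h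
         + 40 * h) * (x^2 * y + y^3),
        1/6 * (e * (3 * d - f - 6) + 18 * d - 10 * f) * x^3 + 1/6 * (e * (3 * d - f - 6) + 18 * d - 10 * f
          + 12) * x * y^2,
        1/6 * (e * (3 * d - f - 6) + 18 * d - 10 * f) * y^3 + 1/6 * (e * (3 * d - f - 6) + 18 * d - 10 * f
          + 12) * x^2 * y],
       [-1/36 * (e * (d * (e + 26) - 6 * e - 6 * f - 36) + 88 * d - 36 * f) * x^3 - 1/36 * (e * (d * (e
         + 26) - 6 * e - 6 * f - 12) + 88 * d - 36 * f + 96) * x * y^2,
        1/6 * (e * g + 6 * g) * x^3 + 1/6 * (e * h + 4 * h) * x^2 * y + 1/3 * g * x * y^2,
        1/3 * h * x^3 + 1/6 * (e * g + 4 * g) * x^2 * y + 1/6 * (e * h + 6 * h) * x * y^2],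
       [-1/36 * (e * (d * (e + 26) - 6 * e - 6 * f - 36) + 88 * d - 36 * f) * y^3 - 1/36 * (e * (d * (e
         + 26) - 6 * e - 6 * f - 12) + 88 * d - 36 * f + 96) * x^2 * y,
        1/3 * g * y^3 + 1/6 * (e * g + 6 * g) * x^2 * y + 1/6 * (e * h + 4 * h) * x * y^2,
        1/6 * (e * h + 6 * h) * y^3 + 1/3 * h * x^2 * y + 1/6 * (e * g + 4 * g) * x * y^2],
       [1/18 * (e * g + 4 * g) * (x^3 - x * y^2) - 1/18 * (e * h + 4 * h) * (y^3 - x^2 * y),
        1/6 * (d * (e + 4) - 2 * e - 2 * f) * x * y^2 - 1/6 * (d * (e + 6) - 2 * e - 2 * f - 2) * x^3,
        1/6 * (d * (e + 6) - 2 * e - 2 * f - 2) * y^3 - 1/6 * (d * (e + 4) - 2 * e - 2 * f) * x^2 * y],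
       [-1/9 * (e * g + 4 * g) * x^2 * y - 1/9 * (e * h + 4 * h) * x * y^2,
        1/3 * (d + 2) * y^3 + 1/3 * (d * (e + 7) - 2 * e - 2 * f + 6) * x^2 * y,
        1/3 * (d + 2) * x^3 + 1/3 * (d * (e + 7) - 2 * e - 2 * f + 6) * x * y^2]]" (is ?K30)
    and "a 2 = third_order_table d e f g h se sx sy sxx sxy x y" (is ?a2)
proof -
  show a_0_eq': ?a0
    by (rule conserved_tableI; simp only: a_0 flux.simps V_0 E table_simps; ((simp; fail) | algebra))
  show K1_0_eq: ?K10
    by (rule moment_tableI; (rule conserved_tableI | rule nonconserved_tableI);
        simp only: K1_0 flux.simps V_0 E a_0_eq' table_simps; ((simp; fail) | algebra))
  show a_1_eq': ?a1
    by (rule conserved_tableI; simp only: a_1 flux.simps V_1 s K1_0_eq table_simps; ((simp; fail) | algebra))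
  show K1_1_eq: ?K11
    by (rule moment_tableI; (rule conserved_tableI | rule nonconserved_tableI);
        simp only: K1_1 flux.simps V_0 V_1 E s K1_0_eq a_0_eq' a_1_eq' table_simps; ((simp; fail) | algebra))
  show K2_0_eq: ?K20
    by (rule moment_tableI; (rule conserved_tableI | rule nonconserved_tableI);
        simp only: K2_def commutator_0 flux.simps K1_0_eq a_0_eq' table_simps; ((simp; fail) | algebra))
  show K3_0_eq: ?K30
    by (rule moment_tableI; (rule conserved_tableI | rule nonconserved_tableI);
        simp only: K3_def commutator_0 flux.simps K2_0_eq a_0_eq' table_simps; ((simp; fail) | algebra))
  show ?a2
    unfolding third_order_table_def
    by (rule conserved_tableI; simp only: a_2 flux.simps V_2 s K1_1_eq K3_0_eq table_simps; ((simp; fail)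
      | algebra))
qed

text \<open>The flux into \<rho> only involves q_x and q_y, so this row of A_4 needs just the
  conserved rows of \<open>K2 1\<close> and avoids the table of \<open>K1 2\<close>. It suffices to
  fix the row of \<epsilon>_2 in \<open>E\<close> before the full A_4 is computed.\<close>

lemma (in moment_expansion) a_3_rho_eq:
  assumes E: "E = nonconserved_table
      [[e, 0, 0],
       [f, g, h],
       [0, -1, 0],
       [0, 0, -1],
       [0, 0, 0],
       [0, 0, 0]]"
    and s: "\<sigma> = nonconserved_list [se, se2, sx, sy, s, s]"
  shows "a 3 Rho Rho = 1/432 * (e * (e * se - 2 * s + 4 * se) - 8 * s) * (x^4 + y^4)
    + 1/216 * (e * (se * (e + 4) - 2 * s + 9 * sx + 9 * sy) + 6 * f * (sx + sy) - 8 * s + 12 * sx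
    + 12 * sy) * x^2 * y^2" (is ?a30)
    and "a 3 Rho Qx = 1/36 * (g * sx + g * sy) * x^2 * y^2" (is ?a31)
    and "a 3 Rho Qy = 1/36 * (h * sx + h * sy) * x^2 * y^2" (is ?a32)
proof -
  note low = low_order_eq[OF E s]
  note a_0_eq' = low(1) and K1_0_eq = low(2) and a_1_eq' = low(3) and K1_1_eq = low(4)
    and K2_0_eq = low(5)
  have K2_1_eq:
    "K2 1 (Inl Rho) Rho = 0"
    "K2 1 (Inl Rho) Qx = 0"
    "K2 1 (Inl Rho) Qy = 0"
    "K2 1 (Inl Qx) Rho = -1/36 * (e * (e * se - 2 * s + 4 * se) - 8 * s) * x^3 - 1/36 * (e * (se * (e + 4)
      - 2 * s + 6 * sx + 12 * sy) + 4 * f * (sx + 2 * sy) - 8 * s + 8 * sx + 16 * sy) * x * y^2"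
    "K2 1 (Inl Qx) Qx = -1/9 * (g * sx + 2 * g * sy) * x * y^2"
    "K2 1 (Inl Qx) Qy = -1/9 * (h * sx + 2 * h * sy) * x * y^2"
    "K2 1 (Inl Qy) Rho = -1/36 * (e * (e * se - 2 * s + 4 * se) - 8 * s) * y^3 - 1/36 * (e * (se * (e + 4)
      - 2 * s + 12 * sx + 6 * sy) + 4 * f * (2 * sx + sy) - 8 * s + 16 * sx + 8 * sy) * x^2 * y"
    "K2 1 (Inl Qy) Qx = -1/9 * (2 * g * sx + g * sy) * x^2 * y"
    "K2 1 (Inl Qy) Qy = -1/9 * (2 * h * sx + h * sy) * x^2 * y"
    by (simp only: K2_def commutator_1 flux.simps K1_0_eq a_0_eq' K1_1_eq a_1_eq' table_simps; ((simp;
      fail) | algebra))+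
  have K3_1_eq:
    "K3 1 (Inl Rho) Rho = -1/36 * (e * (e * se - 2 * s + 4 * se) - 8 * s) * (x^4 + y^4)
      - 1/18 * (e * (se * (e + 4) - 2 * s + 9 * sx + 9 * sy) + 6 * f * (sx + sy) - 8 * s + 12 * sx
      + 12 * sy) * x^2 * y^2"
    "K3 1 (Inl Rho) Qx = -1/3 * (g * sx + g * sy) * x^2 * y^2"
    "K3 1 (Inl Rho) Qy = -1/3 * (h * sx + h * sy) * x^2 * y^2"
    by (simp only: K3_def commutator_1 flux.simps K2_0_eq a_0_eq' K2_1_eq a_1_eq' table_simps; ((simp;
      fail) | algebra))+
  show ?a30 ?a31 ?a32
    by (simp only: a_3 flux.simps V_3 K3_1_eq table_simps; ((simp; fail) | algebra))+
qed

definition fourth_order_table ::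
  "real \<Rightarrow> real \<Rightarrow> real \<Rightarrow> real \<Rightarrow> real \<Rightarrow> real \<Rightarrow> real \<Rightarrow> real \<Rightarrow> conserved \<Rightarrow> conserved \<Rightarrow> real" where
  "fourth_order_table e s se se2 sx sy x y = conserved_table
      [[1/432 * (e * (e * se - 2 * s + 4 * se) - 8 * s) * (x^4 + y^4) + 1/216 * (e * (e * se - 2 * s
        + 4 * se) - 8 * s) * x^2 * y^2,
        0,
        0],
       [0,
        1/216 * (e * (se * (6 * se * (2 * se * (e + 2) - 2 * s + 3 * sx) - 6 * s * (2 * s + 3 * sx)
          - 18 * se2 * sx - 2 * e - 5) + 18 * s * se2 * sx - 12 * s^3 + 4 * s) - 2 * s * (6 * sx * (s - se
          - se2) + 12 * s^2 - 5) - 12 * se * se2 * sx) * x^4 - 1/36 * (8 * s^2 * sx - 4 * s^3 - s) * y^4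
          + 1/216 * (e * (2 * se * (3 * se * (2 * e * se + 4 * se + 3 * sy) - 3 * s * (2 * s + 2 * se
          - 6 * sx - 9 * sy) - 9 * se2 * sy - e - 7) - 2 * s * (9 * se2 * (2 * sx + 3 * sy) + 6 * s^2 - 2)
          + 9 * se2) + 4 * s * (6 * sx * (2 * s - se - se2) - 9 * sy * (3 * s + se + se2) + 7)
          - 12 * se * se2 * sy + 6 * se + 6 * se2) * x^2 * y^2,
        1/216 * (se * (e * (6 * se * (2 * e * se + 4 * se + 3 * sx) - 18 * se2 * sx - 2 * e - 5)
          - 12 * se2 * sx + 6) - 2 * s * (e * (3 * se * (2 * s + 2 * se + 3 * sx) + 6 * s^2 - 9 * se2 * sx
          - 2) + 6 * s * (4 * s - 3 * sx + 6 * sy) + 6 * se * (3 * sx + 2 * sy) - 6 * se2 * sx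
          - 11)) * x^3 * y + 1/216 * (e * (2 * se * (3 * se * (2 * e * se + 4 * se + 3 * sy)
          - 3 * s * (2 * s + 2 * se - 6 * sx - 9 * sy) - 9 * se2 * sy - e - 7)
          - 2 * s * (9 * se2 * (2 * sx + 3 * sy) + 6 * s^2 - 2) + 9 * se2) - 2 * s * (6 * s * (4 * s
          + 6 * sx - 3 * sy) + 6 * se2 * (2 * sx + 3 * sy) - 6 * se * sy - 11) - 12 * se * se2 * sy
          + 6 * se2) * x * y^3],
       [0,
        1/216 * (e * (2 * se * (3 * se * (2 * e * se + 4 * se + 3 * sx) - 3 * s * (2 * s + 2 * se - 9 * sx
          - 6 * sy) - 9 * se2 * sx - e - 7) - 2 * s * (9 * se2 * (3 * sx + 2 * sy) + 6 * s^2 - 2)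
          + 9 * se2) + 2 * s * (6 * se * sx + 11 - 6 * s * (4 * s - 3 * sx + 6 * sy) - 6 * se2 * (3 * sx
          + 2 * sy)) - 12 * se * se2 * sx + 6 * se2) * x^3 * y + 1/216 * (se * (e * (6 * se * (2 * e * se
          + 4 * se + 3 * sy) - 18 * se2 * sy - 2 * e - 5) - 12 * se2 * sy + 6)
          - 2 * s * (e * (3 * se * (2 * s + 2 * se + 3 * sy) + 6 * s^2 - 9 * se2 * sy - 2)
          + 6 * s * (4 * s + 6 * sx - 3 * sy) + 6 * se * (2 * sx + 3 * sy) - 6 * se2 * sy - 11)) * x * y^3,
        1/216 * (e * (se * (6 * se * (2 * se * (e + 2) - 2 * s + 3 * sy) - 6 * s * (2 * s + 3 * sy)
          - 18 * se2 * sy - 2 * e - 5) + 18 * s * se2 * sy - 12 * s^3 + 4 * s) - 2 * s * (6 * sy * (s - se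
          - se2) + 12 * s^2 - 5) - 12 * se * se2 * sy) * y^4
          + 1/216 * (e * (2 * se * (3 * se * (2 * e * se + 4 * se + 3 * sx) - 3 * s * (2 * s + 2 * se
          - 9 * sx - 6 * sy) - 9 * se2 * sx - e - 7) - 2 * s * (9 * se2 * (3 * sx + 2 * sy) + 6 * s^2 - 2)
          + 9 * se2) - 4 * s * (9 * sx * (3 * s + se + se2) - 6 * sy * (2 * s - se - se2) - 7)
          - 12 * se * se2 * sx + 6 * se + 6 * se2) * x^2 * y^2 - 1/36 * (8 * s^2 * sy - 4 * s^3 - s) * x^4]]"

text \<open>The row of \<epsilon>_2 is now the one forced by the row \<rho> of A_4, namely 2 f + 4 +
  3 e = 0 and g = h = 0. Of A_5 a single entry is computed, the one that yields the
  contradiction.\<close>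

lemma (in moment_expansion) a_3_a_4_eq:
  assumes E: "E = nonconserved_table
      [[e, 0, 0],
       [-3/2 * e - 2, 0, 0],
       [0, -1, 0],
       [0, 0, -1],
       [0, 0, 0],
       [0, 0, 0]]"
    and s: "\<sigma> = nonconserved_list [se, se2, sx, sy, s, s]"
  shows "a 3 = fourth_order_table e s se se2 sx sy x y" (is ?a3)
    and "a 4 Rho Qx = 1/4320 * (e * (20 * se * (e * se - 2 * s + 2 * se) - 20 * s^2 - e - 8) - 40 * s^2
      + 20) * x^5 + 1/2160 * (e * (10 * se * (2 * se * (e + 2) - 4 * s + 9 * sx + 9 * sy) - 90 * se2 * (sx
      + sy) - 20 * s^2 - e - 8) - 20 * s * (2 * s - 3 * sx + 9 * sy) - 60 * se2 * sx - 60 * se2 * sy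
      + 44) * x^3 * y^2 + 1/4320 * (e * (20 * se * (e * se - 2 * s + 2 * se) - 20 * s^2 - e - 8)
      - 240 * s * sx - 40 * s^2 + 44) * x * y^4" (is ?a4)
proof -
  note low = low_order_eq[OF E s]
  note a_0_eq' = low(1) and K1_0_eq = low(2) and a_1_eq' = low(3) and K1_1_eq = low(4)
    and K2_0_eq = low(5) and K3_0_eq = low(6)
    and a_2_eq' = low(7)[unfolded third_order_table_def]
  have K1_2_eq: "K1 2 = moment_table
      [[0, -1/72 * (e - 2) * (x * y^2 + x^3), -1/72 * (e - 2) * (x^2 * y + y^3)],
       [1/216 * (e^2 + 2 * e - 8) * (x * y^2 + x^3), 0, 0],
       [1/216 * (e^2 + 2 * e - 8) * (x^2 * y + y^3), 0, 0]]
      [[0,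
        -1/72 * (e * (12 * se * (2 * se * (e + 2) - 2 * s + 3 * sx) - 36 * se2 * sx + e - 2) + 24 * s * sx
          - 24 * se2 * sx) * x^3 - 1/72 * (e * (12 * se * (2 * se * (e + 2) - 2 * s + 3 * sy)
          - 36 * se2 * sy + e - 2) - 48 * s * sx - 72 * s * sy - 24 * se2 * sy) * x * y^2,
        -1/72 * (e * (12 * se * (2 * se * (e + 2) - 2 * s + 3 * sy) - 36 * se2 * sy + e - 2) + 24 * s * sy
          - 24 * se2 * sy) * y^3 - 1/72 * (e * (12 * se * (2 * se * (e + 2) - 2 * s + 3 * sx)
          - 36 * se2 * sx + e - 2) - 72 * s * sx - 48 * s * sy - 24 * se2 * sx) * x^2 * y],
       [0,
        1/144 * (e * (12 * se2 * (3 * e * (se + se2) - 6 * s + 2 * se + 14 * se2 + 6 * sx) - 72 * se * sx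
          + 3 * e - 2) - 48 * se2 * (s - 2 * se2 - sx) - 48 * s * sx - 8) * x^3
          + 1/144 * (e * (12 * se2 * (3 * e * (se + se2) - 6 * s + 2 * se + 14 * se2 + 6 * sy)
          - 72 * se * sy + 3 * e - 2) - 48 * s * (se2 - 2 * sx - 3 * sy) + 48 * se2 * sy + 96 * se2^2
          - 8) * x * y^2,
        1/144 * (e * (12 * se2 * (3 * e * (se + se2) - 6 * s + 2 * se + 14 * se2 + 6 * sy) - 72 * se * sy
          + 3 * e - 2) - 48 * se2 * (s - 2 * se2 - sy) - 48 * s * sy - 8) * y^3
          + 1/144 * (e * (12 * se2 * (3 * e * (se + se2) - 6 * s + 2 * se + 14 * se2 + 6 * sx)
          - 72 * se * sx + 3 * e - 2) - 48 * s * (se2 - 3 * sx - 2 * sy) + 48 * se2 * sx + 96 * se2^2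
          - 8) * x^2 * y],
       [1/216 * (e * (e * (18 * se * (se + sx) - 18 * se2 * sx - 18 * se2^2 - 1) + 12 * sx * (s + 6 * se
         - 7 * se2) + 12 * s^2 + 72 * se^2 - 84 * se2^2 - 2) + 48 * s * (s + sx) - 48 * se2 * sx
         - 48 * se2^2 + 8) * x^3 + 1/216 * (e * (e * (18 * se * (se + sx) - 18 * se2 * sx - 18 * se2^2
         - 1) - 12 * sx * (5 * s - 6 * se + 7 * se2) - 60 * s^2 + 72 * se^2 - 84 * se2^2 - 2)
         - 240 * s * (s + sx) - 48 * se2 * sx - 48 * se2^2 + 8) * x * y^2,
        0,
        0],
       [1/216 * (e * (e * (18 * se * (se + sy) - 18 * se2 * sy - 18 * se2^2 - 1) + 12 * sy * (s + 6 * se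
         - 7 * se2) + 12 * s^2 + 72 * se^2 - 84 * se2^2 - 2) + 48 * s * (s + sy) - 48 * se2 * sy
         - 48 * se2^2 + 8) * y^3 + 1/216 * (e * (e * (18 * se * (se + sy) - 18 * se2 * sy - 18 * se2^2
         - 1) - 12 * sy * (5 * s - 6 * se + 7 * se2) - 60 * s^2 + 72 * se^2 - 84 * se2^2 - 2)
         - 240 * s * (s + sy) - 48 * se2 * sy - 48 * se2^2 + 8) * x^2 * y,
        0,
        0],
       [0,
        1/18 * (e * (2 * s * (s + se) + 3 * se * sx - 3 * se2 * sx) + 2 * s * sx + 4 * s^2
          - 2 * se2 * sx) * x^3 - 1/18 * (2 * s * (e * (s + se) + 6 * s + 2 * sx - 3 * sy)
          + 3 * e * se * sy - 3 * e * se2 * sy - 2 * se2 * sy) * x * y^2,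
        1/18 * (2 * s * (e * (s + se) + 6 * s - 3 * sx + 2 * sy) + 3 * e * se * sx - 3 * e * se2 * sx
          - 2 * se2 * sx) * x^2 * y - 1/18 * (e * (2 * s * (s + se) + 3 * se * sy - 3 * se2 * sy)
          + 2 * s * sy + 4 * s^2 - 2 * se2 * sy) * y^3],
       [0,
        1/9 * (2 * s * sx - s^2) * y^3 + 1/18 * (e * (se * (2 * s - 3 * sx - 3 * sy) + 2 * s^2
          + 3 * se2 * sx + 3 * se2 * sy) + 2 * s * (3 * s - sx + 3 * sy) + 2 * se2 * sx + 2 * se2 * sy) * x^2 * y,
        1/9 * (2 * s * sy - s^2) * x^3 + 1/18 * (e * (se * (2 * s - 3 * sx - 3 * sy) + 2 * s^2
          + 3 * se2 * sx + 3 * se2 * sy) + 2 * s * (3 * s + 3 * sx - sy) + 2 * se2 * sx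
          + 2 * se2 * sy) * x * y^2]]"
    by (rule moment_tableI; (rule conserved_tableI | rule nonconserved_tableI);
        simp only: K1_2 flux.simps V_0 V_1 V_2 E s K1_0_eq K1_1_eq a_0_eq' a_1_eq' a_2_eq' table_simps;
          ((simp; fail) | algebra))
  have K2_1_eq: "K2 1 = moment_table
      [[0, 0, 0],
       [-1/36 * (e * (e * se - 2 * s + 4 * se) - 8 * s) * (x * y^2 + x^3), 0, 0],
       [-1/36 * (e * (e * se - 2 * s + 4 * se) - 8 * s) * (x^2 * y + y^3), 0, 0]]
      [[0,
        1/6 * (e * (se * (2 * e + 7) - 2 * s - 3 * se2) + 2 * s - 2 * se2) * x^3 + 1/6 * (e * (se * (2 * e
          + 7) - 2 * s - 3 * se2) - 10 * s - 2 * se2) * x * y^2,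
        1/6 * (e * (se * (2 * e + 7) - 2 * s - 3 * se2) + 2 * s - 2 * se2) * y^3 + 1/6 * (e * (se * (2 * e
          + 7) - 2 * s - 3 * se2) - 10 * s - 2 * se2) * x^2 * y],
       [0,
        -1/12 * (e * (3 * e * (se + se2) - 6 * s - 4 * se + 20 * se2) - 8 * s + 12 * se2) * x^3
          - 1/12 * (e * (3 * e * (se + se2) - 6 * s - 4 * se + 20 * se2) + 16 * s + 12 * se2) * x * y^2,
        -1/12 * (e * (3 * e * (se + se2) - 6 * s - 4 * se + 20 * se2) - 8 * s + 12 * se2) * y^3
          - 1/12 * (e * (3 * e * (se + se2) - 6 * s - 4 * se + 20 * se2) + 16 * s + 12 * se2) * x^2 * y],
       [-1/36 * (e * (e * (5 * se - 6 * se2) + 6 * s + 20 * se - 28 * se2) + 24 * s - 16 * se2) * x^3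
         - 1/36 * (e * (e * (5 * se - 6 * se2) - 18 * s + 20 * se - 28 * se2) - 72 * s - 16 * se2) * x * y^2,
        0,
        0],
       [-1/36 * (e * (e * (5 * se - 6 * se2) + 6 * s + 20 * se - 28 * se2) + 24 * s - 16 * se2) * y^3
         - 1/36 * (e * (e * (5 * se - 6 * se2) - 18 * s + 20 * se - 28 * se2) - 72 * s - 16 * se2) * x^2 * y,
        0,
        0],
       [0,
        1/18 * (e * (2 * s + 5 * se - 3 * se2) + 10 * s - 2 * se2) * x * y^2 - 1/18 * (e * (2 * s + 5 * se
          - 3 * se2) + 6 * s - 2 * se2) * x^3,
        1/18 * (e * (2 * s + 5 * se - 3 * se2) + 6 * s - 2 * se2) * y^3 - 1/18 * (e * (2 * s + 5 * se
          - 3 * se2) + 10 * s - 2 * se2) * x^2 * y],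
       [0,
        -1/9 * s * y^3 - 1/9 * (e * (s - 2 * se + 3 * se2) + 5 * s + 2 * se2) * x^2 * y,
        -1/9 * s * x^3 - 1/9 * (e * (s - 2 * se + 3 * se2) + 5 * s + 2 * se2) * x * y^2]]"
    by (rule moment_tableI; (rule conserved_tableI | rule nonconserved_tableI);
        simp only: K2_def commutator_1 flux.simps K1_0_eq a_0_eq' K1_1_eq a_1_eq' table_simps; ((simp;
          fail) | algebra))
  have K3_1_eq: "K3 1 = moment_table
      [[-1/36 * (e * (e * se - 2 * s + 4 * se) - 8 * s) * (x^4 + y^4) - 1/18 * (e * (e * se - 2 * s
        + 4 * se) - 8 * s) * x^2 * y^2,
        0,
        0],
       [0,
        1/9 * (e * (e * se - 2 * s + se) - 2 * s) * x^4 + 1/18 * (e * (se * (2 * e + 11) - 4 * s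
          - 9 * se2) - 10 * s - 6 * se2) * x^2 * y^2,
        1/9 * (e * (e * se - 2 * s + se) - 8 * s) * x^3 * y + 1/18 * (e * (se * (2 * e + 11) - 4 * s
          - 9 * se2) - 10 * s - 6 * se2) * x * y^3],
       [0,
        1/18 * (e * (se * (2 * e + 11) - 4 * s - 9 * se2) - 10 * s - 6 * se2) * x^3 * y
          + 1/9 * (e * (e * se - 2 * s + se) - 8 * s) * x * y^3,
        1/9 * (e * (e * se - 2 * s + se) - 2 * s) * y^4 + 1/18 * (e * (se * (2 * e + 11) - 4 * s
          - 9 * se2) - 10 * s - 6 * se2) * x^2 * y^2]]
      [[-1/36 * (e * (e * (se * (2 * e + 21) - 2 * s - 9 * se2) - 2 * s + 52 * se - 42 * se2) + 24 * s
        - 24 * se2) * (x^4 + y^4) - 1/18 * (e * (e * (se * (2 * e + 21) - 2 * s - 9 * se2) - 38 * s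
        + 52 * se - 42 * se2) - 120 * s - 24 * se2) * x^2 * y^2,
        0,
        0],
       [1/72 * (e * (e * (3 * e * (se + se2) - 6 * s - 2 * se + 44 * se2) - 44 * s - 56 * se + 148 * se2)
         - 80 * s + 80 * se2) * (x^4 + y^4) + 1/36 * (e * (e * (3 * e * (se + se2) - 6 * s - 2 * se
         + 44 * se2) + 28 * s - 56 * se + 148 * se2) + 208 * s + 80 * se2) * x^2 * y^2,
        0,
        0],
       [0,
        1/36 * (e * (e * (5 * se - 9 * se2) + 14 * s + 50 * se - 60 * se2) + 44 * s - 36 * se2) * x^4
          + 1/36 * (e * (e * (5 * se - 9 * se2) - 22 * s + 26 * se - 60 * se2) - 148 * s - 36 * se2) * x^2 * y^2,
        1/36 * (e * (e * (5 * se - 9 * se2) + 14 * s + 50 * se - 60 * se2) + 20 * s - 36 * se2) * x^3 * y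
          + 1/36 * (e * (e * (5 * se - 9 * se2) - 22 * s + 26 * se - 60 * se2) - 76 * s - 36 * se2) * x * y^3],
       [0,
        1/36 * (e * (e * (5 * se - 9 * se2) - 22 * s + 26 * se - 60 * se2) - 76 * s - 36 * se2) * x^3 * y
          + 1/36 * (e * (e * (5 * se - 9 * se2) + 14 * s + 50 * se - 60 * se2) + 20 * s - 36 * se2) * x * y^3,
        1/36 * (e * (e * (5 * se - 9 * se2) + 14 * s + 50 * se - 60 * se2) + 44 * s - 36 * se2) * y^4
          + 1/36 * (e * (e * (5 * se - 9 * se2) - 22 * s + 26 * se - 60 * se2) - 148 * s - 36 * se2) * x^2 * y^2],
       [1/108 * (e * (e * (2 * s + 9 * se - 9 * se2) + 22 * s + 36 * se - 42 * se2) + 56 * s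
         - 24 * se2) * (x^4 - y^4),
        0,
        0],
       [1/54 * (e * (e * (s - 9 * se + 9 * se2) + 20 * s - 36 * se + 42 * se2) + 64 * s
         + 24 * se2) * (x * y^3 + x^3 * y),
        0,
        0]]"
    by (rule moment_tableI; (rule conserved_tableI | rule nonconserved_tableI);
        simp only: K3_def commutator_1 flux.simps K2_0_eq a_0_eq' K2_1_eq a_1_eq' table_simps; ((simp;
          fail) | algebra))
  show ?a3
    unfolding fourth_order_table_def
    by (rule conserved_tableI; simp only: a_3 flux.simps V_3 s K1_2_eq K3_0_eq K3_1_eq table_simps;
      ((simp; fail) | algebra))
  \<comment> \<open>From here on only conserved rows are kept: the row \<rho> of a commutator uses
    the momentum rows of its argument through the flux and the row \<rho> through the product with
    \<A>.\<close>
  have K2_2_eq: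
    "K2 2 (Inl Rho) Rho = 1/144 * (e^2 + 2 * e - 8) * (x^4 + y^4) + 1/72 * (e^2 + 2 * e - 8) * x^2 * y^2"
    "K2 2 (Inl Rho) Qx = 0"
    "K2 2 (Inl Rho) Qy = 0"
    "K2 2 (Inl Qx) Rho = 0"
    "K2 2 (Inl Qx) Qx = 1/9 * (2 * s * sx - s^2) * y^4 - 1/144 * (e * (8 * se * (e * se - 2 * s + 2 * se)
      - 8 * s^2 + e + 2) - 16 * s^2 - 8) * x^4 - 1/144 * (e * (8 * se * (se * (e + 2) - 2 * s + 3 * sx
      + 6 * sy) - 24 * se2 * (sx + 2 * sy) - 8 * s^2 + e + 2) + 16 * s * (sx - 6 * sy) - 16 * se2 * sx
      - 32 * se2 * sy - 8) * x^2 * y^2"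
    "K2 2 (Inl Qx) Qy = -1/144 * (e * (8 * se * (e * se - 2 * s + 2 * se) - 8 * s^2 + e + 2) - 64 * s * sy
      - 32 * s^2 - 8) * x^3 * y - 1/144 * (e * (8 * se * (se * (e + 2) - 2 * s + 3 * sx + 6 * sy)
      - 24 * se2 * (sx + 2 * sy) - 8 * s^2 + e + 2) - 16 * s * (2 * s + 3 * sx - 2 * sy) - 16 * se2 * sx
      - 32 * se2 * sy - 8) * x * y^3"
    "K2 2 (Inl Qy) Rho = 0"
    "K2 2 (Inl Qy) Qx = -1/144 * (e * (8 * se * (se * (e + 2) - 2 * s + 6 * sx + 3 * sy)
      - 24 * se2 * (2 * sx + sy) - 8 * s^2 + e + 2) - 16 * s * (2 * s - 2 * sx + 3 * sy) - 32 * se2 * sx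
      - 16 * se2 * sy - 8) * x^3 * y - 1/144 * (e * (8 * se * (e * se - 2 * s + 2 * se) - 8 * s^2 + e + 2)
      - 64 * s * sx - 32 * s^2 - 8) * x * y^3"
    "K2 2 (Inl Qy) Qy = 1/9 * (2 * s * sy - s^2) * x^4 - 1/144 * (e * (8 * se * (e * se - 2 * s + 2 * se)
      - 8 * s^2 + e + 2) - 16 * s^2 - 8) * y^4 - 1/144 * (e * (8 * se * (se * (e + 2) - 2 * s + 6 * sx
      + 3 * sy) - 24 * se2 * (2 * sx + sy) - 8 * s^2 + e + 2) - 16 * s * (6 * sx - sy) - 32 * se2 * sx
      - 16 * se2 * sy - 8) * x^2 * y^2"
    by (simp only: K2_def commutator_2 flux.simps K1_0_eq a_0_eq' K1_1_eq a_1_eq' K1_2_eq a_2_eq'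
      table_simps; ((simp; fail) | algebra))+
  have K3_2_eq:
    "K3 2 (Inl Rho) Qx = -1/72 * (e * (4 * se * (e * se - 2 * s + 2 * se) - 4 * s^2 + e + 2) - 8 * s^2
      - 8) * x^5 - 1/36 * (e * (2 * se * (2 * se * (e + 2) - 4 * s + 9 * sx + 9 * sy) - 18 * se2 * (sx
      + sy) - 4 * s^2 + e + 2) - 4 * s * (2 * s - 3 * sx + 9 * sy) - 12 * se2 * sx - 12 * se2 * sy
      - 8) * x^3 * y^2 - 1/72 * (e * (4 * se * (e * se - 2 * s + 2 * se) - 4 * s^2 + e + 2) - 48 * s * sx
      - 8 * s^2 - 8) * x * y^4"
    by (simp only: K3_def commutator_2 flux.simps K2_0_eq a_0_eq' K2_1_eq a_1_eq' K2_2_eq a_2_eq'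
      table_simps; ((simp; fail) | algebra))+
  have K4_0_eq:
    "K4 0 (Inl Rho) Rho = 1/12 * (e^2 + 2 * e - 8) * (x^4 + y^4) + 1/6 * (e^2 + 2 * e - 8) * x^2 * y^2"
    "K4 0 (Inl Rho) Qx = 0"
    "K4 0 (Inl Rho) Qy = 0"
    "K4 0 (Inl Qx) Rho = 0"
    "K4 0 (Inl Qx) Qx = 1/3 * y^4 - 1/12 * (e^2 + 4 * e - 12) * x^4 - 1/12 * (e^2 + 4 * e - 24) * x^2 * y^2"
    "K4 0 (Inl Qx) Qy = -1/12 * (e^2 + 4 * e - 16) * (x * y^3 + x^3 * y)"
    "K4 0 (Inl Qy) Rho = 0"
    "K4 0 (Inl Qy) Qx = -1/12 * (e^2 + 4 * e - 16) * (x * y^3 + x^3 * y)"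
    "K4 0 (Inl Qy) Qy = 1/3 * x^4 - 1/12 * (e^2 + 4 * e - 12) * y^4 - 1/12 * (e^2 + 4 * e - 24) * x^2 * y^2"
    by (simp only: K4_def commutator_0 flux.simps K3_0_eq a_0_eq' table_simps; ((simp; fail) | algebra))+
  have K5_0_eq:
    "K5 0 (Inl Rho) Qx = -1/6 * (e^2 + 3 * e - 10) * x^5 - 1/3 * (e^2 + 3 * e - 14) * x^3 * y^2
      - 1/6 * (e^2 + 3 * e - 14) * x * y^4"
    by (simp only: K5_def commutator_0 flux.simps K4_0_eq a_0_eq' table_simps; ((simp; fail) | algebra))+
  show ?a4
    by (simp only: a_4 flux.simps V_4 K3_2_eq K5_0_eq, algebra)
qed

section \<open>The isotropy conditions order by order\<close>

lemma isotropic_symbolD: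
  assumes "isotropic_symbol A" "c\<^sup>2 + s\<^sup>2 = 1"
  shows "A (c * x - s * y) (s * x + c * y) Rho Rho = A x y Rho Rho"
    and "A (c * x - s * y) (s * x + c * y) Rho Qx = c * A x y Rho Qx - s * A x y Rho Qy"
    and "A (c * x - s * y) (s * x + c * y) Rho Qy = s * A x y Rho Qx + c * A x y Rho Qy"
    and "A (c * x - s * y) (s * x + c * y) Qx Rho = c * A x y Qx Rho - s * A x y Qy Rho"
    and "A (c * x - s * y) (s * x + c * y) Qy Rho = s * A x y Qx Rho + c * A x y Qy Rho"
    and "A (c * x - s * y) (s * x + c * y) Qx Qx =
      c * (c * A x y Qx Qx - s * A x y Qy Qx) - s * (c * A x y Qx Qy - s * A x y Qy Qy)"
    and "A (c * x - s * y) (s * x + c * y) Qx Qy =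
      s * (c * A x y Qx Qx - s * A x y Qy Qx) + c * (c * A x y Qx Qy - s * A x y Qy Qy)"
    and "A (c * x - s * y) (s * x + c * y) Qy Qx =
      c * (s * A x y Qx Qx + c * A x y Qy Qx) - s * (s * A x y Qx Qy + c * A x y Qy Qy)"
    and "A (c * x - s * y) (s * x + c * y) Qy Qy =
      s * (s * A x y Qx Qx + c * A x y Qy Qx) + c * (s * A x y Qx Qy + c * A x y Qy Qy)"
  using assms by (auto simp: isotropic_symbol_def Let_def)

text \<open>Rational rotations keep all evaluations inside rational arithmetic. They do not preserve
  the square lattice, so they detect anisotropy that half and quarter turns cannot see.\<close>

lemma three_four_five: "(3/5::real)\<^sup>2 + (4/5)\<^sup>2 = 1"
  and four_three_five: "(4/5::real)\<^sup>2 + (3/5)\<^sup>2 = 1"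
  by (simp_all add: power2_eq_square)

text \<open>Clears powers and products at the evaluation points with coordinates 0, 1 and -1, while
  the polynomials in the parameters are left in place for linear or algebraic elimination.\<close>

lemma unit_point_simps:
  "(0::real) ^ 2 = 0" "(0::real) ^ 3 = 0" "(0::real) ^ 4 = 0" "(0::real) ^ 5 = 0"
  "(1::real) ^ n = 1" "(- 1::real) ^ 2 = 1" "(- 1::real) ^ 3 = - 1" "(- 1::real) ^ 4 = 1"
  "- (0::real) = 0" "t * 1 = t" "t * (0::real) = 0" "1 * t = t" "0 * t = 0" "t - 0 = t" "t + 0 = t" "0 + t = t"
  for t :: real
  by simp_all

text \<open>The half turn forces the blocks of the wrong parity to vanish.\<close>

lemma isotropic_symbol_half_turn:
  assumes "isotropic_symbol A"
  shows "A (- x) (- y) Rho Rho = A x y Rho Rho" "A (- x) (- y) Rho Qx = - A x y Rho Qx"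
    "A (- x) (- y) Rho Qy = - A x y Rho Qy" "A (- x) (- y) Qx Rho = - A x y Qx Rho"
    "A (- x) (- y) Qy Rho = - A x y Qy Rho" "A (- x) (- y) Qx Qx = A x y Qx Qx"
    "A (- x) (- y) Qx Qy = A x y Qx Qy" "A (- x) (- y) Qy Qx = A x y Qy Qx"
    "A (- x) (- y) Qy Qy = A x y Qy Qy"
  using isotropic_symbolD[OF assms, of "-1" 0 x y] by simp_all

lemma isotropic_symbol_quarter_turn:
  assumes "isotropic_symbol A"
  shows "A (- y) x Rho Qx = - A x y Rho Qy" "A (- y) x Qx Rho = - A x y Qy Rho"
    "A (- y) x Qy Rho = A x y Qx Rho" "A (- y) x Qx Qx = A x y Qy Qy"
    "A (- y) x Qx Qy = - A x y Qy Qx" "A (- y) x Qy Qy = A x y Qx Qx"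
  using isotropic_symbolD[OF assms, of 0 1 x y] by simp_all

text \<open>The momentum block is linear in \<xi> and must be even, so the half turn kills it; the
  quarter turn compares the two entries of the column \<rho> and gives k = m = 0.\<close>

lemma isotropic_first_order_iff:
  "isotropic_symbol (\<lambda>x y. conserved_table
     [[0, x, y],
      [x * (2/3 + e / 6 + k / 2) + y * m, x * (e1 / 6 + k1 / 2) + y * m1, x * (e2 / 6 + k2 / 2) + y * m2],
      [y * (2/3 + e / 6 - k / 2) + x * m, y * (e1 / 6 - k1 / 2) + x * m1, y * (e2 / 6 - k2 / 2) + x * m2]])
   \<longleftrightarrow> e1 = 0 \<and> e2 = 0 \<and> k = 0 \<and> k1 = 0 \<and> k2 = 0 \<and> m = 0 \<and> m1 = 0 \<and> m2 = 0"
  (is "isotropic_symbol ?A \<longleftrightarrow> ?C")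
proof
  assume A: "isotropic_symbol ?A"
  note h = isotropic_symbol_half_turn[OF A, unfolded table_simps] and q
    = isotropic_symbol_quarter_turn[OF A, unfolded table_simps]
  show ?C
    using h(6)[where x = 1 and y = 0] h(6)[where x = 0 and y = 1] h(7)[where x = 1 and y = 0] h(7)[where x
      = 0 and y = 1] h(8)[where x = 0 and y = 1] h(9)[where x = 0 and y = 1]
      q(2)[where x = 0 and y = 1] q(2)[where x = 1 and y = 0] unfolding unit_point_simps mult_minus_left
    by (intro conjI; linarith)
next
  assume ?C
  then show "isotropic_symbol ?A"
    by (intro isotropic_symbol_odd[where p = "\<lambda>_. 1" and q = "\<lambda>_. 2/3 + e / 6"]) (simp add: algebra_simps)
qed

text \<open>Parity removes p0 and r0 from the column \<rho>, the quarter turn gives p1 = r2 and r1 =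
  - p2, and the rotation (3/5, 4/5) gives both p2 = 0 and the value of r2. Positivity of
  \<open>sxx\<close> and \<open>sxy\<close> permits the divisions.\<close>

lemma isotropic_second_order_iff:
  fixes se sxx sxy :: real
  assumes "sxx > 0" "sxy > 0"
  shows "isotropic_symbol (\<lambda>x y. second_order_table e p0 p1 p2 r0 r1 r2 se sxx sxy x y)
   \<longleftrightarrow> p0 = 0 \<and> p2 = 0 \<and> r0 = 0 \<and> r1 = 0 \<and> p1 = r2 \<and> r2 = (sxx - 4 * sxy) / (2 * sxy + sxx)"
  (is "isotropic_symbol ?A \<longleftrightarrow> ?C")
proof
  assume A: "isotropic_symbol ?A"
  note h = isotropic_symbol_half_turn[OF A, unfolded second_order_table_def table_simps] and q
    = isotropic_symbol_quarter_turn[OF A, unfolded second_order_table_def table_simps]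
    and r = isotropic_symbolD[OF A, of "3/5" "4/5", unfolded second_order_table_def table_simps,
      OF three_four_five]
  have 0: "p0 = 0" "r0 = 0"
    using h(4)[where x = 0 and y = 1] h(5)[where x = 1 and y = 0] assms by simp_all
  have "sxy * (p1 - r2) = 0" "sxy * (p2 + r1) = 0"
    using q(4)[where x = 1 and y = 0] q(5)[where x = 1 and y = 0] by (simp_all add: algebra_simps)
  then have 1: "p1 = r2" "r1 = - p2"
    using assms by auto
  have p2: "p2 * (sxx + 2 * sxy) = 0" and r2: "r2 * (2 * sxy + sxx) = sxx - 4 * sxy"
    using r(6-9)[where x = 1 and y = 0] by (simp_all add: 1 field_simps power2_eq_square)
  have pos: "sxx + 2 * sxy > 0" "2 * sxy + sxx > 0" using assms by simp_all
  then have "p2 = 0" using p2 by (metis less_irrefl mult_eq_0_iff)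
  moreover have "r2 = (sxx - 4 * sxy) / (2 * sxy + sxx)" using r2 pos by (simp add: eq_divide_eq)
  ultimately show ?C using 0 1 by simp
next
  assume C: ?C
  then have r2: "r2 * (2 * sxy + sxx) = sxx - 4 * sxy"
    using assms by (simp add: field_simps)
  have C': "p0 = 0" "p2 = 0" "r0 = 0" "r1 = 0" "p1 = r2"
    using C by simp_all
  \<comment> \<open>v is read off from y^2 in the entry (q_x, q_x) and w from x y in the
    off-diagonal entry. That the coefficient of x^2 equals v + w is precisely the equation
    \<open>r2\<close>.\<close>
  show "isotropic_symbol ?A"
    apply (rule isotropic_symbol_even[where u = "\<lambda>_. 0" and v = "\<lambda>r. - 1/3 * sxy * (r2 + 2) * r"
        and w = "\<lambda>_. 1/6 * (e * se - r2 * se - r2 * sxx - 2 * r2 * sxy - se + sxx - 4 * sxy)"],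
      rule conserved_tableI)
    apply (simp_all only: second_order_table_def table_simps C')
    apply (algebra | (use r2 in algebra))+
    done
qed

text \<open>The row \<rho> alone forces d = -1, and with the second order relation for d this means
  \<open>sxy = sxx\<close>. The columns q_x and q_y of the momentum block have the wrong parity and
  yield the equations for g and h; the column \<rho> yields those for \<open>c\<close>.\<close>

lemma isotropic_third_order_iff:
  fixes sxx se sx sy :: real
  assumes pos: "sxx > 0" "sx > 0" "sy > 0" and d: "d * (2 * sxy + sxx) = sxx - 4 * sxy"
  shows "isotropic_symbol (\<lambda>x y. third_order_table d e f g h se sx sy sxx sxy x y)
   \<longleftrightarrow> sxx = sxy \<and> d = - 1 \<and>
     (2 * f + 4 + 3 * e = 0 \<and> g = 0 \<and> h = 0 \<or>
      sx = sy \<and> sy = 1 / (12 * sxx) \<and> g = 0 \<and> h = 0 \<or>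
      sx = sy \<and> sy = 1 / (12 * sxx) \<and> sxx = se)"
  (is "isotropic_symbol ?A \<longleftrightarrow> ?C")
proof
  assume A: "isotropic_symbol ?A"
  note half = isotropic_symbol_half_turn[OF A, unfolded third_order_table_def table_simps]
    and quarter = isotropic_symbol_quarter_turn[OF A, unfolded third_order_table_def table_simps]
    and rot = isotropic_symbolD[OF A, of "3/5" "4/5", unfolded third_order_table_def table_simps,
      OF three_four_five]
  have d': "d = - 1"
    using rot(2)[where x = 1 and y = 0] by (simp add: field_simps power2_eq_square power3_eq_cube)
  with d have s: "sxy = sxx" by simp
  note half' = half[unfolded s d'] and quarter' = quarter[unfolded s d'] and rot' = rot[unfolded s d']
  have g: "g * (se - sxx) * sx = 0"
    using half'(6)[where x = 1 and y = 0, unfolded unit_point_simps] by algebra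
  have g': "g * (4 * sxx * sx + 6 * sxx * sy + 2 * se * sy - 1) = 0"
    using half'(6)[where x = 1 and y = 1, unfolded unit_point_simps] g by algebra
  have g'': "g * (6 * sxx * sx + 4 * sxx * sy + 2 * se * sx - 1) = 0"
    using half'(8)[where x = 0 and y = 1, unfolded unit_point_simps] half'(8)[where x = 1 and y
      = 1, unfolded unit_point_simps] by algebra
  have h: "h * (se - sxx) * sx = 0"
    using half'(7)[where x = 1 and y = 0, unfolded unit_point_simps] by algebra
  have h': "h * (4 * sxx * sx + 6 * sxx * sy + 2 * se * sy - 1) = 0"
    using half'(7)[where x = 1 and y = 1, unfolded unit_point_simps] h by algebra
  have h'': "h * (6 * sxx * sx + 4 * sxx * sy + 2 * se * sx - 1) = 0"
    using half'(9)[where x = 0 and y = 1, unfolded unit_point_simps] half'(9)[where x = 1 and y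
      = 1, unfolded unit_point_simps] by algebra
  \<comment> \<open>The factor through which the equilibrium of \<epsilon>_2 in the column \<rho>
    enters every defect; alternative (i) is c = 0 together with g = h = 0.\<close>
  define c where "c = 2 * f + 4 + 3 * e"
  have c: "c * ((se - sxx) * (sx - sy)) = 0"
    unfolding c_def using quarter'(2)[where x = 0 and y = 1, unfolded unit_point_simps] by algebra
  have c': "c * (2 * (se - sxx) * sx - 4 * sxx * sx - 6 * sxx * sy - 2 * se * sy + 1) = 0"
    unfolding c_def using rot'(4)[where x = 1 and y = 0, unfolded unit_point_simps] by algebra
  have c'': "c * (2 * (se - sxx) * sy - 4 * sxx * sy - 6 * sxx * sx - 2 * se * sx + 1) = 0"
    unfolding c_def using rot'(5)[where x = 0 and y = 1, unfolded unit_point_simps] by algebra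
  \<comment> \<open>The two linear equations differ by 4 sxx (sx - sy), so sx = sy, and either one
    then reads 12 sxx sy = 1.\<close>
  have equal: "sx = sy \<and> sy = 1 / (12 * sxx)"
    if "4 * sxx * sx + 8 * sxx * sy = 1" "8 * sxx * sx + 4 * sxx * sy = 1"
  proof -
    have "sxx * (sx - sy) = 0" using that by algebra
    then have "sx = sy" using pos by simp
    then show ?thesis using that pos by (simp add: field_simps)
  qed
  have "2 * f + 4 + 3 * e = 0 \<and> g = 0 \<and> h = 0 \<or>
      sx = sy \<and> sy = 1 / (12 * sxx) \<and> g = 0 \<and> h = 0 \<or>
      sx = sy \<and> sy = 1 / (12 * sxx) \<and> sxx = se"
  \<comment> \<open>If the two are equal, a nonzero one among c, g, h produces both equations of
    \<open>equal\<close>, hence (iii). If they differ, g = h = 0, and a nonzero c forces sx = sy,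
    after which \<open>se\<close> drops out of \<open>c'\<close> and (ii) follows.\<close>
  proof (cases "se = sxx")
    case True
    show ?thesis
    proof (cases "c = 0 \<and> g = 0 \<and> h = 0")
      case False
      then consider "c \<noteq> 0" | "g \<noteq> 0" | "h \<noteq> 0" by blast
      then have "4 * sxx * sx + 8 * sxx * sy = 1 \<and> 8 * sxx * sx + 4 * sxx * sy = 1"
      proof cases
        case 1
        then have "2 * (se - sxx) * sx - 4 * sxx * sx - 6 * sxx * sy - 2 * se * sy + 1 = 0"
          "2 * (se - sxx) * sy - 4 * sxx * sy - 6 * sxx * sx - 2 * se * sx + 1 = 0"
          using c' c'' mult_eq_0_iff by blast+
        then show ?thesis unfolding True by (intro conjI; algebra)
      next
        case 2
        then have "4 * sxx * sx + 6 * sxx * sy + 2 * se * sy - 1 = 0"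
          "6 * sxx * sx + 4 * sxx * sy + 2 * se * sx - 1 = 0"
          using g' g'' mult_eq_0_iff by blast+
        then show ?thesis unfolding True by (intro conjI; algebra)
      next
        case 3
        then have "4 * sxx * sx + 6 * sxx * sy + 2 * se * sy - 1 = 0"
          "6 * sxx * sx + 4 * sxx * sy + 2 * se * sx - 1 = 0"
          using h' h'' mult_eq_0_iff by blast+
        then show ?thesis unfolding True by (intro conjI; algebra)
      qed
      then show ?thesis using equal True by simp
    qed (simp add: c_def)
  next
    case False
    then have gh: "g = 0" "h = 0" using g h pos by auto
    show ?thesis
    proof (cases "c = 0")
      case c0: False
      then have xy: "sx = sy" using c False by simp
      have "2 * (se - sxx) * sx - 4 * sxx * sx - 6 * sxx * sy - 2 * se * sy + 1 = 0"
        using c' c0 mult_eq_0_iff by blast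
      then have "sxx * (12 * sy) = 1" unfolding xy by algebra
      then show ?thesis using xy gh pos by (simp add: field_simps)
    qed (use gh in \<open>simp add: c_def\<close>)
  qed
  then show ?C using s d' by simp
next
  assume C: ?C
  then have C': "sxy = sxx" "d = - 1" by auto
  have sy: "sxx * (12 * sy) = 1" if "sy = 1 / (12 * sxx)"
    using that pos by simp
  from C consider "2 * f + 4 + 3 * e = 0" "g = 0" "h = 0" | "sx = sy" "sxx * (12 * sy) = 1" "g = 0" "h = 0"
    | "sx = sy" "sxx * (12 * sy) = 1" "sxx = se"
    using sy by blast
  note cases = this
  have g: "g * (se - sxx) * sx = 0" "g * (4 * sxx * sx + 6 * sxx * sy + 2 * se * sy - 1) = 0"
    "g * (se - sxx) * sy = 0" "g * (6 * sxx * sx + 4 * sxx * sy + 2 * se * sx - 1) = 0"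
    by (cases rule: cases; simp add: algebra_simps)+
  have h: "h * (se - sxx) * sx = 0" "h * (4 * sxx * sx + 6 * sxx * sy + 2 * se * sy - 1) = 0"
    "h * (se - sxx) * sy = 0" "h * (6 * sxx * sx + 4 * sxx * sy + 2 * se * sx - 1) = 0"
    by (cases rule: cases; simp add: algebra_simps)+
  have c: "(2 * f + 4 + 3 * e) * ((se - sxx) * (sx - sy)) = 0"
    "(2 * f + 4 + 3 * e) * (2 * (se - sxx) * sx - 4 * sxx * sx - 6 * sxx * sy - 2 * se * sy + 1) = 0"
    "(2 * f + 4 + 3 * e) * (2 * (se - sxx) * sy - 4 * sxx * sy - 6 * sxx * sx - 2 * se * sx + 1) = 0"
    by (cases rule: cases; simp add: algebra_simps)+
  \<comment> \<open>The coefficient of x^3 in the entry (q_x, \<rho>) at d = -1 and sxy = sxx. The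
    identities \<open>c\<close> say that the three other coefficients in this column have the same
    value.\<close>
  define Q where "Q = 1/216 * e * (6 * se * (e * se + 4 * se + 3 * sx) - 6 * sxx * (3 * sx + 2 * sxx) - e
    - 2) + 1/18 * sx * (f * (se - sxx) + 2 * se - 2 * sxx) - 2/9 * sxx^2 + 1/27"
  show "isotropic_symbol ?A"
    apply (rule isotropic_symbol_odd[where p = "\<lambda>r. 1/72 * (e - 2) * r" and q
      = "\<lambda>r. Q * r"], rule conserved_tableI)
    apply (simp_all only: third_order_table_def table_simps C')
    subgoal by algebra
    subgoal by algebra
    subgoal unfolding Q_def using c(2) by algebra
    subgoal using g(1,2) by algebra
    subgoal using h(1,2) by algebra
    subgoal unfolding Q_def using c(1,3) by algebra
    subgoal using g(3,4) by algebra
    subgoal using h(3,4) by algebra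
    done
qed

text \<open>Comparison with v Id + w \<xi> \<xi>^T: the transverse coefficients give sx = sy, and
  the remaining ones give polynomial equations in s, se, se2, sy and e, from which \<open>sy\<close>
  is eliminated to obtain se = s.\<close>

lemma isotropic_fourth_order_iff:
  fixes s se se2 sx sy :: real
  assumes pos: "s > 0" "se > 0" "se2 > 0" "sx > 0" "sy > 0"
  shows "isotropic_symbol (\<lambda>x y. fourth_order_table e s se se2 sx sy x y)
   \<longleftrightarrow> se = s \<and> sx = sy \<and> sy = 1 / (6 * s) \<and> (2 + 3 * e = 0 \<or> se2 = s)"
  (is "isotropic_symbol ?A \<longleftrightarrow> ?C")
proof
  assume A: "isotropic_symbol ?A"
  note quarter = isotropic_symbol_quarter_turn[OF A, unfolded fourth_order_table_def table_simps]
    and rot = isotropic_symbolD[OF A, of "3/5" "4/5", unfolded fourth_order_table_def table_simps,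
      OF three_four_five]
    and rot' = isotropic_symbolD[OF A, of "4/5" "3/5", unfolded fourth_order_table_def table_simps,
      OF four_three_five]
  have "s^2 * (sx - sy) = 0"
    using quarter(4)[where x = 1 and y = 0, unfolded unit_point_simps] by algebra
  then have xy: "sx = sy" using pos by simp
  \<comment> \<open>In the entry (q_x, q_y) the two rotations force the coefficients of x^3 y and x
    y^3 to be equal, and equal to the difference of the x^4 coefficients of the diagonal entries.
    \<open>r\<close> and \<open>e\<close> are combinations of these two conditions.\<close>
  have r: "12 * s * sy * (se + s) = 3 * s + se"
    using rot(7)[where x = 1 and y = 0, unfolded unit_point_simps xy] rot'(7)[where x = 1 and y
      = 0, unfolded unit_point_simps xy] by algebra
  have e: "(se - se2) * (12 * s * sy - 1) * (3 * e + 2) = 0"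
    using rot(7)[where x = 1 and y = 0, unfolded unit_point_simps xy] rot'(7)[where x = 1 and y
      = 0, unfolded unit_point_simps xy] by algebra
  have t: "1/2 * (se - se2) * (3 * e + 2) * (12 * s * sy - 1) - 24 * s * sy * se + 2 * (se + s) = 0"
    using rot(6)[where x = 1 and y = 0, unfolded unit_point_simps xy] by algebra
  \<comment> \<open>Multiplying \<open>r\<close> by se and inserting this relation eliminates sy: se
    (3 s + se) = (se + s)^2, which is s (se - s) = 0.\<close>
  have "24 * s * sy * se = 2 * (se + s)" using e t by algebra
  then have "se * (3 * s + se) = (se + s) * (se + s)" using r by algebra
  then have "s * (se - s) = 0" by algebra
  then have se: "se = s" using pos by simp
  then have sy: "6 * s * sy = 1" using r pos by (simp add: algebra_simps)
  then have "s = se2 \<or> 3 * e + 2 = 0" using e se by auto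
  then show ?C using se xy sy pos by (auto simp: field_simps)
next
  assume C: ?C
  then have C': "se = s" "sx = sy" and e: "(2 + 3 * e) * (se2 - s) = 0" and sy: "6 * s * sy = 1"
    using pos by auto
  \<comment> \<open>The coefficient of x^4 in the entry (\<rho>, \<rho>). \<open>X\<close> and
    \<open>Z\<close> below are the coefficients of x^4 and y^4 in (q_x, q_x), that is the
    longitudinal and transverse values, so v = Z |\<xi>|^4 and w = (X - Z) |\<xi>|^2.\<close>
  define U where "U = 1/432 * e^2 * s + 1/216 * e * s - 1/54 * s"
  define X where "X = 1/216 * s * (e * (2 * e * (6 * s^2 - 1) - 12 * s^2 - 1) - 24 * s^2 + 10)"
  define Z where "Z = 1/9 * s^3 + 1/36 * s - 2/9 * s^2 * sy"
  show "isotropic_symbol ?A"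
    apply (rule isotropic_symbol_even[where u = "\<lambda>r. U * r\<^sup>2" and v = "\<lambda>r. Z * r\<^sup>2"
        and w = "\<lambda>r. (X - Z) * r"], rule conserved_tableI)
    apply (simp_all only: fourth_order_table_def table_simps C')
    subgoal unfolding U_def by algebra
    subgoal unfolding X_def Z_def using e sy by algebra
    subgoal unfolding X_def Z_def using e sy by algebra
    subgoal unfolding X_def Z_def using e sy by algebra
    subgoal unfolding X_def Z_def using e sy by algebra
    done
qed

lemma relax_sigma_pos: "0 < s k \<Longrightarrow> s k < 2 \<Longrightarrow> relax_sigma s k > 0"
  by (simp add: relax_sigma_def field_simps)

text \<open>The entry (\<rho>, \<rho>) must be a multiple of (x^2 + y^2)^2; the excess in the
  coefficient of x^2 y^2 is a multiple of (2 f + 4 + 3 e) (sx + sy). The other two entries of the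
  row have even degree where odd parity is required.\<close>

lemma isotropic_symbol_fourth_order_rho:
  assumes A: "isotropic_symbol (A 3)" and pos: "sx > 0" "sy > 0"
    and expansion: "\<And>x y. \<exists>V D. moment_expansion x y E \<sigma> (\<lambda>n. A n x y) V D"
    and E: "E = nonconserved_table [[e, 0, 0], [f, g, h], [0, - 1, 0], [0, 0, - 1], [0, 0, 0], [0, 0, 0]]"
    and s: "\<sigma> = nonconserved_list [se, se2, sx, sy, s, s]"
  shows "2 * f + 4 + 3 * e = 0" "g = 0" "h = 0"
proof -
  have A_rho: "A 3 x y Rho Rho = 1/432 * (e * (e * se - 2 * s + 4 * se) - 8 * s) * (x^4 + y^4)
    + 1/216 * (e * (se * (e + 4) - 2 * s + 9 * sx + 9 * sy) + 6 * f * (sx + sy) - 8 * s + 12 * sx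
    + 12 * sy) * x^2 * y^2"
    "A 3 x y Rho Qx = 1/36 * (g * sx + g * sy) * x^2 * y^2"
    "A 3 x y Rho Qy = 1/36 * (h * sx + h * sy) * x^2 * y^2" for x y
  proof -
    obtain V D where "moment_expansion x y E \<sigma> (\<lambda>n. A n x y) V D" using expansion by blast
    from moment_expansion.a_3_rho_eq[OF this E s]
    show "A 3 x y Rho Rho = 1/432 * (e * (e * se - 2 * s + 4 * se) - 8 * s) * (x^4 + y^4)
      + 1/216 * (e * (se * (e + 4) - 2 * s + 9 * sx + 9 * sy) + 6 * f * (sx + sy) - 8 * s + 12 * sx
      + 12 * sy) * x^2 * y^2"
      "A 3 x y Rho Qx = 1/36 * (g * sx + g * sy) * x^2 * y^2"
      "A 3 x y Rho Qy = 1/36 * (h * sx + h * sy) * x^2 * y^2" .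
  qed
  have "(2 * f + 4 + 3 * e) * (sx + sy) = 0"
    using isotropic_symbolD(1)[OF A three_four_five, where x = 1 and y = 0]
    unfolding A_rho unit_point_simps by algebra
  then show "2 * f + 4 + 3 * e = 0" using pos by auto
  have "g * (sx + sy) = 0" "h * (sx + sy) = 0"
    using isotropic_symbol_half_turn(2,3)[OF A, where x = 1 and y = 1]
    unfolding A_rho unit_point_simps by (simp_all add: algebra_simps)
  then show "g = 0" "h = 0" using pos by auto
qed

text \<open>An isotropic even-free entry (\<rho>, q_x) invariant under y to -y would be \<alpha> x
  |\<xi>|^4. With 6 s sf = 1 and (2 + 3 e) (se2 - s) = 0 the coefficients of x^3 y^2 and x y^4 fall
  short of 2 \<alpha> and \<alpha> by exactly 1/135 and 1/270, independently of all
  parameters.\<close>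

lemma not_isotropic_symbol_fifth_order:
  assumes A: "isotropic_symbol (A 4)" and sf: "6 * s * sf = 1" and e: "(2 + 3 * e) * (se2 - s) = 0"
    and expansion: "\<And>x y. \<exists>V D. moment_expansion x y E \<sigma> (\<lambda>n. A n x y) V D"
    and E: "E = nonconserved_table [[e, 0, 0], [- 3/2 * e - 2, 0, 0], [0, - 1, 0], [0, 0,
      - 1], [0, 0, 0], [0, 0, 0]]"
    and s: "\<sigma> = nonconserved_list [s, se2, sf, sf, s, s]"
  shows False
proof -
  have A_rho: "A 4 x y Rho Qx = 1/4320 * (e * (20 * s * (e * s - 2 * s + 2 * s) - 20 * s^2 - e - 8)
    - 40 * s^2 + 20) * x^5 + 1/2160 * (e * (10 * s * (2 * s * (e + 2) - 4 * s + 9 * sf + 9 * sf)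
    - 90 * se2 * (sf + sf) - 20 * s^2 - e - 8) - 20 * s * (2 * s - 3 * sf + 9 * sf) - 60 * se2 * sf
    - 60 * se2 * sf + 44) * x^3 * y^2 + 1/4320 * (e * (20 * s * (e * s - 2 * s + 2 * s) - 20 * s^2 - e
    - 8) - 240 * s * sf - 40 * s^2 + 44) * x * y^4" for x y
  proof -
    obtain V D where "moment_expansion x y E \<sigma> (\<lambda>n. A n x y) V D" using expansion by blast
    from moment_expansion.a_3_a_4_eq(2)[OF this E s] show ?thesis .
  qed
  \<comment> \<open>The rotation and its inverse are used together: in the sum the value of the
    entry (\<rho>, q_y) cancels, so it never has to be computed.\<close>
  have "(3/5::real)\<^sup>2 + (- 4/5)\<^sup>2 = 1" by (simp add: power2_eq_square)
  note 1 = isotropic_symbolD(2)[OF A three_four_five, where x = 1 and y = 0]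
    and 2 = isotropic_symbolD(2)[OF A this, where x = 1 and y = 0]
  have "A 4 (3/5) (4/5) Rho Qx + A 4 (3/5) (- 4/5) Rho Qx = 2 * (3/5 * A 4 1 0 Rho Qx)"
    using 1 2 by simp
  then show False
    unfolding A_rho unit_point_simps using sf e by algebra
qed

theorem proposition8:
  fixes lam :: real
    and E :: "nonconserved \<Rightarrow> conserved \<Rightarrow> real"
    and s :: "nonconserved \<Rightarrow> real"
  assumes "lam > 0"
    and "\<And>k. 0 < s k \<and> s k < 2"
  shows
    "(\<forall>m\<in>{1..5}. isotropic_at_order lam E s m \<longleftrightarrow> lack_of_isotropy5_bigo lam E s (m + 1)) \<and>
     (isotropic_at_order lam E s 1 \<longleftrightarrow>
       E Epsi Qx = 0 \<and> E Epsi Qy = 0 \<and>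
       E PhiXX Rho = 0 \<and> E PhiXX Qx = 0 \<and> E PhiXX Qy = 0 \<and>
       E PhiXY Rho = 0 \<and> E PhiXY Qx = 0 \<and> E PhiXY Qy = 0) \<and>
     (isotropic_at_order lam E s 2 \<longleftrightarrow>
       isotropic_at_order lam E s 1 \<and>
       E PhiX Rho = 0 \<and> E PhiX Qy = 0 \<and> E PhiY Rho = 0 \<and> E PhiY Qx = 0 \<and>
       E PhiX Qx = E PhiY Qy \<and>
       E PhiY Qy = (relax_sigma s PhiXX - 4 * relax_sigma s PhiXY) / (2 * relax_sigma s PhiXY + relax_sigma s PhiXX)) \<and>
     (isotropic_at_order lam E s 3 \<longleftrightarrow>
       isotropic_at_order lam E s 2 \<and>
       (relax_sigma s PhiXX = relax_sigma s PhiXY \<and> E PhiX Qx = -1) \<and>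
       ((2 * E Epsi2 Rho + 4 + 3 * E Epsi Rho = 0 \<and> E Epsi2 Qx = 0 \<and> E Epsi2 Qy = 0) \<or>
        (relax_sigma s PhiX = relax_sigma s PhiY \<and> relax_sigma s PhiY = 1 / (12 * relax_sigma s PhiXX) \<and>
           E Epsi2 Qx = 0 \<and> E Epsi2 Qy = 0) \<or>
        (relax_sigma s PhiX = relax_sigma s PhiY \<and> relax_sigma s PhiY = 1 / (12 * relax_sigma s PhiXX) \<and>
           relax_sigma s PhiXX = relax_sigma s Epsi))) \<and>
     (isotropic_at_order lam E s 4 \<longleftrightarrow>
       isotropic_at_order lam E s 3 \<and>
       (2 * E Epsi2 Rho + 4 + 3 * E Epsi Rho = 0 \<and> relax_sigma s Epsi = relax_sigma s PhiXX \<and>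
        E Epsi2 Qx = 0 \<and> E Epsi2 Qy = 0 \<and>
        relax_sigma s PhiX = relax_sigma s PhiY \<and> relax_sigma s PhiY = 1 / (6 * relax_sigma s PhiXX)) \<and>
       (2 + 3 * E Epsi Rho = 0 \<or> relax_sigma s Epsi2 = relax_sigma s PhiXX)) \<and>
     (\<not> lack_of_isotropy5_bigo lam E s 6)"
proof -
  have nz: "lam \<noteq> 0" "\<And>k. s k \<noteq> 0"
    using assms(1) assms(2) by (simp, metis less_irrefl)
  define \<sigma> where "\<sigma> = relax_sigma s"
  have \<sigma>_pos: "\<sigma> k > 0" for k
    using assms(2)[of k] by (simp add: \<sigma>_def relax_sigma_pos)
  \<comment> \<open>Here \<open>A n\<close> is the symbol of A_(n+1), the index being the power of
    \<Delta>t; accordingly \<open>iso n\<close> decides the passage from order n to order n +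
    1.\<close>
  define A where "A n x y = scaled_symbol lam E s x y n" for n x y
  define iso where "iso n \<longleftrightarrow> isotropic_symbol (A n)" for n
  have A: "\<exists>V D. moment_expansion x y E \<sigma> (\<lambda>n. A n x y) V D" for x y
    using scaled_symbol_expansion[where lam = lam and s = s and E = E and x = x and y = y, OF nz]
    unfolding A_def \<sigma>_def by blast
  have at_order: "isotropic_at_order lam E s m \<longleftrightarrow> (\<forall>n<m. iso n)" for m
    unfolding isotropic_at_order_iff[where lam = lam and s = s, OF nz] iso_def A_def ..
  have at_order_Suc: "isotropic_at_order lam E s (Suc m) \<longleftrightarrow> isotropic_at_order lam E s m \<and> iso m" for m
    unfolding at_order by (auto simp: less_Suc_eq)
  have \<sigma>_list: "\<sigma> = nonconserved_list [\<sigma> Epsi, \<sigma> Epsi2, \<sigma> PhiX, \<sigma> PhiY, \<sigma> PhiXX, \<sigma> PhiXY]"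
    by (rule nonconserved_listI)

  let ?C1 = "E Epsi Qx = 0 \<and> E Epsi Qy = 0 \<and> E PhiXX Rho = 0 \<and> E PhiXX Qx = 0 \<and> E PhiXX Qy = 0 \<and>
       E PhiXY Rho = 0 \<and> E PhiXY Qx = 0 \<and> E PhiXY Qy = 0"
  let ?C2 = "E PhiX Rho = 0 \<and> E PhiX Qy = 0 \<and> E PhiY Rho = 0 \<and> E PhiY Qx = 0 \<and> E PhiX Qx = E PhiY Qy \<and>
       E PhiY Qy = (\<sigma> PhiXX - 4 * \<sigma> PhiXY) / (2 * \<sigma> PhiXY + \<sigma> PhiXX)"
  let ?C3 = "(\<sigma> PhiXX = \<sigma> PhiXY \<and> E PhiX Qx = -1) \<and>
       ((2 * E Epsi2 Rho + 4 + 3 * E Epsi Rho = 0 \<and> E Epsi2 Qx = 0 \<and> E Epsi2 Qy = 0) \<or>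
        (\<sigma> PhiX = \<sigma> PhiY \<and> \<sigma> PhiY = 1 / (12 * \<sigma> PhiXX) \<and> E Epsi2 Qx = 0 \<and> E Epsi2 Qy = 0) \<or>
        (\<sigma> PhiX = \<sigma> PhiY \<and> \<sigma> PhiY = 1 / (12 * \<sigma> PhiXX) \<and> \<sigma> PhiXX = \<sigma> Epsi))"
  let ?C4 = "(2 * E Epsi2 Rho + 4 + 3 * E Epsi Rho = 0 \<and> \<sigma> Epsi = \<sigma> PhiXX \<and> E Epsi2 Qx = 0 \<and> E Epsi2 Qy = 0 \<and>
        \<sigma> PhiX = \<sigma> PhiY \<and> \<sigma> PhiY = 1 / (6 * \<sigma> PhiXX)) \<and>
       (2 + 3 * E Epsi Rho = 0 \<or> \<sigma> Epsi2 = \<sigma> PhiXX)"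

  \<comment> \<open>\<open>V\<close> and \<open>D\<close> depend on the point (x, y). A table valid
    for every expansion therefore identifies the symbol as a function of that point.\<close>
  have A_eq: "A n = T" if "\<And>x y a V D. moment_expansion x y E \<sigma> a V D \<Longrightarrow> a n = T x y" for n T
  proof (intro ext)
    fix x y
    obtain V D where "moment_expansion x y E \<sigma> (\<lambda>n. A n x y) V D" using A by blast
    then show "A n x y i j = T x y i j" for i j using that by metis
  qed
  have iso_0: "iso 0 \<longleftrightarrow> ?C1"
    unfolding iso_def by (subst A_eq, erule moment_expansion.a_0_eq, subst isotropic_first_order_iff, blast)
  have iso_1: "iso 1 \<longleftrightarrow> ?C2" if C1: ?C1
  proof -
    have E: "E = nonconserved_table
      [[E Epsi Rho, 0, 0], [E Epsi2 Rho, E Epsi2 Qx, E Epsi2 Qy], [E PhiX Rho, E PhiX Qx, E PhiX Qy],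
       [E PhiY Rho, E PhiY Qx, E PhiY Qy], [0, 0, 0], [0, 0, 0]]"
      by (rule nonconserved_tableI) (simp_all add: C1)
    show ?thesis
      unfolding iso_def by (subst A_eq, erule moment_expansion.a_1_eq[OF _ E \<sigma>_list],
        subst isotropic_second_order_iff[OF \<sigma>_pos \<sigma>_pos], blast)
  qed
  have iso_2: "iso 2 \<longleftrightarrow> ?C3" if C: ?C1 ?C2
  proof -
    have E: "E = nonconserved_table
      [[E Epsi Rho, 0, 0], [E Epsi2 Rho, E Epsi2 Qx, E Epsi2 Qy], [0, E PhiX Qx, 0],
       [0, 0, E PhiX Qx], [0, 0, 0], [0, 0, 0]]"
      by (rule nonconserved_tableI) (use C in simp_all)
    have "2 * \<sigma> PhiXY + \<sigma> PhiXX > 0" using \<sigma>_pos by (simp add: add_pos_pos)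
    then have d: "E PhiX Qx * (2 * \<sigma> PhiXY + \<sigma> PhiXX) = \<sigma> PhiXX - 4 * \<sigma> PhiXY"
      using C by (simp add: eq_divide_eq)
    show ?thesis
      unfolding iso_def by (subst A_eq, erule moment_expansion.low_order_eq(7)[OF _ E \<sigma>_list],
        subst isotropic_third_order_iff[OF \<sigma>_pos \<sigma>_pos \<sigma>_pos d], blast)
  qed
  have iso_3: "iso 3 \<longleftrightarrow> ?C4" if C: ?C1 ?C2 ?C3
  proof -
    have \<sigma>_list': "\<sigma> = nonconserved_list [\<sigma> Epsi, \<sigma> Epsi2, \<sigma> PhiX, \<sigma> PhiY, \<sigma> PhiXX, \<sigma> PhiXX]"
      using \<sigma>_list C(3) by simp
    have E: "E = nonconserved_table
      [[E Epsi Rho, 0, 0], [E Epsi2 Rho, E Epsi2 Qx, E Epsi2 Qy], [0, -1, 0], [0, 0, -1], [0, 0, 0], [0, 0, 0]]"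
      by (rule nonconserved_tableI) (use C in simp_all)
    \<comment> \<open>Isotropy of A_4 enters twice: its row \<rho> fixes the row of \<epsilon>_2 in
      \<open>E\<close>, and only with these values inserted is the full table of A_4
      compared.\<close>
    have rho: "2 * E Epsi2 Rho + 4 + 3 * E Epsi Rho = 0 \<and> E Epsi2 Qx = 0 \<and> E Epsi2 Qy = 0" if "iso 3"
      using isotropic_symbol_fourth_order_rho[OF that[unfolded iso_def] \<sigma>_pos \<sigma>_pos A E \<sigma>_list'] by blast
    have "iso 3 \<longleftrightarrow> \<sigma> Epsi = \<sigma> PhiXX \<and> \<sigma> PhiX = \<sigma> PhiY \<and> \<sigma> PhiY = 1 / (6 * \<sigma> PhiXX) \<and>
        (2 + 3 * E Epsi Rho = 0 \<or> \<sigma> Epsi2 = \<sigma> PhiXX)"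
      if "2 * E Epsi2 Rho + 4 + 3 * E Epsi Rho = 0 \<and> E Epsi2 Qx = 0 \<and> E Epsi2 Qy = 0"
    proof -
      have E: "E = nonconserved_table
        [[E Epsi Rho, 0, 0], [- 3/2 * E Epsi Rho - 2, 0, 0], [0, -1, 0], [0, 0, -1], [0, 0, 0], [0, 0, 0]]"
        by (rule nonconserved_tableI) (use C that in simp_all)
      show ?thesis
        unfolding iso_def by (subst A_eq, erule moment_expansion.a_3_a_4_eq(1)[OF _ E \<sigma>_list'],
          rule isotropic_fourth_order_iff[OF \<sigma>_pos \<sigma>_pos \<sigma>_pos \<sigma>_pos \<sigma>_pos])
    qed
    then show ?thesis using rho by blast
  qed
  have iso_4: "\<not> iso 4" if C: ?C1 ?C2 ?C3 ?C4
  proof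
    assume "iso 4"
    have \<sigma>_list': "\<sigma> = nonconserved_list [\<sigma> PhiXX, \<sigma> Epsi2, \<sigma> PhiY, \<sigma> PhiY, \<sigma> PhiXX, \<sigma> PhiXX]"
      using \<sigma>_list C(3,4) by simp
    have E: "E = nonconserved_table
      [[E Epsi Rho, 0, 0], [- 3/2 * E Epsi Rho - 2, 0, 0], [0, -1, 0], [0, 0, -1], [0, 0, 0], [0, 0, 0]]"
      by (rule nonconserved_tableI) (use C in simp_all)
    have "6 * \<sigma> PhiXX * \<sigma> PhiY = 1" "(2 + 3 * E Epsi Rho) * (\<sigma> Epsi2 - \<sigma> PhiXX) = 0"
      using C(4) \<sigma>_pos[of PhiXX] by auto
    from not_isotropic_symbol_fifth_order[OF \<open>iso 4\<close>[unfolded iso_def] this A E \<sigma>_list']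
    show False .
  qed

  have order: "isotropic_at_order lam E s 1 \<longleftrightarrow> ?C1"
    "isotropic_at_order lam E s 2 \<longleftrightarrow> isotropic_at_order lam E s 1 \<and> ?C2"
    "isotropic_at_order lam E s 3 \<longleftrightarrow> isotropic_at_order lam E s 2 \<and> ?C3"
    "isotropic_at_order lam E s 4 \<longleftrightarrow> isotropic_at_order lam E s 3 \<and> ?C4"
    "\<not> isotropic_at_order lam E s 5"
  proof -
    have step: "isotropic_at_order lam E s (m + 1) \<longleftrightarrow> isotropic_at_order lam E s m \<and> P"
      if "isotropic_at_order lam E s m \<Longrightarrow> iso m \<longleftrightarrow> P" for m P
      using that at_order_Suc[of m] by auto
    show 1: "isotropic_at_order lam E s 1 \<longleftrightarrow> ?C1"
      using iso_0 by (simp add: at_order)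
    show 2: "isotropic_at_order lam E s 2 \<longleftrightarrow> isotropic_at_order lam E s 1 \<and> ?C2"
      using step[of 1, OF iso_1[OF 1[THEN iffD1]]] by (simp only: one_add_one)
    show 3: "isotropic_at_order lam E s 3 \<longleftrightarrow> isotropic_at_order lam E s 2 \<and> ?C3"
    proof -
      have "iso 2 \<longleftrightarrow> ?C3" if "isotropic_at_order lam E s 2"
        using that[unfolded 2] 1 by (intro iso_2) blast+
      from step[OF this] show ?thesis by simp
    qed
    show 4: "isotropic_at_order lam E s 4 \<longleftrightarrow> isotropic_at_order lam E s 3 \<and> ?C4"
    proof -
      have "iso 3 \<longleftrightarrow> ?C4" if "isotropic_at_order lam E s 3"
        using that[unfolded 3 2] 1 by (intro iso_3) blast+
      from step[OF this] show ?thesis by simp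
    qed
    have "\<not> iso 4" if "isotropic_at_order lam E s 4"
      using that[unfolded 4 3 2] 1 by (intro iso_4) blast+
    then show "\<not> isotropic_at_order lam E s 5"
      using at_order_Suc[of 4] by auto
  qed
  have "\<not> lack_of_isotropy5_bigo lam E s 6"
    using order(5) isotropic_at_order_iff_bigo[of 5 lam E s] by simp
  moreover have "\<forall>m\<in>{1..5}. isotropic_at_order lam E s m \<longleftrightarrow> lack_of_isotropy5_bigo lam E s (m + 1)"
    using isotropic_at_order_iff_bigo by simp
  ultimately show ?thesis
    using order(1-4) unfolding \<sigma>_def by (intro conjI)
qed

end
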